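(* The integrated density of states of the Landau Hamiltonian $H_3$ on $\mathbb R^3$ admits the asymptotic expansion $$N(\lambda;H_3)=\frac{1}{6\pi^2}\lambda^{3/2}+O(1)$$ for large enough $\lambda$.
   Context: Let $D_j=-i\,\partial/\partial x_j$. The Landau Hamiltonian on $\mathbb R^3$ is $H_3=(D_1+x_2)^2+D_2^2+D_3^2$. Its integrated density of states is $$N(\lambda;H_3)=\lim_{L\to\infty}\frac{\tilde N(\lambda;H_L)}{L^3},$$ where $H_L$ is the restriction of $H_3$ to the cube $[0,L]^3$ with periodic boundary conditions in $x_1$ and Dirichlet boundary conditions in $(x_2,x_3)$, and $\tilde N(\lambda;H_L)$ is the counting function (with multiplicity) of the discrete eigenvalues of $H_L$ not exceeding $\lambda$. *)

theory Defs
  imports "HOL-Analysis.Analysis" "HOL-Library.Landau_Symbols"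
begin

section \<open>The differential expression\<close>

definition partial :: "3 \<Rightarrow> (real^3 \<Rightarrow> complex) \<Rightarrow> real^3 \<Rightarrow> complex" where
  "partial j u x = frechet_derivative u (at x) (axis j 1)"

definition D :: "3 \<Rightarrow> (real^3 \<Rightarrow> complex) \<Rightarrow> real^3 \<Rightarrow> complex" where
  "D j u x = - \<i> * partial j u x"

definition magnetic_D1 :: "(real^3 \<Rightarrow> complex) \<Rightarrow> real^3 \<Rightarrow> complex" where
  "magnetic_D1 u x = D 1 u x + complex_of_real (x $ 2) * u x"

definition landau_H :: "(real^3 \<Rightarrow> complex) \<Rightarrow> real^3 \<Rightarrow> complex" where
  "landau_H u x = magnetic_D1 (magnetic_D1 u) x + D 2 (D 2 u) x + D 3 (D 3 u) x"

definition C1_fun :: "(real^3 \<Rightarrow> complex) \<Rightarrow> bool" where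
  "C1_fun u \<longleftrightarrow> u differentiable_on UNIV \<and> (\<forall>j. continuous_on UNIV (partial j u))"

definition C2_fun :: "(real^3 \<Rightarrow> complex) \<Rightarrow> bool" where
  "C2_fun u \<longleftrightarrow> C1_fun u \<and> (\<forall>j. C1_fun (partial j u))"


section \<open>The operator on the cube\<close>

definition cube :: "real \<Rightarrow> (real^3) set" where
  "cube L = cbox 0 (\<chi> i. L)"

text \<open>
  Functions that are \<open>C\<^sup>2\<close> up to the boundary of the cube are represented by \<open>C\<^sup>2\<close>
  functions on the whole space. Periodicity is imposed on the whole space, so that the
  derivatives match on the faces \<open>x\<^sub>1 = 0\<close> and \<open>x\<^sub>1 = L\<close> as well.
\<close>

definition landau_core :: "real \<Rightarrow> (real^3 \<Rightarrow> complex) set" where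
  "landau_core L = {u. C2_fun u
     \<and> (\<forall>x. u (x + axis 1 L) = u x)
     \<and> (\<forall>x\<in>cube L. x $ 2 = 0 \<or> x $ 2 = L \<or> x $ 3 = 0 \<or> x $ 3 = L \<longrightarrow> u x = 0)}"

definition L2_cube :: "real \<Rightarrow> (real^3 \<Rightarrow> complex) set" where
  "L2_cube L = {u. u \<in> borel_measurable (lebesgue_on (cube L))
     \<and> integrable (lebesgue_on (cube L)) (\<lambda>x. (norm (u x))\<^sup>2)}"

definition L2_tendsto :: "real \<Rightarrow> (nat \<Rightarrow> real^3 \<Rightarrow> complex) \<Rightarrow> (real^3 \<Rightarrow> complex) \<Rightarrow> bool" where
  "L2_tendsto L f u \<longleftrightarrow>
     (\<lambda>n. LINT x|lebesgue_on (cube L). (norm (f n x - u x))\<^sup>2) \<longlonglongrightarrow> 0"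

text \<open>
  The self-adjoint operator \<open>H\<^sub>L\<close> on \<open>L\<^sup>2\<close> of the cube, given by its graph: \<open>u\<close> is in the
  domain and \<open>H\<^sub>L u = w\<close>. It is the closure of the differential expression on
  \<open>landau_core L\<close>, which is essentially self-adjoint there. Elements of \<open>L\<^sup>2\<close> are represented
  by functions, and the relation respects almost everywhere equality in both arguments.
\<close>

definition landau_op :: "real \<Rightarrow> (real^3 \<Rightarrow> complex) \<Rightarrow> (real^3 \<Rightarrow> complex) \<Rightarrow> bool" where
  "landau_op L u w \<longleftrightarrow> u \<in> L2_cube L \<and> w \<in> L2_cube L
     \<and> (\<exists>f. (\<forall>n. f n \<in> landau_core L)
            \<and> L2_tendsto L f u \<and> L2_tendsto L (\<lambda>n. landau_H (f n)) w)"


section \<open>Eigenvalue counting and integrated density of states\<close>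

definition eigenspace :: "real \<Rightarrow> real \<Rightarrow> (real^3 \<Rightarrow> complex) set" where
  "eigenspace L \<mu> = {u. landau_op L u (\<lambda>x. complex_of_real \<mu> * u x)}"

definition L2_independent :: "real \<Rightarrow> nat \<Rightarrow> (nat \<Rightarrow> real^3 \<Rightarrow> complex) \<Rightarrow> bool" where
  "L2_independent L n f \<longleftrightarrow>
     (\<forall>c :: nat \<Rightarrow> complex.
        (AE x in lebesgue_on (cube L). (\<Sum>i<n. c i * f i x) = 0) \<longrightarrow> (\<forall>i<n. c i = 0))"

text \<open>
  The dimension over the complex numbers of the eigenspace as a subspace of \<open>L\<^sup>2\<close>, i.e. modulo
  almost everywhere equality. It is 0 unless \<open>\<mu>\<close> is an eigenvalue. The value is extended so that
  infinite multiplicities or infinitely many eigenvalues would not be counted as 0.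
\<close>

definition multiplicity_at :: "real \<Rightarrow> real \<Rightarrow> ennreal" where
  "multiplicity_at L \<mu> =
     (SUP n\<in>{n. \<exists>f. (\<forall>i<n. f i \<in> eigenspace L \<mu>) \<and> L2_independent L n f}. of_nat n)"

definition landau_count :: "real \<Rightarrow> real \<Rightarrow> ennreal" where
  "landau_count L E = (\<Sum>\<^sub>\<infinity>\<mu>\<in>{..E}. multiplicity_at L \<mu>)"

definition landau_ids :: "real \<Rightarrow> real" where
  "landau_ids E = enn2real (Lim at_top (\<lambda>L. landau_count L E / ennreal (L ^ 3)))"

end

theory Submission
  imports Defs "HOL-Real_Asymp.Real_Asymp"
begin

text \<open>
  Separation of variables. A function \<open>exp (\<i> k x\<^sub>1) y (x\<^sub>2 + k) sin (\<pi> (m + 1) x\<^sub>3 / L)\<close> with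
  \<open>k = 2 \<pi> n / L\<close> is an eigenfunction for \<open>\<mu>\<close> as soon as \<open>y\<close> solves the harmonic oscillator equation
  \<open>y'' = (t\<^sup>2 - \<nu>) y\<close> on \<open>[k, k + L]\<close> with Dirichlet conditions, where
  \<open>\<nu> = \<mu> - (\<pi> (m + 1) / L)\<^sup>2\<close>. The Dirichlet eigenvalues of one interval are simple, so the separated
  eigenfunctions for \<open>\<mu>\<close> are indexed by a set of pairs \<open>(n, m)\<close>, and
  \<open>multiplicity_at_eq\<close> shows that they exhaust the eigenspace. No spectral theorem is
  involved: an eigenfunction of the closed operator is tested with separated functions whose profile
  solves the Dirichlet problem for a polynomial right hand side. By the Fredholm
  alternative this gives orthogonality to the right hand sides up to one number for each pair,
  and a function orthogonal to all of them vanishes by \<open>modes_complete\<close>.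

  Hence the counting function is the number of triples consisting of \<open>n\<close>, \<open>m\<close> and an
  oscillator eigenvalue \<open>\<nu> \<le> E - (\<pi> (m + 1) / L)\<^sup>2\<close> on the interval at \<open>k\<close>. On the whole line
  these eigenvalues would be the Landau levels \<open>2 j + 1\<close>. On an interval there are never more
  (\<open>dirichlet_eigenvalues_le\<close>): by the ladder operators the energy is at least \<open>2 J + 1\<close> times
  the squared norm on the complement of the first \<open>J\<close> Hermite functions. On an interval that contains
  \<open>[- R, R]\<close> with \<open>R\<close> large there are almost as many (\<open>dirichlet_eigenvalues_ge\<close>): cut-off Hermite
  functions are good trial functions, and Sturm's oscillation argument converts their negative
  energy into eigenvalues. Of the frequencies that can contribute at all, about
  \<open>L\<^sup>2 / (2 \<pi>)\<close>, all but a number of order \<open>L\<close> belong to such long intervals. Since the third direction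
  contributes \<open>L sqrt (E - 2 j - 1) / \<pi>\<close> states for the level \<open>j\<close>, the limit density is
  \<open>1 / (2 \<pi>\<^sup>2)\<close> times the sum of \<open>sqrt (E - 2 j - 1)\<close> over the levels below \<open>E\<close>.

  This sum is the midpoint rule with step 2 for half the integral of \<open>sqrt\<close> over \<open>[0, E]\<close>, which is
  \<open>E powr (3/2) / 3\<close>. The error of the midpoint rule is bounded by telescoping second differences
  of the concave function \<open>sqrt\<close>, hence is bounded uniformly in \<open>E\<close>.
\<close>

section \<open>Underdetermined linear systems\<close>

lemma exists_nontrivial_solution:
  fixes v :: "nat \<Rightarrow> nat \<Rightarrow> 'a::field"
  assumes "q < p"
  shows "\<exists>c. (\<exists>i<p. c i \<noteq> 0) \<and> (\<forall>r<q. (\<Sum>i<p. c i * v r i) = 0)"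
  using assms
proof (induction q arbitrary: p v)
  case 0
  then show ?case by (intro exI[of _ "\<lambda>_. 1"]) auto
next
  case (Suc q)
  show ?case
  proof (cases "\<forall>i<p. v q i = 0")
    case True
    obtain c where c: "\<exists>i<p. c i \<noteq> 0" "\<forall>r<q. (\<Sum>i<p. c i * v r i) = 0"
      using Suc.IH[of p v] Suc.prems by auto
    have "(\<Sum>i<p. c i * v q i) = 0" using True by simp
    with c show ?thesis by (metis less_Suc_eq)
  next
    case False
    then obtain s where s: "s < p" "v q s \<noteq> 0" by auto
    obtain m where m: "p = Suc m" using s(1) by (cases p) auto
    define \<sigma> where "\<sigma> i = (if i < s then i else Suc i)" for i
    have bij: "bij_betw \<sigma> {..<m} ({..<p} - {s})"
      unfolding bij_betw_def
    proof
      show "inj_on \<sigma> {..<m}" by (auto simp: inj_on_def \<sigma>_def split: if_splits)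
      show "\<sigma> ` {..<m} = {..<p} - {s}"
      proof
        show "\<sigma> ` {..<m} \<subseteq> {..<p} - {s}" using s m by (auto simp: \<sigma>_def)
        show "{..<p} - {s} \<subseteq> \<sigma> ` {..<m}"
        proof
          fix i assume i: "i \<in> {..<p} - {s}"
          show "i \<in> \<sigma> ` {..<m}"
          proof (cases "i < s")
            case True
            then show ?thesis using s m by (intro image_eqI[of _ _ i]) (auto simp: \<sigma>_def)
          next
            case False
            then show ?thesis using i s m by (intro image_eqI[of _ _ "i - 1"]) (auto simp: \<sigma>_def)
          qed
        qed
      qed
    qed
    \<comment> \<open>Eliminate the unknown with index s by means of the last equation.\<close>
    define w where "w r i = v r (\<sigma> i) - v r s / v q s * v q (\<sigma> i)" for r i
    obtain d where d: "\<exists>i<m. d i \<noteq> 0" "\<forall>r<q. (\<Sum>i<m. d i * w r i) = 0"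
      using Suc.IH[of m w] Suc.prems m by auto
    define c where "c i = (if i = s then - (\<Sum>j<m. d j * v q (\<sigma> j)) / v q s
       else d (inv_into {..<m} \<sigma> i))" for i
    have c\<sigma>: "c (\<sigma> i) = d i" if "i < m" for i
    proof -
      have "\<sigma> i \<noteq> s" by (auto simp: \<sigma>_def)
      moreover have "inv_into {..<m} \<sigma> (\<sigma> i) = i"
        using bij that by (simp add: bij_betw_def)
      ultimately show ?thesis by (simp add: c_def)
    qed
    have split: "(\<Sum>i<p. c i * v r i) = c s * v r s + (\<Sum>j<m. d j * v r (\<sigma> j))" for r
    proof -
      have "(\<Sum>i<p. c i * v r i) = c s * v r s + (\<Sum>i\<in>{..<p}-{s}. c i * v r i)"
        using s by (simp add: sum.remove)
      also have "(\<Sum>i\<in>{..<p}-{s}. c i * v r i) = (\<Sum>j<m. c (\<sigma> j) * v r (\<sigma> j))"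
        by (rule sum.reindex_bij_betw[OF bij, symmetric])
      also have "\<dots> = (\<Sum>j<m. d j * v r (\<sigma> j))" by (intro sum.cong) (auto simp: c\<sigma>)
      finally show ?thesis .
    qed
    have cs: "c s = - (\<Sum>j<m. d j * v q (\<sigma> j)) / v q s" by (simp add: c_def)
    have "(\<Sum>i<p. c i * v r i) = 0" if "r < Suc q" for r
    proof (cases "r = q")
      case True
      then show ?thesis using s by (simp add: split cs)
    next
      case False
      then have "(\<Sum>j<m. d j * w r j) = 0" using d that by simp
      moreover have "(\<Sum>j<m. d j * w r j)
          = (\<Sum>j<m. d j * v r (\<sigma> j)) - v r s / v q s * (\<Sum>j<m. d j * v q (\<sigma> j))"
        by (simp add: w_def algebra_simps sum_subtractf sum_distrib_left)
      ultimately show ?thesis by (simp add: split cs)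
    qed
    moreover have "\<exists>i<p. c i \<noteq> 0"
      using d(1) c\<sigma> bij by (metis bij_betwE c\<sigma> lessThan_iff Diff_iff)
    ultimately show ?thesis by blast
  qed
qed

section \<open>Solutions of the oscillator equation\<close>

text \<open>
  The power series coefficients of the solution of \<open>y'' = (t\<^sup>2 - \<nu>) y - g\<close> with \<open>y 0 = \<alpha>\<close> and
  \<open>y' 0 = \<beta>\<close>. Power series give solutions on the whole line that depend continuously on \<open>t\<close> and
  \<open>\<nu>\<close> together.
\<close>

fun osc_coeff :: "real \<Rightarrow> real \<Rightarrow> real poly \<Rightarrow> real \<Rightarrow> nat \<Rightarrow> real" where
  "osc_coeff \<alpha> \<beta> g \<nu> 0 = \<alpha>"
| "osc_coeff \<alpha> \<beta> g \<nu> (Suc 0) = \<beta>"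
| "osc_coeff \<alpha> \<beta> g \<nu> (Suc (Suc n)) =
     ((if 2 \<le> n then osc_coeff \<alpha> \<beta> g \<nu> (n - 2) else 0)
       - \<nu> * osc_coeff \<alpha> \<beta> g \<nu> n - coeff g n) / (real (Suc n) * real (Suc (Suc n)))"

text \<open>
  The denominators in the recursion grow, so the coefficients decay faster than any geometric
  sequence, uniformly for bounded \<open>\<nu>\<close>.
\<close>

lemma osc_coeff_bound:
  assumes "1 \<le> R" "0 \<le> K"
  shows "\<exists>C. \<forall>\<nu>\<in>{-K..K}. \<forall>n. \<bar>osc_coeff \<alpha> \<beta> g \<nu> n\<bar> * R ^ n \<le> C"
proof -
  define G where "G = (\<Sum>i\<le>degree g. \<bar>coeff g i\<bar> * R ^ (i+2))"
  define X where "X = \<bar>\<alpha>\<bar> + \<bar>\<beta>\<bar> * R + G"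
  define B where "B = R ^ 4 + K * R ^ 2 + 1"
  have G0: "0 \<le> G" unfolding G_def using assms by (intro sum_nonneg) auto
  have X0: "0 \<le> X" using G0 assms by (simp add: X_def)
  have gX: "\<bar>coeff g n\<bar> * R ^ (n+2) \<le> X" for n
  proof (cases "n \<le> degree g")
    case True
    have "\<bar>coeff g n\<bar> * R ^ (n+2) \<le> G"
      unfolding G_def using assms True by (intro member_le_sum) auto
    moreover have "0 \<le> \<bar>\<beta>\<bar> * R" using assms by simp
    ultimately show ?thesis unfolding X_def by linarith
  next
    case False
    then show ?thesis using X0 by (simp add: coeff_eq_0)
  qed
  have B1: "1 \<le> B" using assms by (simp add: B_def)
  obtain N :: nat where N: "B \<le> real N" using real_arch_simple by blast
  \<comment> \<open>The recursion multiplies the bound by at most B, and by at most 1 once the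
      denominators exceed B.\<close>
  have bd: "\<bar>osc_coeff \<alpha> \<beta> g \<nu> n\<bar> * R ^ n \<le> X * B ^ min n N" if \<nu>: "\<nu> \<in> {-K..K}" for \<nu> n
  proof (induction n rule: less_induct)
    case (less n)
    let ?c = "osc_coeff \<alpha> \<beta> g \<nu>"
    show ?case
    proof (cases "n = 0 \<or> n = 1")
      case True
      have "1 \<le> B ^ min n N" using B1 by (rule one_le_power)
      then have "X \<le> X * B ^ min n N" using X0 by (simp add: mult_le_cancel_left1)
      moreover have "\<bar>?c n\<bar> * R ^ n \<le> X" using True G0 assms by (auto simp: X_def)
      ultimately show ?thesis by linarith
    next
      case False
      then obtain m where m: "n = Suc (Suc m)" by (metis One_nat_def not0_implies_Suc)
      define Y where "Y = X * B ^ min m N"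
      have XY: "X \<le> Y" unfolding Y_def
        using X0 one_le_power[OF B1, of "min m N"] by (simp add: mult_le_cancel_left1)
      have 1: "\<bar>if 2 \<le> m then ?c (m - 2) else 0\<bar> * R ^ (m+2) \<le> R ^ 4 * Y"
      proof (cases "2 \<le> m")
        case True
        have "\<bar>?c (m-2)\<bar> * R ^ (m-2) \<le> X * B ^ min (m-2) N"
          using less.IH[of "m-2"] m by simp
        also have "\<dots> \<le> Y" unfolding Y_def
          using X0 B1 by (intro mult_left_mono power_increasing) auto
        finally have "\<bar>?c (m-2)\<bar> * R ^ (m-2) * R ^ 4 \<le> Y * R ^ 4"
          using assms by (intro mult_right_mono) auto
        moreover have "R ^ (m+2) = R ^ (m-2) * R ^ 4"
          using True by (simp flip: power_add)
        ultimately show ?thesis using True by (simp add: mult_ac)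
      next
        case False
        then show ?thesis using XY X0 assms by simp
      qed
      have 2: "\<bar>\<nu> * ?c m\<bar> * R ^ (m+2) \<le> K * R ^ 2 * Y"
      proof -
        have "\<bar>?c m\<bar> * R ^ m \<le> Y" using less.IH[of m] m by (simp add: Y_def)
        then have "\<bar>\<nu>\<bar> * (\<bar>?c m\<bar> * R ^ m) * R ^ 2 \<le> K * Y * R ^ 2"
          using \<nu> assms XY X0 by (intro mult_right_mono mult_mono) auto
        then show ?thesis by (simp add: abs_mult power_add power2_eq_square mult_ac)
      qed
      define Z where "Z = (if 2 \<le> m then ?c (m - 2) else 0) - \<nu> * ?c m - coeff g m"
      have "\<bar>Z\<bar> \<le> \<bar>if 2 \<le> m then ?c (m - 2) else 0\<bar> + \<bar>\<nu> * ?c m\<bar> + \<bar>coeff g m\<bar>"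
        unfolding Z_def by linarith
      then have "\<bar>Z\<bar> * R ^ (m+2) \<le> (\<bar>if 2 \<le> m then ?c (m - 2) else 0\<bar> + \<bar>\<nu> * ?c m\<bar> + \<bar>coeff g m\<bar>) * R ^ (m+2)"
        using assms by (intro mult_right_mono) auto
      also have "\<dots> \<le> R ^ 4 * Y + K * R ^ 2 * Y + Y"
        unfolding distrib_right using 1 2 gX[of m] XY by linarith
      also have "\<dots> = B * Y" by (simp add: B_def algebra_simps)
      finally have Z: "\<bar>Z\<bar> * R ^ (m+2) \<le> B * Y" .
      define q where "q = real (Suc m) * real (Suc (Suc m))"
      have q0: "1 \<le> q" unfolding q_def by (intro mult_ge1_I) auto
      have cn: "\<bar>?c n\<bar> * R ^ n = \<bar>Z\<bar> * R ^ (m+2) / q"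
        using q0 by (simp add: m Z_def q_def abs_mult)
      have Y0: "0 \<le> Y" using XY X0 by linarith
      show ?thesis
      proof (cases "m < N")
        case True
        have "\<bar>?c n\<bar> * R ^ n \<le> B * Y"
        proof -
          have "\<bar>Z\<bar> * R ^ (m+2) / q \<le> \<bar>Z\<bar> * R ^ (m+2) / 1"
            using q0 assms by (intro divide_left_mono) auto
          then show ?thesis unfolding cn using Z by linarith
        qed
        also have "B * Y = X * B ^ Suc m" using True by (simp add: Y_def)
        also have "\<dots> \<le> X * B ^ min n N" using True m X0 B1
          by (intro mult_left_mono power_increasing) auto
        finally show ?thesis .
      next
        case False
        have "real N \<le> real (Suc m) * 1" using False by simp
        also have "\<dots> \<le> q" unfolding q_def by (intro mult_left_mono) auto
        finally have "real N \<le> q" .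
        then have "B * Y / q \<le> Y" using N q0 Y0
          using mult_right_mono[of B q Y] by (simp add: divide_le_eq mult.commute)
        then have "\<bar>?c n\<bar> * R ^ n \<le> Y" unfolding cn
          using divide_right_mono[OF Z, of q] q0 by linarith
        also have "Y = X * B ^ min n N" using False m by (simp add: Y_def)
        finally show ?thesis .
      qed
    qed
  qed
  have "\<bar>osc_coeff \<alpha> \<beta> g \<nu> n\<bar> * R ^ n \<le> X * B ^ N" if \<nu>: "\<nu> \<in> {-K..K}" for \<nu> n
  proof -
    have "X * B ^ min n N \<le> X * B ^ N" using X0 B1
      by (intro mult_left_mono power_increasing) auto
    then show ?thesis using bd[OF \<nu>, of n] by linarith
  qed
  then show ?thesis by blast
qed

definition osc_sol :: "real \<Rightarrow> real \<Rightarrow> real poly \<Rightarrow> real \<Rightarrow> real \<Rightarrow> real" where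
  "osc_sol \<alpha> \<beta> g \<nu> t = (\<Sum>n. osc_coeff \<alpha> \<beta> g \<nu> n * t ^ n)"

definition osc_sol' :: "real \<Rightarrow> real \<Rightarrow> real poly \<Rightarrow> real \<Rightarrow> real \<Rightarrow> real" where
  "osc_sol' \<alpha> \<beta> g \<nu> t = (\<Sum>n. diffs (osc_coeff \<alpha> \<beta> g \<nu>) n * t ^ n)"

text \<open>
  A majorant for the series and its derivative. The factor 4 in \<open>S = 4 R\<close> absorbs the factor
  \<open>n + 1\<close> of the differentiated series.
\<close>

lemma osc_coeff_geometric:
  assumes "1 \<le> R" "0 \<le> K"
  shows "\<exists>C. \<forall>\<nu>\<in>{-K..K}. \<forall>t\<in>{-R..R}. \<forall>n. \<bar>osc_coeff \<alpha> \<beta> g \<nu> n * t ^ n\<bar> \<le> C * (1/2) ^ n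
     \<and> \<bar>diffs (osc_coeff \<alpha> \<beta> g \<nu>) n * t ^ n\<bar> \<le> C * (1/2) ^ n"
proof -
  define S where "S = 4 * R"
  have S: "1 \<le> S" "0 < S" using assms by (auto simp: S_def)
  obtain C where C: "\<And>\<nu> n. \<nu> \<in> {-K..K} \<Longrightarrow> \<bar>osc_coeff \<alpha> \<beta> g \<nu> n\<bar> * S ^ n \<le> C"
    using osc_coeff_bound[OF S(1) assms(2), of \<alpha> \<beta> g] by blast
  have C0: "0 \<le> C" using C[of 0 0] assms by simp
  have tp: "\<bar>t ^ n\<bar> \<le> S ^ n * (1/4) ^ n" if "t \<in> {-R..R}" for t n
  proof -
    have "\<bar>t\<bar> ^ n \<le> R ^ n" using that by (intro power_mono) auto
    moreover have "S ^ n * (1/4) ^ n = R ^ n" by (subst power_mult_distrib[symmetric]) (simp add: S_def)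
    ultimately show ?thesis by (simp add: power_abs)
  qed
  have 1: "\<bar>osc_coeff \<alpha> \<beta> g \<nu> n * t ^ n\<bar> \<le> C * (1/2) ^ n" if "\<nu> \<in> {-K..K}" "t \<in> {-R..R}" for \<nu> t n
  proof -
    have "\<bar>osc_coeff \<alpha> \<beta> g \<nu> n * t ^ n\<bar> \<le> \<bar>osc_coeff \<alpha> \<beta> g \<nu> n\<bar> * (S ^ n * (1/4) ^ n)"
      unfolding abs_mult using tp[OF that(2)] by (intro mult_left_mono) auto
    also have "\<dots> \<le> C * (1/4) ^ n"
      unfolding mult.assoc[symmetric] using C[OF that(1)] by (intro mult_right_mono) auto
    also have "\<dots> \<le> C * (1/2) ^ n" using C0 by (intro mult_left_mono power_mono) auto
    finally show ?thesis .
  qed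
  have 2: "\<bar>diffs (osc_coeff \<alpha> \<beta> g \<nu>) n * t ^ n\<bar> \<le> C * (1/2) ^ n" if "\<nu> \<in> {-K..K}" "t \<in> {-R..R}" for \<nu> t n
  proof -
    have n2: "real (Suc n) * (1/4) ^ n \<le> (1/2) ^ n"
    proof -
      have "real (Suc n) \<le> 2 ^ n" by (induction n) auto
      then have "real (Suc n) * (1/4) ^ n \<le> 2 ^ n * (1/4) ^ n" by (intro mult_right_mono) auto
      also have "\<dots> = (1/2 :: real) ^ n" by (subst power_mult_distrib[symmetric]) simp
      finally show ?thesis .
    qed
    have "\<bar>diffs (osc_coeff \<alpha> \<beta> g \<nu>) n * t ^ n\<bar> \<le> real (Suc n) * \<bar>osc_coeff \<alpha> \<beta> g \<nu> (Suc n)\<bar> * (S ^ n * (1/4) ^ n)"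
      unfolding abs_mult diffs_def using tp[OF that(2), of n] by (intro mult_mono) auto
    also have "\<dots> \<le> real (Suc n) * \<bar>osc_coeff \<alpha> \<beta> g \<nu> (Suc n)\<bar> * (S ^ Suc n * (1/4) ^ n)"
      using S by (intro mult_left_mono mult_right_mono) auto
    also have "\<dots> = \<bar>osc_coeff \<alpha> \<beta> g \<nu> (Suc n)\<bar> * S ^ Suc n * (real (Suc n) * (1/4) ^ n)"
      by (simp only: mult_ac)
    also have "\<dots> \<le> C * (1/2) ^ n" 
      using C[OF that(1), of "Suc n"] C0 n2 by (intro mult_mono) (auto simp del: power_Suc)
    finally show ?thesis .
  qed
  show ?thesis using 1 2 by blast
qed

text \<open>
  Joint continuity is what the phase of a solution needs in order to be followed in \<open>t\<close> and in the
  spectral parameter.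
\<close>

lemma continuous_on_osc_sol:
  "continuous_on UNIV (\<lambda>(t, \<nu>). osc_sol \<alpha> \<beta> g \<nu> t)"
  "continuous_on UNIV (\<lambda>(t, \<nu>). osc_sol' \<alpha> \<beta> g \<nu> t)"
proof -
  have cc: "continuous_on UNIV (\<lambda>\<nu>. osc_coeff \<alpha> \<beta> g \<nu> n)" for n
  proof (induction n rule: less_induct)
    case (less n)
    show ?case
    proof (cases "n = 0 \<or> n = 1")
      case True then show ?thesis by auto
    next
      case False
      then obtain m where m: "n = Suc (Suc m)" by (metis One_nat_def not0_implies_Suc)
      have "continuous_on UNIV (\<lambda>\<nu>. osc_coeff \<alpha> \<beta> g \<nu> m)" "continuous_on UNIV (\<lambda>\<nu>. osc_coeff \<alpha> \<beta> g \<nu> (m - 2))"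
        using less.IH m by auto
      then show ?thesis unfolding m osc_coeff.simps
        by (cases "2 \<le> m") (auto intro!: continuous_intros simp del: of_nat_Suc)
    qed
  qed
  have gen: "continuous_on UNIV (\<lambda>(t, \<nu>). \<Sum>n. d \<nu> n * t ^ n)"
    if d: "\<And>n. continuous_on UNIV (\<lambda>\<nu>. d \<nu> n)"
      and bd: "\<And>R K. 1 \<le> R \<Longrightarrow> 0 \<le> K \<Longrightarrow> \<exists>C. \<forall>\<nu>\<in>{-K..K}. \<forall>t\<in>{-R..R}. \<forall>n. \<bar>d \<nu> n * t ^ n\<bar> \<le> C * (1/2) ^ n"
    for d :: "real \<Rightarrow> nat \<Rightarrow> real"
  proof -
    have "isCont (\<lambda>(t, \<nu>). \<Sum>n. d \<nu> n * t ^ n) p" for p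
    proof -
      obtain t0 \<nu>0 where p: "p = (t0, \<nu>0)" by force
      define R where "R = \<bar>t0\<bar> + 1"
      define K where "K = \<bar>\<nu>0\<bar> + 1"
      obtain C where C: "\<forall>\<nu>\<in>{-K..K}. \<forall>t\<in>{-R..R}. \<forall>n. \<bar>d \<nu> n * t ^ n\<bar> \<le> C * (1/2) ^ n"
        using bd[of R K] unfolding R_def K_def by auto
      let ?S = "{-R..R} \<times> {-K..K}"
      have sg: "summable (\<lambda>n. C * (1/2::real) ^ n)" by (intro summable_mult summable_geometric) auto
      have "uniform_limit ?S (\<lambda>N x. \<Sum>n<N. d (snd x) n * fst x ^ n) (\<lambda>x. \<Sum>n. d (snd x) n * fst x ^ n) sequentially"
        by (rule Weierstrass_m_test[OF _ sg]) (use C in auto)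
      then have "continuous_on ?S (\<lambda>x. \<Sum>n. d (snd x) n * fst x ^ n)"
        by (rule uniform_limit_theorem[rotated])
           (auto intro!: continuous_intros continuous_on_compose2[OF d] always_eventually)
      moreover have "p \<in> interior ?S"
        by (auto simp: interior_Times p R_def K_def abs_if)
      ultimately show ?thesis
        by (simp add: continuous_on_interior case_prod_unfold)
    qed
    then show ?thesis by (simp add: continuous_at_imp_continuous_on)
  qed
  show "continuous_on UNIV (\<lambda>(t, \<nu>). osc_sol \<alpha> \<beta> g \<nu> t)"
    unfolding osc_sol_def
  proof (rule gen[OF cc])
    fix R K :: real assume "1 \<le> R" "0 \<le> K"
    from osc_coeff_geometric[OF this, of \<alpha> \<beta> g]
    show "\<exists>C. \<forall>\<nu>\<in>{-K..K}. \<forall>t\<in>{-R..R}. \<forall>n. \<bar>osc_coeff \<alpha> \<beta> g \<nu> n * t ^ n\<bar> \<le> C * (1/2) ^ n"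
      by blast
  qed
  show "continuous_on UNIV (\<lambda>(t, \<nu>). osc_sol' \<alpha> \<beta> g \<nu> t)"
    unfolding osc_sol'_def
  proof (rule gen)
    show "continuous_on UNIV (\<lambda>\<nu>. diffs (osc_coeff \<alpha> \<beta> g \<nu>) n)" for n
      unfolding diffs_def by (intro continuous_intros cc)
    fix R K :: real assume "1 \<le> R" "0 \<le> K"
    from osc_coeff_geometric[OF this, of \<alpha> \<beta> g]
    show "\<exists>C. \<forall>\<nu>\<in>{-K..K}. \<forall>t\<in>{-R..R}. \<forall>n. \<bar>diffs (osc_coeff \<alpha> \<beta> g \<nu>) n * t ^ n\<bar> \<le> C * (1/2) ^ n"
      by blast
  qed
qed

lemma osc_summable:
  "summable (\<lambda>n. osc_coeff \<alpha> \<beta> g \<nu> n * t ^ n)"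
  "summable (\<lambda>n. diffs (osc_coeff \<alpha> \<beta> g \<nu>) n * t ^ n)"
proof -
  obtain C where C: "\<And>n. \<bar>osc_coeff \<alpha> \<beta> g \<nu> n * t ^ n\<bar> \<le> C * (1/2) ^ n"
    "\<And>n. \<bar>diffs (osc_coeff \<alpha> \<beta> g \<nu>) n * t ^ n\<bar> \<le> C * (1/2) ^ n"
  proof -
    have mem: "\<nu> \<in> {-\<bar>\<nu>\<bar>..\<bar>\<nu>\<bar>}" "t \<in> {-(\<bar>t\<bar>+1)..\<bar>t\<bar>+1}" by auto
    have "1 \<le> \<bar>t\<bar>+1" "0 \<le> \<bar>\<nu>\<bar>" by auto
    from osc_coeff_geometric[OF this, of \<alpha> \<beta> g] mem show ?thesis using that by blast
  qed
  have sg: "summable (\<lambda>n. C * (1/2::real) ^ n)" by (intro summable_mult summable_geometric) auto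
  show "summable (\<lambda>n. osc_coeff \<alpha> \<beta> g \<nu> n * t ^ n)"
    "summable (\<lambda>n. diffs (osc_coeff \<alpha> \<beta> g \<nu>) n * t ^ n)"
    by (rule summable_comparison_test[OF _ sg]; use C in auto)+
qed

lemma osc_sol_deriv:
  "(osc_sol \<alpha> \<beta> g \<nu> has_real_derivative osc_sol' \<alpha> \<beta> g \<nu> t) (at t)"
  unfolding osc_sol_def[abs_def] osc_sol'_def
  by (rule termdiffs_strong_converges_everywhere) (rule osc_summable)

lemma osc_sol'_deriv:
  "(osc_sol' \<alpha> \<beta> g \<nu> has_real_derivative (t\<^sup>2 - \<nu>) * osc_sol \<alpha> \<beta> g \<nu> t - poly g t) (at t)"
proof -
  let ?c = "osc_coeff \<alpha> \<beta> g \<nu>"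
  have "(osc_sol' \<alpha> \<beta> g \<nu> has_real_derivative (\<Sum>n. diffs (diffs ?c) n * t ^ n)) (at t)"
    unfolding osc_sol'_def[abs_def]
    by (rule termdiffs_strong_converges_everywhere) (rule osc_summable)
  moreover have "(\<lambda>n. diffs (diffs ?c) n * t ^ n) sums ((t\<^sup>2 - \<nu>) * osc_sol \<alpha> \<beta> g \<nu> t - poly g t)"
  proof -
    have s: "(\<lambda>n. ?c n * t ^ n) sums osc_sol \<alpha> \<beta> g \<nu> t"
      unfolding osc_sol_def using osc_summable(1) by (rule summable_sums)
    have "(\<lambda>n. t\<^sup>2 * (?c n * t ^ n)) sums (t\<^sup>2 * osc_sol \<alpha> \<beta> g \<nu> t)"
      by (rule sums_mult[OF s])
    then have "(\<lambda>n. (if 2 \<le> n + 2 then ?c (n + 2 - 2) else 0) * t ^ (n+2)) sums (t\<^sup>2 * osc_sol \<alpha> \<beta> g \<nu> t)"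
      by (simp add: power_add mult_ac power2_eq_square)
    then have 1: "(\<lambda>n. (if 2 \<le> n then ?c (n - 2) else 0) * t ^ n) sums (t\<^sup>2 * osc_sol \<alpha> \<beta> g \<nu> t)"
      by (subst (asm) sums_iff_shift) (simp add: numeral_2_eq_2)
    have 2: "(\<lambda>n. \<nu> * (?c n * t ^ n)) sums (\<nu> * osc_sol \<alpha> \<beta> g \<nu> t)" by (rule sums_mult[OF s])
    have 3: "(\<lambda>n. coeff g n * t ^ n) sums poly g t"
      unfolding poly_altdef by (rule sums_finite) (auto simp: coeff_eq_0)
    have "diffs (diffs ?c) n * t ^ n = (if 2 \<le> n then ?c (n - 2) else 0) * t ^ n - \<nu> * (?c n * t ^ n) - coeff g n * t ^ n" for n
    proof -
      have "diffs (diffs ?c) n = real (Suc n) * real (Suc (Suc n)) * ?c (Suc (Suc n))"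
        by (simp only: diffs_def mult.assoc)
      also have "\<dots> = (if 2 \<le> n then ?c (n - 2) else 0) - \<nu> * ?c n - coeff g n"
        by (simp del: of_nat_Suc)
      finally show ?thesis by (simp only: left_diff_distrib mult.assoc)
    qed
    then have "(\<lambda>n. diffs (diffs ?c) n * t ^ n) = (\<lambda>n. (if 2 \<le> n then ?c (n - 2) else 0) * t ^ n - \<nu> * (?c n * t ^ n) - coeff g n * t ^ n)"
      by (rule ext)
    with sums_diff[OF sums_diff[OF 1 2] 3] show ?thesis by (simp only: left_diff_distrib)
  qed
  ultimately show ?thesis by (metis sums_unique)
qed

lemma osc_sol_0: "osc_sol \<alpha> \<beta> g \<nu> 0 = \<alpha>" "osc_sol' \<alpha> \<beta> g \<nu> 0 = \<beta>"
  by (simp_all add: osc_sol_def osc_sol'_def powser_zero diffs_def)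

text \<open>
  The solution with value 0 and slope 1 at \<open>a\<close>. The Dirichlet eigenvalues of \<open>{a..b}\<close> are the
  zeros of \<open>\<nu> \<mapsto> dsol a \<nu> b\<close>, and they are simple.
\<close>

definition dsol :: "real \<Rightarrow> real \<Rightarrow> real \<Rightarrow> real" where
  "dsol a \<nu> t = osc_sol 1 0 0 \<nu> a * osc_sol 0 1 0 \<nu> t - osc_sol 0 1 0 \<nu> a * osc_sol 1 0 0 \<nu> t"

definition dsol' :: "real \<Rightarrow> real \<Rightarrow> real \<Rightarrow> real" where
  "dsol' a \<nu> t = osc_sol 1 0 0 \<nu> a * osc_sol' 0 1 0 \<nu> t - osc_sol 0 1 0 \<nu> a * osc_sol' 1 0 0 \<nu> t"

lemma dsol_deriv: "(dsol a \<nu> has_real_derivative dsol' a \<nu> t) (at t)"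
  unfolding dsol_def[abs_def] dsol'_def
  by (auto intro!: derivative_eq_intros osc_sol_deriv)

lemma dsol'_deriv: "(dsol' a \<nu> has_real_derivative (t\<^sup>2 - \<nu>) * dsol a \<nu> t) (at t)"
  unfolding dsol_def dsol'_def[abs_def]
  by (rule derivative_eq_intros osc_sol'_deriv refl)+ (simp add: algebra_simps)

lemma continuous_on_dsol: "continuous_on S (dsol a \<nu>)" "continuous_on S (dsol' a \<nu>)"
  using dsol_deriv dsol'_deriv by (meson DERIV_continuous continuous_at_imp_continuous_on)+

lemma osc_wronskian:
  "osc_sol 1 0 0 \<nu> t * osc_sol' 0 1 0 \<nu> t - osc_sol 0 1 0 \<nu> t * osc_sol' 1 0 0 \<nu> t = 1"
proof -
  let ?W = "\<lambda>t. osc_sol 1 0 0 \<nu> t * osc_sol' 0 1 0 \<nu> t - osc_sol 0 1 0 \<nu> t * osc_sol' 1 0 0 \<nu> t"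
  have "(?W has_real_derivative 0) (at t)" for t
    by (rule derivative_eq_intros osc_sol_deriv osc_sol'_deriv refl)+ (simp add: algebra_simps)
  then have "?W t = ?W 0" using DERIV_isconst_all by blast
  then show ?thesis by (simp add: osc_sol_0)
qed

lemma dsol_init: "dsol a \<nu> a = 0" "dsol' a \<nu> a = 1"
  using osc_wronskian[of \<nu> a] by (simp_all add: dsol_def dsol'_def mult.commute)

text \<open>
  A common zero of the solution and its derivative would make the coefficients of this combination
  of two solutions vanish, since their Wronskian at \<open>t\<close> is 1; but at \<open>a\<close> it is 1 as well.
\<close>

lemma dsol_nonzero: "dsol a \<nu> t \<noteq> 0 \<or> dsol' a \<nu> t \<noteq> 0"
proof (rule ccontr)
  assume "\<not> ?thesis"
  then have z: "dsol a \<nu> t = 0" "dsol' a \<nu> t = 0" by auto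
  let ?p = "osc_sol 1 0 0 \<nu>" and ?q = "osc_sol 0 1 0 \<nu>" and ?p' = "osc_sol' 1 0 0 \<nu>" and ?q' = "osc_sol' 0 1 0 \<nu>"
  have "?p a * (?p t * ?q' t - ?q t * ?p' t) = ?p t * dsol' a \<nu> t - ?p' t * dsol a \<nu> t"
    "?q a * (?p t * ?q' t - ?q t * ?p' t) = ?q t * dsol' a \<nu> t - ?q' t * dsol a \<nu> t"
    by (simp_all add: dsol_def dsol'_def algebra_simps)
  then have "?p a = 0" "?q a = 0" using z osc_wronskian[of \<nu> t] by simp_all
  then show False using osc_wronskian[of \<nu> a] by simp
qed

lemma continuous_on_dsol2:
  "continuous_on S (\<lambda>(t, \<nu>). dsol a \<nu> t)" "continuous_on S (\<lambda>(t, \<nu>). dsol' a \<nu> t)"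
proof -
  have c: "continuous_on S (\<lambda>x. F (f x) (snd x))"
    if "continuous_on UNIV (\<lambda>(t, \<nu>). F t \<nu>)" "continuous_on S f" 
    for F :: "real \<Rightarrow> real \<Rightarrow> real" and f :: "real \<times> real \<Rightarrow> real"
    using continuous_on_compose2[OF that(1) continuous_on_Pair[OF that(2) continuous_on_snd[OF continuous_on_id]]]
    by simp
  show "continuous_on S (\<lambda>(t, \<nu>). dsol a \<nu> t)" "continuous_on S (\<lambda>(t, \<nu>). dsol' a \<nu> t)"
    unfolding dsol_def dsol'_def case_prod_unfold
    by (intro continuous_intros c[OF continuous_on_osc_sol(1)] c[OF continuous_on_osc_sol(2)])+
qed

lemma integral_by_ftc:
  fixes F f :: "real \<Rightarrow> real"
  assumes "a \<le> b" "\<And>t. (F has_real_derivative f t) (at t)"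
  shows "(f has_integral F b - F a) {a..b}"
  using assms by (intro fundamental_theorem_of_calculus)
    (auto intro: has_field_derivative_at_within simp flip: has_real_derivative_iff_has_vector_derivative)

text \<open>
  The Fredholm alternative. Away from the eigenvalues a multiple of the homogeneous solution corrects
  the value at \<open>b\<close>; at an eigenvalue this value is already determined, and it vanishes by
  orthogonality to the eigenfunction. Polynomial right hand sides keep the solutions within
  reach of power series.
\<close>

lemma dirichlet_problem_solvable:
  fixes g :: "real poly"
  assumes "a < b" and orth: "dsol a \<nu> b = 0 \<Longrightarrow> integral {a..b} (\<lambda>t. poly g t * dsol a \<nu> t) = 0"
  obtains \<phi> \<phi>' where
    "\<And>t. (\<phi> has_real_derivative \<phi>' t) (at t)"
    "\<And>t. (\<phi>' has_real_derivative (t\<^sup>2 - \<nu>) * \<phi> t - poly g t) (at t)"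
    "\<phi> a = 0" "\<phi> b = 0"
proof -
  \<comment> \<open>A particular solution, corrected so as to vanish at the left end point.\<close>
  define p where "p t = osc_sol 0 0 g \<nu> t" for t
  define p' where "p' t = osc_sol' 0 0 g \<nu> t" for t
  let ?u = "osc_sol 1 0 0 \<nu>" and ?v = "osc_sol 0 1 0 \<nu>" and ?u' = "osc_sol' 1 0 0 \<nu>" and ?v' = "osc_sol' 0 1 0 \<nu>"
  define f where "f t = p t - p a * (?u t * ?v' a - ?v t * ?u' a)" for t
  define f' where "f' t = p' t - p a * (?u' t * ?v' a - ?v' t * ?u' a)" for t
  have f: "(f has_real_derivative f' t) (at t)" for t
    unfolding f_def[abs_def] f'_def p_def p'_def
    by (rule derivative_eq_intros osc_sol_deriv refl)+ simp
  have f': "(f' has_real_derivative (t\<^sup>2 - \<nu>) * f t - poly g t) (at t)" for t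
    unfolding f_def f'_def[abs_def] p_def p'_def
    by (rule derivative_eq_intros osc_sol'_deriv refl)+ (simp add: algebra_simps)
  have fa: "f a = 0" using osc_wronskian[of \<nu> a] by (simp add: f_def)
  show ?thesis
  proof (cases "dsol a \<nu> b = 0")
    case False
    define c where "c = f b / dsol a \<nu> b"
    show ?thesis
    proof (rule that)
      show "((\<lambda>t. f t - c * dsol a \<nu> t) has_real_derivative f' t - c * dsol' a \<nu> t) (at t)" for t
        by (rule derivative_eq_intros f dsol_deriv refl)+ simp
      show "((\<lambda>t. f' t - c * dsol' a \<nu> t) has_real_derivative (t\<^sup>2 - \<nu>) * (f t - c * dsol a \<nu> t) - poly g t) (at t)" for t
        by (rule derivative_eq_intros f' dsol'_deriv refl)+ (simp add: algebra_simps)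
    qed (use False fa in \<open>auto simp: c_def dsol_init\<close>)
  next
    case True
    \<comment> \<open>Green's identity shows that the boundary value is the obstruction.\<close>
    have "((\<lambda>t. f t * dsol' a \<nu> t - f' t * dsol a \<nu> t) has_real_derivative poly g t * dsol a \<nu> t) (at t)" for t
      by (rule derivative_eq_intros f f' dsol_deriv dsol'_deriv refl)+ (simp add: algebra_simps)
    from integral_by_ftc[OF less_imp_le[OF assms(1)] this]
    have "((\<lambda>t. poly g t * dsol a \<nu> t) has_integral f b * dsol' a \<nu> b) {a..b}"
      by (simp add: fa True dsol_init)
    then have "f b * dsol' a \<nu> b = 0" using orth[OF True] by (metis integral_unique)
    then have "f b = 0" using True dsol_nonzero[of a \<nu> b] by auto
    with f f' fa show ?thesis by (rule that)
  qed
qed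

section \<open>Upper bound in one dimension\<close>

text \<open>
  The recursion is the raising operator \<open>t - d/dt\<close>, transported from the Hermite functions to their
  polynomial factors.
\<close>

fun herm :: "nat \<Rightarrow> real poly" where
  "herm 0 = 1"
| "herm (Suc j) = [:0, 2:] * herm j - pderiv (herm j)"

definition hermite_fun :: "nat \<Rightarrow> real \<Rightarrow> real" where
  "hermite_fun j t = poly (herm j) t * exp (- t\<^sup>2 / 2)"

lemma pderiv_herm: "pderiv (herm (Suc j)) = smult (2 * real (Suc j)) (herm j)"
proof (induction j)
  case 0
  show ?case by (simp add: pderiv_pCons)
next
  case (Suc j)
  have lin: "pderiv [:0, 2::real:] = [:2:]" by (simp add: pderiv_pCons)
  have "pderiv (herm (Suc (Suc j))) = [:2:] * herm (Suc j) + [:0, 2:] * pderiv (herm (Suc j)) - pderiv (pderiv (herm (Suc j)))"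
    by (simp only: herm.simps(2)[of "Suc j"] pderiv_diff pderiv_mult lin)
       (simp add: algebra_simps)
  also have "\<dots> = [:2:] * herm (Suc j) + smult (2 * real (Suc j)) ([:0, 2:] * herm j - pderiv (herm j))"
    unfolding Suc.IH by (simp only: pderiv_smult mult_smult_right smult_diff_right add_diff_eq)
  also have "[:0, 2:] * herm j - pderiv (herm j) = herm (Suc j)" by simp
  also have "[:2:] * herm (Suc j) + smult (2 * real (Suc j)) (herm (Suc j)) = smult (2 * real (Suc (Suc j))) (herm (Suc j))"
    by (simp only: mult_pCons_left smult_add_left[symmetric] mult_zero_left pCons_0_0 add_0_right) (simp add: algebra_simps)
  finally show ?case .
qed

lemma gauss_deriv: "((\<lambda>t. exp (- t\<^sup>2 / 2)) has_real_derivative - t * exp (- t\<^sup>2 / 2)) (at t)"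
  by (auto intro!: derivative_eq_intros)

lemma hermite_fun_deriv_raise:
  "(hermite_fun j has_real_derivative t * hermite_fun j t - hermite_fun (Suc j) t) (at t)"
  unfolding hermite_fun_def[abs_def]
  by (rule derivative_eq_intros poly_DERIV gauss_deriv refl)+ (simp add: algebra_simps)

lemma hermite_fun_deriv_lower:
  "(hermite_fun (Suc j) has_real_derivative 2 * real (Suc j) * hermite_fun j t - t * hermite_fun (Suc j) t) (at t)"
  unfolding hermite_fun_def[abs_def]
  by (rule derivative_eq_intros poly_DERIV gauss_deriv refl)+
     (simp add: pderiv_herm algebra_simps del: herm.simps of_nat_Suc)

lemma continuous_on_hermite_fun [continuous_intros]: "continuous_on S (hermite_fun j)"
  using hermite_fun_deriv_raise by (meson DERIV_continuous continuous_at_imp_continuous_on)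

text \<open>
  Functions that vanish at both ends of the interval have a lowered function \<open>f' + t f\<close> of large
  norm once they are orthogonal to the first Hermite functions. Orthogonality to the Gaussian
  is what makes \<open>f\<close> a raised function \<open>-g' + t g\<close> with \<open>g\<close> vanishing at both ends, and
  \<open>g\<close> inherits the remaining orthogonality relations.
\<close>

lemma lowering_lower_bound:
  fixes f f' :: "real \<Rightarrow> real"
  assumes "a < b"
    and "\<And>t. (f has_real_derivative f' t) (at t)" "continuous_on UNIV f'"
    and "f a = 0" "f b = 0"
    and "\<And>j. j < J \<Longrightarrow> integral {a..b} (\<lambda>t. f t * hermite_fun j t) = 0"
  shows "2 * real J * integral {a..b} (\<lambda>t. (f t)\<^sup>2) \<le> integral {a..b} (\<lambda>t. (f' t + t * f t)\<^sup>2)"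
  using assms(2-)
proof (induction J arbitrary: f f')
  case 0
  have "continuous_on S f" for S using 0(1) by (meson DERIV_continuous continuous_at_imp_continuous_on)
  moreover have "continuous_on {a..b} f'" using 0(2) continuous_on_subset by blast
  ultimately have "0 \<le> integral {a..b} (\<lambda>t. (f' t + t * f t)\<^sup>2)"
    by (intro integral_nonneg integrable_continuous_interval continuous_intros) auto
  then show ?case by simp
next
  case (Suc J)
  note f = Suc.prems(1)
  have cf: "continuous_on S f" for S using f by (meson DERIV_continuous continuous_at_imp_continuous_on)
  have cf': "continuous_on S f'" for S using Suc.prems(2) continuous_on_subset by blast
  note int = integrable_continuous_interval
  let ?E = "\<lambda>t::real. exp (- t\<^sup>2 / 2)"
  \<comment> \<open>An antiderivative on the whole line, so that no one-sided derivatives occur.\<close>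
  have "\<exists>P. \<forall>t. (P has_real_derivative f t * ?E t) (at t)"
  proof -
    define h where "h t = f t * ?E t" for t
    have ch: "continuous_on S h" for S unfolding h_def by (intro continuous_intros cf) auto
    define P where "P t = (if 0 \<le> t then integral {0..t} h else - integral {t..0} h)" for t
    have "(P has_real_derivative h t) (at t)" for t
    proof -
      define r where "r = \<bar>t\<bar> + 1"
      have "((\<lambda>u. integral {-r..u} h) has_real_derivative h t) (at t within {-r..r})"
        by (rule integral_has_real_derivative[OF ch]) (auto simp: r_def)
      moreover have "at t within {-r..r} = at t"
        by (rule at_within_interior) (auto simp: r_def)
      ultimately have d: "((\<lambda>u. integral {-r..u} h - integral {-r..0} h) has_real_derivative h t) (at t)"
        by (auto intro!: derivative_eq_intros)
      show ?thesis
      proof (rule has_field_derivative_transform_within_open[OF d, of "{-r<..<r}"])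
        fix u assume u: "u \<in> {-r<..<r}"
        show "integral {-r..u} h - integral {-r..0} h = P u"
        proof (cases "0 \<le> u")
          case True
          then show ?thesis using Henstock_Kurzweil_Integration.integral_combine[of "-r" 0 u h] int[OF ch] u
            by (auto simp: P_def)
        next
          case False
          then show ?thesis using Henstock_Kurzweil_Integration.integral_combine[of "-r" u 0 h] int[OF ch] u
            by (auto simp: P_def)
        qed
      qed (auto simp: r_def)
    qed
    then show ?thesis unfolding h_def by blast
  qed
  then obtain P where P: "\<And>t. (P has_real_derivative f t * ?E t) (at t)" by blast
  define g where "g t = - (P t - P a) * exp (t\<^sup>2 / 2)" for t
  define g' where "g' t = t * g t - f t" for t
  have EE: "?E t * exp (t\<^sup>2 / 2) = 1" for t by (simp flip: exp_add)
  have g: "(g has_real_derivative g' t) (at t)" for t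
  proof -
    have "(g has_real_derivative - (f t * ?E t) * exp (t\<^sup>2 / 2) + - (P t - P a) * (exp (t\<^sup>2 / 2) * t)) (at t)"
      unfolding g_def[abs_def] by (auto intro!: derivative_eq_intros P simp: algebra_simps)
    moreover have alg: "- (u * X) * Y + - v * (Y * t) = t * (- v * Y) - u" if "X * Y = 1" for u v X Y :: real
      using that by (simp add: mult.assoc)
    have "- (f t * ?E t) * exp (t\<^sup>2 / 2) + - (P t - P a) * (exp (t\<^sup>2 / 2) * t) = g' t"
      unfolding g'_def g_def by (rule alg[OF EE])
    ultimately show ?thesis by (simp only:)
  qed
  have cg: "continuous_on S g" for S using g by (meson DERIV_continuous continuous_at_imp_continuous_on)
  have cg': "continuous_on S g'" for S unfolding g'_def[abs_def] by (intro continuous_intros cf cg)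
  have ga: "g a = 0" by (simp add: g_def)
  have gb: "g b = 0"
  proof -
    have "((\<lambda>t. f t * ?E t) has_integral P b - P a) {a..b}"
      by (rule integral_by_ftc[OF less_imp_le[OF assms(1)] P])
    moreover have "integral {a..b} (\<lambda>t. f t * ?E t) = 0"
      using Suc.prems(5)[of 0] by (simp add: hermite_fun_def)
    ultimately have "P b = P a" by (simp add: integral_unique)
    then show ?thesis by (simp add: g_def)
  qed
  have g_orth: "integral {a..b} (\<lambda>t. g t * hermite_fun j t) = 0" if "j < J" for j
  proof -
    let ?k = "hermite_fun (Suc j)"
    have "((\<lambda>t. g t * ?k t) has_real_derivative 2 * real (Suc j) * (g t * hermite_fun j t) - f t * ?k t) (at t)" for t
      by (rule derivative_eq_intros g hermite_fun_deriv_lower refl)+ (simp add: g'_def algebra_simps)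
    from integral_by_ftc[OF less_imp_le[OF assms(1)] this]
    have "((\<lambda>t. 2 * real (Suc j) * (g t * hermite_fun j t) - f t * ?k t) has_integral 0) {a..b}"
      by (simp add: ga gb)
    then have "integral {a..b} (\<lambda>t. 2 * real (Suc j) * (g t * hermite_fun j t) - f t * ?k t) = 0"
      by (rule integral_unique)
    also have "integral {a..b} (\<lambda>t. 2 * real (Suc j) * (g t * hermite_fun j t) - f t * ?k t)
        = 2 * real (Suc j) * integral {a..b} (\<lambda>t. g t * hermite_fun j t) - integral {a..b} (\<lambda>t. f t * ?k t)"
      by (subst Henstock_Kurzweil_Integration.integral_diff)
         (auto intro!: int continuous_intros cf cg simp del: of_nat_Suc)
    also have "integral {a..b} (\<lambda>t. f t * ?k t) = 0" using Suc.prems(5)[of "Suc j"] that by simp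
    finally show ?thesis by simp
  qed
  define G where "G = integral {a..b} (\<lambda>t. (g t)\<^sup>2)"
  define F where "F = integral {a..b} (\<lambda>t. (f t)\<^sup>2)"
  define A where "A = integral {a..b} (\<lambda>t. (f' t + t * f t)\<^sup>2)"
  define l where "l = 2 * real (Suc J)"
  have IH: "2 * real J * G \<le> integral {a..b} (\<lambda>t. (g' t + t * g t)\<^sup>2)"
    unfolding G_def using Suc.IH[of g g'] g cg' ga gb g_orth by blast
  have ch1: "continuous_on {a..b} (\<lambda>t. (g' t + t * g t)\<^sup>2)" "continuous_on {a..b} (\<lambda>t. (g t)\<^sup>2)"
      "continuous_on {a..b} (\<lambda>t. (f t)\<^sup>2)" "continuous_on {a..b} (\<lambda>t. (f' t + t * f t)\<^sup>2)"
      "continuous_on {a..b} (\<lambda>t. (f' t + t * f t) * g t)"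
    by (intro continuous_intros cf cg cf' cg')+
  \<comment> \<open>The commutation relation: raising exceeds lowering by twice the norm.\<close>
  have comm: "F = integral {a..b} (\<lambda>t. (g' t + t * g t)\<^sup>2) + 2 * G"
  proof -
    have "((\<lambda>t. - 2 * t * (g t)\<^sup>2) has_real_derivative (f t)\<^sup>2 - (g' t + t * g t)\<^sup>2 - 2 * (g t)\<^sup>2) (at t)" for t
      by (rule derivative_eq_intros g refl)+ (simp add: g'_def power2_eq_square algebra_simps)
    from integral_by_ftc[OF less_imp_le[OF assms(1)] this]
    have h1: "((\<lambda>t. (f t)\<^sup>2 - (g' t + t * g t)\<^sup>2 - 2 * (g t)\<^sup>2) has_integral 0) {a..b}"
      by (simp add: ga gb)
    have h2: "((\<lambda>t. (f t)\<^sup>2 - (g' t + t * g t)\<^sup>2 - 2 * (g t)\<^sup>2) has_integral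
        F - integral {a..b} (\<lambda>t. (g' t + t * g t)\<^sup>2) - 2 * G) {a..b}"
      unfolding F_def G_def
      by (intro has_integral_diff has_integral_mult_right integrable_integral int ch1)
    show ?thesis using has_integral_unique[OF h1 h2] by simp
  qed
  then have FG: "l * G \<le> F" using IH by (simp add: l_def algebra_simps)
  have cross: "integral {a..b} (\<lambda>t. (f' t + t * f t) * g t) = F"
  proof -
    have "((\<lambda>t. f t * g t) has_real_derivative (f' t + t * f t) * g t - (f t)\<^sup>2) (at t)" for t
      by (rule derivative_eq_intros f g refl)+ (simp add: g'_def power2_eq_square algebra_simps)
    from integral_by_ftc[OF less_imp_le[OF assms(1)] this]
    have h1: "((\<lambda>t. (f' t + t * f t) * g t - (f t)\<^sup>2) has_integral 0) {a..b}"
      by (simp add: ga gb)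
    have h2: "((\<lambda>t. (f' t + t * f t) * g t - (f t)\<^sup>2) has_integral
        integral {a..b} (\<lambda>t. (f' t + t * f t) * g t) - F) {a..b}"
      unfolding F_def by (intro has_integral_diff integrable_integral int ch1)
    show ?thesis using has_integral_unique[OF h1 h2] by simp
  qed
  have "0 \<le> integral {a..b} (\<lambda>t. (f' t + t * f t - l * g t)\<^sup>2)"
    by (intro integral_nonneg int continuous_intros cf cg cf') auto
  also have "integral {a..b} (\<lambda>t. (f' t + t * f t - l * g t)\<^sup>2) = A - 2 * l * F + l\<^sup>2 * G"
  proof -
    have "((\<lambda>t. (f' t + t * f t)\<^sup>2 - 2 * l * ((f' t + t * f t) * g t) + l\<^sup>2 * (g t)\<^sup>2) has_integral A - 2 * l * F + l\<^sup>2 * G) {a..b}"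
      unfolding A_def G_def cross[symmetric]
      by (intro has_integral_diff has_integral_add has_integral_mult_right integrable_integral int ch1)
    moreover have "(f' t + t * f t)\<^sup>2 - 2 * l * ((f' t + t * f t) * g t) + l\<^sup>2 * (g t)\<^sup>2 = (f' t + t * f t - l * g t)\<^sup>2" for t
      by (simp add: power2_eq_square algebra_simps)
    ultimately show ?thesis by (simp add: integral_unique)
  qed
  finally have "2 * l * F - l * (l * G) \<le> A" by (simp add: power2_eq_square)
  moreover have "l * (l * G) \<le> l * F" using FG by (intro mult_left_mono) (auto simp: l_def)
  ultimately have "l * F \<le> A" by linarith
  then show ?case by (simp add: l_def F_def A_def)
qed

text \<open>
  The energy is the squared norm of the lowered function plus that of the function itself, up to a
  boundary term.
\<close>

lemma oscillator_form_lower_bound: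
  fixes f f' :: "real \<Rightarrow> real"
  assumes "a < b"
    and f: "\<And>t. (f has_real_derivative f' t) (at t)" and cf': "continuous_on UNIV f'"
    and "f a = 0" "f b = 0"
    and "\<And>j. j < J \<Longrightarrow> integral {a..b} (\<lambda>t. f t * hermite_fun j t) = 0"
  shows "(2 * real J + 1) * integral {a..b} (\<lambda>t. (f t)\<^sup>2) \<le> integral {a..b} (\<lambda>t. (f' t)\<^sup>2 + t\<^sup>2 * (f t)\<^sup>2)"
proof -
  have cf: "continuous_on S f" for S using f by (meson DERIV_continuous continuous_at_imp_continuous_on)
  have cf': "continuous_on S f'" for S using cf' continuous_on_subset by blast
  have "((\<lambda>t. t * (f t)\<^sup>2) has_real_derivative (f' t + t * f t)\<^sup>2 + (f t)\<^sup>2 - ((f' t)\<^sup>2 + t\<^sup>2 * (f t)\<^sup>2)) (at t)" for t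
    by (rule derivative_eq_intros f refl)+ (simp add: power2_eq_square algebra_simps)
  from integral_by_ftc[OF less_imp_le[OF assms(1)] this]
  have h1: "((\<lambda>t. (f' t + t * f t)\<^sup>2 + (f t)\<^sup>2 - ((f' t)\<^sup>2 + t\<^sup>2 * (f t)\<^sup>2)) has_integral 0) {a..b}"
    by (simp add: assms)
  have h2: "((\<lambda>t. (f' t + t * f t)\<^sup>2 + (f t)\<^sup>2 - ((f' t)\<^sup>2 + t\<^sup>2 * (f t)\<^sup>2)) has_integral
     integral {a..b} (\<lambda>t. (f' t + t * f t)\<^sup>2) + integral {a..b} (\<lambda>t. (f t)\<^sup>2) - integral {a..b} (\<lambda>t. (f' t)\<^sup>2 + t\<^sup>2 * (f t)\<^sup>2)) {a..b}"
    by (intro has_integral_diff has_integral_add integrable_integral integrable_continuous_interval continuous_intros cf cf')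
  have "integral {a..b} (\<lambda>t. (f' t + t * f t)\<^sup>2) + integral {a..b} (\<lambda>t. (f t)\<^sup>2) = integral {a..b} (\<lambda>t. (f' t)\<^sup>2 + t\<^sup>2 * (f t)\<^sup>2)"
    using has_integral_unique[OF h1 h2] by simp
  moreover have "2 * real J * integral {a..b} (\<lambda>t. (f t)\<^sup>2) \<le> integral {a..b} (\<lambda>t. (f' t + t * f t)\<^sup>2)"
    by (rule lowering_lower_bound[OF assms(1-5)]) (rule assms(6))
  ultimately show ?thesis by (simp add: algebra_simps)
qed

text \<open>The difference of the eigenvalues times the pairing is the increment of the Wronskian.\<close>

lemma dsol_orthogonal:
  assumes "a < b" "dsol a \<nu> b = 0" "dsol a \<mu> b = 0" "\<nu> \<noteq> \<mu>"
  shows "integral {a..b} (\<lambda>t. dsol a \<nu> t * dsol a \<mu> t) = 0"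
proof -
  have "((\<lambda>t. dsol a \<nu> t * dsol' a \<mu> t - dsol' a \<nu> t * dsol a \<mu> t) has_real_derivative
      (\<nu> - \<mu>) * (dsol a \<nu> t * dsol a \<mu> t)) (at t)" for t
    by (rule derivative_eq_intros dsol_deriv dsol'_deriv refl)+ (simp add: algebra_simps)
  from integral_by_ftc[OF less_imp_le[OF assms(1)] this]
  have "((\<lambda>t. (\<nu> - \<mu>) * (dsol a \<nu> t * dsol a \<mu> t)) has_integral 0) {a..b}"
    using assms by (simp add: dsol_init)
  then have "integral {a..b} (\<lambda>t. (\<nu> - \<mu>) * (dsol a \<nu> t * dsol a \<mu> t)) = 0" by (rule integral_unique)
  then show ?thesis using assms by simp
qed

lemma dsol_norm_pos:
  assumes "a < b"
  shows "0 < integral {a..b} (\<lambda>t. (dsol a \<nu> t)\<^sup>2)"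
proof -
  have c: "continuous_on {a..b} (\<lambda>t. (dsol a \<nu> t)\<^sup>2)" by (intro continuous_intros continuous_on_dsol)
  have "0 \<le> integral {a..b} (\<lambda>t. (dsol a \<nu> t)\<^sup>2)"
    by (intro integral_nonneg integrable_continuous_interval c) auto
  moreover have "integral {a..b} (\<lambda>t. (dsol a \<nu> t)\<^sup>2) \<noteq> 0"
  proof
    assume "integral {a..b} (\<lambda>t. (dsol a \<nu> t)\<^sup>2) = 0"
    then have z: "\<forall>t\<in>{a..b}. dsol a \<nu> t = 0"
      using integral_eq_0_iff[OF c assms] by simp
    \<comment> \<open>The slope 1 at the left end point makes the solution positive immediately to the right of it.\<close>
    have "(dsol a \<nu> has_real_derivative 1) (at a)" using dsol_deriv[of a \<nu> a] by (simp add: dsol_init)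
    then obtain d where d: "0 < d" "\<And>h. 0 < h \<Longrightarrow> h < d \<Longrightarrow> dsol a \<nu> a < dsol a \<nu> (a + h)"
      using DERIV_pos_inc_right[of "dsol a \<nu>" 1 a] by auto
    define h where "h = min (d/2) (b - a)"
    have "0 < dsol a \<nu> (a + h)" using d(2)[of h] d(1) assms by (auto simp: h_def dsol_init)
    moreover have "a + h \<in> {a..b}" using d(1) assms by (auto simp: h_def)
    ultimately show False using z by auto
  qed
  ultimately show ?thesis by linarith
qed

text \<open>
  If there were more than \<open>J\<close> eigenvalues, some combination of their eigenfunctions would be
  orthogonal to the first \<open>J\<close> Hermite functions, and the two bounds of its energy would
  contradict each other.
\<close>

lemma dirichlet_eigenvalues_le:
  assumes ab: "a < b" and e: "e < 2 * real J + 1"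
    and S: "S \<subseteq> {\<nu>. \<nu> \<le> e \<and> dsol a \<nu> b = 0}" "finite S"
  shows "card S \<le> J"
proof (rule ccontr)
  assume "\<not> card S \<le> J"
  define p where "p = card S"
  have pJ: "J < p" using \<open>\<not> card S \<le> J\<close> by (simp add: p_def)
  obtain \<nu> where bij: "bij_betw \<nu> {..<p} S"
    using ex_bij_betw_nat_finite[OF S(2)] by (auto simp: p_def atLeast0LessThan)
  have \<nu>S: "\<nu> i \<le> e" "dsol a (\<nu> i) b = 0" if "i < p" for i
    using bij_betwE[OF bij] S(1) that by auto
  obtain c where c: "\<exists>i<p. c i \<noteq> 0"
    and c0: "\<forall>j<J. (\<Sum>i<p. c i * integral {a..b} (\<lambda>t. dsol a (\<nu> i) t * hermite_fun j t)) = 0"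
    using exists_nontrivial_solution[OF pJ, of "\<lambda>j i. integral {a..b} (\<lambda>t. dsol a (\<nu> i) t * hermite_fun j t)"] by blast
  define f where "f t = (\<Sum>i<p. c i * dsol a (\<nu> i) t)" for t
  define f' where "f' t = (\<Sum>i<p. c i * dsol' a (\<nu> i) t)" for t
  have f: "(f has_real_derivative f' t) (at t)" for t
    unfolding f_def[abs_def] f'_def by (auto intro!: derivative_eq_intros dsol_deriv simp: mult_ac)
  have f': "(f' has_real_derivative (\<Sum>i<p. c i * ((t\<^sup>2 - \<nu> i) * dsol a (\<nu> i) t))) (at t)" for t
    unfolding f'_def[abs_def] by (auto intro!: derivative_eq_intros dsol'_deriv simp: mult_ac)
  have cf: "continuous_on S f" for S using f by (meson DERIV_continuous continuous_at_imp_continuous_on)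
  have cf': "continuous_on S f'" for S using f' by (meson DERIV_continuous continuous_at_imp_continuous_on)
  have fab: "f a = 0" "f b = 0" using \<nu>S by (auto simp: f_def dsol_init)
  note int = integrable_continuous_interval
  have orth: "integral {a..b} (\<lambda>t. f t * hermite_fun j t) = 0" if "j < J" for j
  proof -
    have "integral {a..b} (\<lambda>t. f t * hermite_fun j t) = integral {a..b} (\<lambda>t. \<Sum>i<p. c i * (dsol a (\<nu> i) t * hermite_fun j t))"
      by (simp add: f_def sum_distrib_right mult.assoc)
    also have "\<dots> = (\<Sum>i<p. c i * integral {a..b} (\<lambda>t. dsol a (\<nu> i) t * hermite_fun j t))"
      by (subst integral_sum) (auto intro!: int continuous_intros continuous_on_dsol)
    finally show ?thesis using c0 that by simp
  qed
  define n where "n i = integral {a..b} (\<lambda>t. (dsol a (\<nu> i) t)\<^sup>2)" for i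
  have n: "0 < n i" for i unfolding n_def by (rule dsol_norm_pos[OF ab])
  have pair: "integral {a..b} (\<lambda>t. dsol a (\<nu> i) t * dsol a (\<nu> k) t) = (if i = k then n i else 0)"
    if "i < p" "k < p" for i k
    using dsol_orthogonal[OF ab, of "\<nu> i" "\<nu> k"] \<nu>S that bij
    by (auto simp: n_def power2_eq_square bij_betw_def inj_on_def)
  have quad: "integral {a..b} (\<lambda>t. f t * (\<Sum>i<p. d i * dsol a (\<nu> i) t)) = (\<Sum>i<p. c i * d i * n i)" for d
  proof -
    have "integral {a..b} (\<lambda>t. f t * (\<Sum>i<p. d i * dsol a (\<nu> i) t))
        = integral {a..b} (\<lambda>t. \<Sum>i<p. \<Sum>k<p. c i * d k * (dsol a (\<nu> i) t * dsol a (\<nu> k) t))"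
      by (simp add: f_def sum_product mult_ac)
    also have "\<dots> = (\<Sum>i<p. \<Sum>k<p. c i * d k * integral {a..b} (\<lambda>t. dsol a (\<nu> i) t * dsol a (\<nu> k) t))"
      by (subst integral_sum, auto intro!: int continuous_intros continuous_on_dsol)
         (subst integral_sum, auto intro!: int continuous_intros continuous_on_dsol)
    also have "\<dots> = (\<Sum>i<p. \<Sum>k<p. if k = i then c i * d i * n i else 0)"
      by (intro sum.cong) (auto simp: pair)
    also have "\<dots> = (\<Sum>i<p. c i * d i * n i)" by simp
    finally show ?thesis .
  qed
  have norm: "integral {a..b} (\<lambda>t. (f t)\<^sup>2) = (\<Sum>i<p. (c i)\<^sup>2 * n i)"
    using quad[of c] by (simp add: f_def power2_eq_square)
  have "((\<lambda>t. f t * f' t) has_real_derivative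
      (f' t)\<^sup>2 + t\<^sup>2 * (f t)\<^sup>2 - f t * (\<Sum>i<p. (c i * \<nu> i) * dsol a (\<nu> i) t)) (at t)" for t
  proof -
    have eq: "(\<Sum>i<p. c i * ((t\<^sup>2 - \<nu> i) * dsol a (\<nu> i) t)) = t\<^sup>2 * f t - (\<Sum>i<p. (c i * \<nu> i) * dsol a (\<nu> i) t)"
      by (simp add: f_def algebra_simps sum_subtractf sum_distrib_left)
    have f'2: "(f' has_real_derivative t\<^sup>2 * f t - (\<Sum>i<p. (c i * \<nu> i) * dsol a (\<nu> i) t)) (at t)"
      using f'[of t] unfolding eq .
    show ?thesis
      by (rule derivative_eq_intros f f'2 refl)+ (simp add: power2_eq_square algebra_simps)
  qed
  from integral_by_ftc[OF less_imp_le[OF ab] this]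
  have h1: "((\<lambda>t. (f' t)\<^sup>2 + t\<^sup>2 * (f t)\<^sup>2 - f t * (\<Sum>i<p. (c i * \<nu> i) * dsol a (\<nu> i) t)) has_integral 0) {a..b}"
    by (simp add: fab)
  have h2: "((\<lambda>t. (f' t)\<^sup>2 + t\<^sup>2 * (f t)\<^sup>2 - f t * (\<Sum>i<p. (c i * \<nu> i) * dsol a (\<nu> i) t)) has_integral
     integral {a..b} (\<lambda>t. (f' t)\<^sup>2 + t\<^sup>2 * (f t)\<^sup>2) - integral {a..b} (\<lambda>t. f t * (\<Sum>i<p. (c i * \<nu> i) * dsol a (\<nu> i) t))) {a..b}"
    by (intro has_integral_diff integrable_integral int continuous_intros cf cf' continuous_on_dsol)
  have energy: "integral {a..b} (\<lambda>t. (f' t)\<^sup>2 + t\<^sup>2 * (f t)\<^sup>2) = (\<Sum>i<p. c i * (c i * \<nu> i) * n i)"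
    using has_integral_unique[OF h1 h2] quad[of "\<lambda>i. c i * \<nu> i"] by simp
  have pos: "0 < (\<Sum>i<p. (c i)\<^sup>2 * n i)"
  proof -
    obtain k where k: "k < p" "c k \<noteq> 0" using c by blast
    have "0 < (c k)\<^sup>2 * n k" using k n[of k] by simp
    also have "\<dots> \<le> (\<Sum>i<p. (c i)\<^sup>2 * n i)"
      using k by (intro member_le_sum mult_nonneg_nonneg less_imp_le[OF n]) auto
    finally show ?thesis .
  qed
  have "(2 * real J + 1) * (\<Sum>i<p. (c i)\<^sup>2 * n i) \<le> (\<Sum>i<p. c i * (c i * \<nu> i) * n i)"
    using oscillator_form_lower_bound[OF ab f cf' fab orth] by (simp add: norm energy)
  also have "\<dots> \<le> (\<Sum>i<p. e * ((c i)\<^sup>2 * n i))"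
  proof (rule sum_mono)
    fix i assume "i \<in> {..<p}"
    then have "\<nu> i * ((c i)\<^sup>2 * n i) \<le> e * ((c i)\<^sup>2 * n i)"
      using \<nu>S n[of i] by (intro mult_right_mono) auto
    then show "c i * (c i * \<nu> i) * n i \<le> e * ((c i)\<^sup>2 * n i)" by (simp add: power2_eq_square mult_ac)
  qed
  also have "\<dots> = e * (\<Sum>i<p. (c i)\<^sup>2 * n i)" by (simp add: sum_distrib_left)
  finally show False using pos e by (simp add: mult_le_cancel_right)
qed

text \<open>Below the minimum of the potential there is no oscillation, hence no eigenvalue.\<close>

lemma dsol_pos_below_potential:
  assumes "a < t" "\<And>s. s \<in> {a..t} \<Longrightarrow> \<nu> \<le> s\<^sup>2"
  shows "0 < dsol a \<nu> t"
proof (rule ccontr)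
  let ?y = "dsol a \<nu>" and ?y' = "dsol' a \<nu>"
  assume "\<not> 0 < ?y t"
  \<comment> \<open>The product of the solution and its derivative would increase from 0 to 0.\<close>
  have der: "((\<lambda>s. ?y s * ?y' s) has_real_derivative (?y' s)\<^sup>2 + (s\<^sup>2 - \<nu>) * (?y s)\<^sup>2) (at s)" for s
    by (rule derivative_eq_intros dsol_deriv dsol'_deriv refl)+ (simp add: power2_eq_square algebra_simps)
  have "(?y has_real_derivative 1) (at a)" using dsol_deriv[of a \<nu> a] by (simp add: dsol_init)
  then obtain d where d: "0 < d" "\<And>h. 0 < h \<Longrightarrow> h < d \<Longrightarrow> ?y a < ?y (a + h)"
    using DERIV_pos_inc_right[of ?y 1 a] by auto
  define h where "h = min (d/2) (t - a)"
  have h: "0 < ?y (a + h)" "a < a + h" "a + h \<le> t" using d(2)[of h] d(1) assms by (auto simp: h_def dsol_init)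
  obtain z where z: "a + h \<le> z" "z \<le> t" "?y z = 0"
    using IVT2'[of ?y t 0 "a + h"] h \<open>\<not> 0 < ?y t\<close> continuous_on_dsol by (auto simp: not_less)
  have az: "a < z" using z h by linarith
  let ?D = "\<lambda>s. (?y' s)\<^sup>2 + (s\<^sup>2 - \<nu>) * (?y s)\<^sup>2"
  have "(?D has_integral 0) {a..z}"
    using integral_by_ftc[OF less_imp_le[OF az] der] z by (simp add: dsol_init)
  moreover have cD: "continuous_on {a..z} ?D" by (intro continuous_intros continuous_on_dsol)
  moreover have nn: "0 \<le> ?D s" if "s \<in> {a..z}" for s
    using assms(2)[of s] that z by (intro add_nonneg_nonneg mult_nonneg_nonneg) auto
  ultimately have "?D a = 0"
    using integral_eq_0_iff[OF cD az nn] az by (auto simp: integral_unique)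
  then show False by (simp add: dsol_init)
qed

section \<open>Lower bound in one dimension\<close>

text \<open>
  Looking at the first return to the level \<open>c\<close>: just before it the function would have to be
  below \<open>c\<close>, so it would have returned earlier.
\<close>

lemma upcrossing_stays_above:
  fixes \<theta> :: "real \<Rightarrow> real"
  assumes cont: "continuous_on {a..b} \<theta>"
    and cross: "\<And>s. s \<in> {a..b} \<Longrightarrow> \<theta> s = c \<Longrightarrow>
      \<exists>d>0. \<forall>t\<in>{a..b}. (s < t \<and> t < s + d \<longrightarrow> c < \<theta> t) \<and> (s - d < t \<and> t < s \<longrightarrow> \<theta> t < c)"
    and s: "s \<in> {a..b}" "\<theta> s = c" and t: "s < t" "t \<in> {a..b}"
  shows "c < \<theta> t"
proof (rule ccontr)
  assume "\<not> c < \<theta> t"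
  obtain d where d: "0 < d" "\<And>u. u \<in> {a..b} \<Longrightarrow> s < u \<Longrightarrow> u < s + d \<Longrightarrow> c < \<theta> u"
    using cross[OF s] by blast
  define h where "h = min (s + d/2) t"
  have h: "s < h" "h \<le> t" "h \<in> {a..b}" using d(1) t s by (auto simp: h_def)
  have "c < \<theta> (min (s + d/2) t)"
  proof (cases "h = t")
    case True
    then have "t < s + d" using d(1) by (auto simp: h_def)
    then show ?thesis using d(2)[of t] t True h_def by auto
  next
    case False
    then show ?thesis using d h by (auto simp: h_def min_def split: if_splits)
  qed
  then have ch: "c < \<theta> h" by (simp add: h_def)
  define A where "A = {u \<in> {h..t}. \<theta> u = c}"
  have sub: "{h..t} \<subseteq> {a..b}" using h t by auto
  have cht: "continuous_on {h..t} \<theta>" using cont sub continuous_on_subset by blast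
  obtain u where "h \<le> u" "u \<le> t" "\<theta> u = c"
    using IVT2'[of \<theta> t c h] ch \<open>\<not> c < \<theta> t\<close> h cht by auto
  then have "A \<noteq> {}" by (auto simp: A_def)
  moreover have "compact A"
  proof -
    have "closed A" unfolding A_def
      using continuous_closed_preimage_constant[OF cht] by auto
    moreover have "bounded A" by (rule bounded_subset[of "{h..t}"]) (auto simp: A_def)
    ultimately show ?thesis by (simp add: compact_eq_bounded_closed)
  qed
  ultimately obtain m where m: "m \<in> A" "\<And>u. u \<in> A \<Longrightarrow> m \<le> u"
    using compact_attains_inf[of A] by blast
  have hm: "h < m" using m(1) ch by (cases "h = m") (auto simp: A_def)
  obtain d' where d': "0 < d'" "\<And>u. u \<in> {a..b} \<Longrightarrow> m - d' < u \<Longrightarrow> u < m \<Longrightarrow> \<theta> u < c"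
    using cross[of m] m(1) sub by (auto simp: A_def)
  define u where "u = max (m - d'/2) ((h + m)/2)"
  have u: "h \<le> u" "u < m" "m - d' < u" using d'(1) hm by (auto simp: u_def max_def field_simps)
  then have uab: "u \<in> {a..b}" using m(1) sub by (auto simp: A_def)
  have "\<theta> u < c" using d'(2)[OF uab] u by auto
  moreover have "continuous_on {h..u} \<theta>"
    by (rule continuous_on_subset[OF cht]) (use u m in \<open>auto simp: A_def\<close>)
  ultimately obtain v where v: "h \<le> v" "v \<le> u" "\<theta> v = c"
    using IVT2'[of \<theta> u c h] ch u by auto
  then have "v \<in> A" using u m by (auto simp: A_def)
  then show False using m(2)[of v] v u by auto
qed

text \<open>
  Sturm's counting argument. The phase of the curve \<open>y' + i y\<close> depends continuously on the
  spectral parameter, and its value at the right end point is a multiple of \<open>\<pi>\<close> exactly at the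
  eigenvalues. It starts from 0 and can pass a multiple of \<open>\<pi>\<close> only upwards as \<open>t\<close> increases,
  so a phase that ends below \<open>J \<pi>\<close> allows fewer than \<open>J\<close> zeros, and otherwise the
  intermediate value theorem in the spectral parameter provides \<open>J\<close> eigenvalues.
\<close>

lemma few_zeros_or_many_eigenvalues:
  assumes ab: "a < b" and J: "1 \<le> J"
  shows "(finite {t\<in>{a<..<b}. dsol a e t = 0} \<and> card {t\<in>{a<..<b}. dsol a e t = 0} < J)
    \<or> (\<exists>S. finite S \<and> card S = J \<and> S \<subseteq> {\<nu>. \<nu> \<le> e \<and> dsol a \<nu> b = 0})"
proof -
  define \<nu>0 where "\<nu>0 = min 0 e"
  let ?S = "{a..b} \<times> {\<nu>0..e}"
  define z where "z = (\<lambda>(t, \<nu>). Complex (dsol' a \<nu> t) (dsol a \<nu> t))"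
  have cz: "continuous_on ?S z"
    unfolding z_def Complex_eq case_prod_unfold
    using continuous_on_dsol2[of ?S a]
    by (auto intro!: continuous_intros simp: case_prod_unfold)
  moreover have "contractible ?S"
    by (intro convex_imp_contractible convex_Times) auto
  moreover have z0: "z x \<noteq> 0" for x
    using dsol_nonzero[of a "snd x" "fst x"] by (auto simp: z_def case_prod_unfold Complex_eq_0)
  ultimately obtain g where g: "continuous_on ?S g" "\<And>x. x \<in> ?S \<Longrightarrow> z x = exp (g x)"
    using continuous_logarithm_on_contractible[of ?S z] by metis
  define \<theta> where "\<theta> t \<nu> = Im (g (t, \<nu>) - g (a, \<nu>))" for t \<nu>
  have polar: "dsol a \<nu> t = norm (z (t, \<nu>)) * sin (\<theta> t \<nu>)" "dsol' a \<nu> t = norm (z (t, \<nu>)) * cos (\<theta> t \<nu>)"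
    if "t \<in> {a..b}" "\<nu> \<in> {\<nu>0..e}" for t \<nu>
  proof -
    have "z (a, \<nu>) = 1" by (simp add: z_def dsol_init complex_eq_iff)
    then have "exp (g (t, \<nu>) - g (a, \<nu>)) = z (t, \<nu>)"
      using g(2)[of "(t, \<nu>)"] g(2)[of "(a, \<nu>)"] that ab by (simp add: exp_diff)
    then have *: "z (t, \<nu>) = exp (g (t, \<nu>) - g (a, \<nu>))" by simp
    have "dsol a \<nu> t = Im (z (t, \<nu>))" "dsol' a \<nu> t = Re (z (t, \<nu>))" by (simp_all add: z_def)
    then show "dsol a \<nu> t = norm (z (t, \<nu>)) * sin (\<theta> t \<nu>)" "dsol' a \<nu> t = norm (z (t, \<nu>)) * cos (\<theta> t \<nu>)"
      unfolding * by (simp_all add: \<theta>_def Re_exp Im_exp norm_exp_eq_Re)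
  qed
  have c1: "continuous_on {a..b} (\<lambda>t. \<theta> t \<nu>)" if "\<nu> \<in> {\<nu>0..e}" for \<nu>
    unfolding \<theta>_def using that ab
    by (auto intro!: continuous_intros continuous_on_compose2[OF g(1)])
  have c2: "continuous_on {\<nu>0..e} (\<lambda>\<nu>. \<theta> t \<nu>)" if "t \<in> {a..b}" for t
    unfolding \<theta>_def using that ab
    by (auto intro!: continuous_intros continuous_on_compose2[OF g(1)])
  have \<theta>a: "\<theta> a \<nu> = 0" for \<nu> by (simp add: \<theta>_def)
  have \<nu>0e: "\<nu>0 \<in> {\<nu>0..e}" "e \<in> {\<nu>0..e}" by (auto simp: \<nu>0_def)
  have above: "real_of_int i * pi < \<theta> t e"
    if "s \<in> {a..b}" "\<theta> s e = real_of_int i * pi" "s < t" "t \<in> {a..b}" for i s t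
  proof (rule upcrossing_stays_above[OF c1[OF \<nu>0e(2)] _ that])
    fix s assume s: "s \<in> {a..b}" "\<theta> s e = real_of_int i * pi"
    let ?y = "dsol a e"
    have sin0: "sin (\<theta> s e) = 0" unfolding s(2) by (simp add: sin_zero_iff_int2)
    then have "?y s = 0" using polar[OF s(1) \<nu>0e(2)] by simp
    define w where "w = dsol' a e s"
    have w0: "w \<noteq> 0" using \<open>?y s = 0\<close> dsol_nonzero[of a e s] by (simp add: w_def)
    have "((\<lambda>t. ?y t * w) has_real_derivative w * w) (at s)"
      unfolding w_def by (rule derivative_eq_intros dsol_deriv refl)+ simp
    moreover have "0 < w * w" using w0 not_real_square_gt_zero by blast
    ultimately obtain d1 d2 where d: "0 < d1" "\<And>h. 0 < h \<Longrightarrow> h < d1 \<Longrightarrow> 0 < ?y (s + h) * w"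
      "0 < d2" "\<And>h. 0 < h \<Longrightarrow> h < d2 \<Longrightarrow> ?y (s - h) * w < 0"
      using DERIV_pos_inc_right[of "\<lambda>t. ?y t * w" "w * w" s] DERIV_pos_inc_left[of "\<lambda>t. ?y t * w" "w * w" s]
      \<open>?y s = 0\<close> by auto
    obtain d3 where d3: "0 < d3" "\<And>t. t \<in> {a..b} \<Longrightarrow> \<bar>t - s\<bar> < d3 \<Longrightarrow> \<bar>\<theta> t e - \<theta> s e\<bar> < pi"
      using c1[OF \<nu>0e(2), unfolded continuous_on_iff] s(1) pi_gt_zero by (metis dist_real_def)
    have key: "sin (\<theta> t e - \<theta> s e) * (norm (z (t, e)) * norm (z (s, e))) = ?y t * w" if "t \<in> {a..b}" for t
      using polar[OF that \<nu>0e(2)] polar[OF s(1) \<nu>0e(2)] sin0 by (simp add: sin_diff w_def)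
    have zpos: "0 < norm (z (t, e)) * norm (z (s, e))" for t using z0 by simp
    show "\<exists>d>0. \<forall>t\<in>{a..b}. (s < t \<and> t < s + d \<longrightarrow> real_of_int i * pi < \<theta> t e) \<and> (s - d < t \<and> t < s \<longrightarrow> \<theta> t e < real_of_int i * pi)"
    proof (intro exI[of _ "min d1 (min d2 d3)"] conjI ballI impI)
      fix t assume t: "t \<in> {a..b}"
      show "real_of_int i * pi < \<theta> t e" if "s < t \<and> t < s + min d1 (min d2 d3)"
      proof -
        have "0 < ?y t * w" using d(2)[of "t - s"] that by auto
        then have "0 < sin (\<theta> t e - \<theta> s e)" using key[OF t] zpos[of t] by (metis zero_less_mult_pos2)
        moreover have "\<bar>\<theta> t e - \<theta> s e\<bar> < pi" using d3(2)[OF t] that by auto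
        ultimately have "0 < \<theta> t e - \<theta> s e" using sin_ge_zero[of "\<theta> s e - \<theta> t e"] sin_minus[of "\<theta> t e - \<theta> s e"] by force
        then show ?thesis using s by simp
      qed
      show "\<theta> t e < real_of_int i * pi" if "s - min d1 (min d2 d3) < t \<and> t < s"
      proof -
        have "?y t * w < 0" using d(4)[of "s - t"] that by auto
        then have "sin (\<theta> t e - \<theta> s e) < 0" using key[OF t] zpos[of t]
          by (metis mult_less_0_iff not_less_iff_gr_or_eq)
        moreover have "\<bar>\<theta> t e - \<theta> s e\<bar> < pi" using d3(2)[OF t] that by auto
        ultimately have "\<theta> t e - \<theta> s e < 0" using sin_ge_zero[of "\<theta> t e - \<theta> s e"] by force
        then show ?thesis using s by simp
      qed
    qed (use d d3 in auto)
  qed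
  show ?thesis
  proof (cases "\<theta> b e < real J * pi")
    case True
    let ?Z = "{t\<in>{a<..<b}. dsol a e t = 0}"
    have phase: "\<exists>i::int. \<theta> t e = real_of_int i * pi \<and> 1 \<le> i \<and> i < int J" if "t \<in> ?Z" for t
    proof -
      have t: "t \<in> {a..b}" "a < t" "t < b" "dsol a e t = 0" using that by auto
      have "sin (\<theta> t e) = 0" using polar(1)[OF t(1) \<nu>0e(2)] t(4) z0 by simp
      then obtain i :: int where i: "\<theta> t e = real_of_int i * pi" by (auto simp: sin_zero_iff_int2)
      have "0 < real_of_int i * pi" using above[of a 0 t] \<theta>a t i ab by simp
      then have "1 \<le> i" by (simp add: zero_less_mult_iff)
      moreover have "real_of_int i * pi < \<theta> b e" using above[of t i b] t i ab by auto
      with True have "real_of_int i * pi < real J * pi" by linarith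
      then have "real_of_int i < real J" by simp
      then have "i < int J" by linarith
      ultimately show ?thesis using i by blast
    qed
    have inj: "inj_on (\<lambda>t. \<theta> t e / pi) ?Z"
    proof (rule linorder_inj_onI)
      fix s t assume st: "s < t" "s \<in> ?Z" "t \<in> ?Z"
      obtain i where "\<theta> s e = real_of_int i * pi" using phase[OF st(2)] by blast
      then have "\<theta> s e < \<theta> t e" using above[of s i t] st by auto
      then show "\<theta> s e / pi \<noteq> \<theta> t e / pi" by simp
    qed auto
    have img: "(\<lambda>t. \<theta> t e / pi) ` ?Z \<subseteq> real_of_int ` {1..<int J}"
    proof
      fix x assume "x \<in> (\<lambda>t. \<theta> t e / pi) ` ?Z"
      then obtain t where "t \<in> ?Z" "x = \<theta> t e / pi" by blast
      then show "x \<in> real_of_int ` {1..<int J}" using phase[of t] by auto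
    qed
    have fin: "finite ?Z" using inj_on_finite[OF inj img] by simp
    have "card ?Z \<le> card (real_of_int ` {1..<int J})"
      by (rule card_inj_on_le[OF inj img]) simp
    also have "\<dots> \<le> card {1..<int J}" by (rule card_image_le) simp
    also have "\<dots> < J" using J by simp
    finally show ?thesis using fin by blast
  next
    case False
    have "\<theta> b \<nu>0 < pi"
    proof (rule ccontr)
      assume "\<not> \<theta> b \<nu>0 < pi"
      then obtain t where t: "a \<le> t" "t \<le> b" "\<theta> t \<nu>0 = pi"
        using IVT'[of "\<lambda>t. \<theta> t \<nu>0" a pi b] \<theta>a[of \<nu>0] c1[OF \<nu>0e(1)] ab by auto
      then have "a < t" using \<theta>a[of \<nu>0] by (cases "a = t") auto
      moreover have "dsol a \<nu>0 t = 0" using polar(1)[of t \<nu>0] t \<nu>0e by simp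
      moreover have "\<nu>0 \<le> s\<^sup>2" for s by (simp add: \<nu>0_def min_le_iff_disj)
      ultimately show False using dsol_pos_below_potential[of a t \<nu>0] by simp
    qed
    have "\<exists>\<nu>. \<nu> \<in> {\<nu>0..e} \<and> \<theta> b \<nu> = real i * pi" if "i \<in> {1..J}" for i
    proof -
      have "1 * pi \<le> real i * pi" "real i * pi \<le> real J * pi"
        using that by (intro mult_right_mono; simp)+
      then have "\<theta> b \<nu>0 \<le> real i * pi" "real i * pi \<le> \<theta> b e"
        using \<open>\<theta> b \<nu>0 < pi\<close> False by linarith+
      then show ?thesis
        using IVT'[of "\<theta> b" \<nu>0 "real i * pi" e] c2[of b] ab \<nu>0e by auto
    qed
    then obtain \<nu> where \<nu>: "\<And>i. i \<in> {1..J} \<Longrightarrow> \<nu> i \<in> {\<nu>0..e} \<and> \<theta> b (\<nu> i) = real i * pi"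
      by metis
    have inj: "inj_on \<nu> {1..J}"
    proof (rule inj_onI)
      fix i j assume ij: "i \<in> {1..J}" "j \<in> {1..J}" "\<nu> i = \<nu> j"
      then have "real i * pi = real j * pi" using \<nu> by metis
      then show "i = j" by simp
    qed
    have "dsol a (\<nu> i) b = 0" if "i \<in> {1..J}" for i
      using polar(1)[of b "\<nu> i"] \<nu>[OF that] ab by simp
    then have "\<nu> ` {1..J} \<subseteq> {\<nu>. \<nu> \<le> e \<and> dsol a \<nu> b = 0}" using \<nu> by auto
    moreover have "card (\<nu> ` {1..J}) = J" using card_image[OF inj] by simp
    ultimately show ?thesis by (intro disjI2 exI[of _ "\<nu> ` {1..J}"]) auto
  qed
qed

text \<open>
  Jacobi's condition: writing the test function as a multiple of the solution turns the
  energy into a square plus the derivative of a function \<open>K\<close> that extends continuously by 0 to the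
  zeros of the solution.
\<close>

lemma jacobi_form_nonneg:
  assumes ab: "a < b"
    and Z: "finite {t\<in>{a<..<b}. dsol a e t = 0}"
    and g: "\<And>t. (g has_real_derivative g' t) (at t)" and cg': "continuous_on UNIV g'"
    and g0: "g a = 0" "g b = 0" "\<And>t. t \<in> {a<..<b} \<Longrightarrow> dsol a e t = 0 \<Longrightarrow> g t = 0"
  shows "0 \<le> integral {a..b} (\<lambda>t. (g' t)\<^sup>2 + (t\<^sup>2 - e) * (g t)\<^sup>2)"
proof -
  let ?y = "dsol a e" and ?y' = "dsol' a e"
  \<comment> \<open>Since x / 0 = 0, this is also the continuous extension to the zeros.\<close>
  define K where "K t = (g t)\<^sup>2 * ?y' t / ?y t" for t
  let ?Z = "{t\<in>{a<..<b}. dsol a e t = 0} \<union> {a, b}"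
  have cg: "isCont g t" for t using g DERIV_isCont by blast
  have cg'2: "continuous_on S g'" for S using cg' continuous_on_subset by blast
  have cy: "isCont ?y t" "isCont ?y' t" for t using dsol_deriv dsol'_deriv DERIV_isCont by blast+
  have "isCont K t" if "t \<in> {a..b}" for t
  proof (cases "?y t = 0")
    case False
    then show ?thesis unfolding K_def[abs_def] by (intro continuous_intros cg cy) auto
  next
    case True
    have gt: "g t = 0"
    proof (cases "t \<in> {a<..<b}")
      case False
      then have "t = a \<or> t = b" using that by auto
      then show ?thesis using g0 by auto
    qed (use g0(3)[of t] True in auto)
    have y't: "?y' t \<noteq> 0" using True dsol_nonzero by blast
    have "((\<lambda>s. g s * ?y' s * (((g s - g t) / (s - t)) / ((?y s - ?y t) / (s - t)))) \<longlongrightarrow> g t * ?y' t * (g' t / ?y' t)) (at t)"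
      using g[of t] dsol_deriv[of a e t] y't cg[of t] cy(2)[of t]
      by (intro tendsto_intros) (auto simp: has_field_derivative_iff isCont_def)
    moreover have "\<forall>\<^sub>F s in at t. g s * ?y' s * (((g s - g t) / (s - t)) / ((?y s - ?y t) / (s - t))) = K s"
      unfolding eventually_at_filter
      by (rule always_eventually) (auto simp: K_def gt True power2_eq_square)
    ultimately have "(K \<longlongrightarrow> g t * ?y' t * (g' t / ?y' t)) (at t)" by (simp add: filterlim_cong)
    then show ?thesis by (simp add: isCont_def K_def gt True)
  qed
  then have cK: "continuous_on {a..b} K" by (simp add: continuous_at_imp_continuous_on)
  have dK: "(K has_real_derivative
      ((g' t)\<^sup>2 + (t\<^sup>2 - e) * (g t)\<^sup>2) - (g' t - g t * ?y' t / ?y t)\<^sup>2) (at t)" if "?y t \<noteq> 0" for t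
    unfolding K_def[abs_def] using that
    by (auto intro!: derivative_eq_intros g dsol_deriv dsol'_deriv simp: power2_eq_square field_simps)
  have "((\<lambda>t. ((g' t)\<^sup>2 + (t\<^sup>2 - e) * (g t)\<^sup>2) - (g' t - g t * ?y' t / ?y t)\<^sup>2) has_integral K b - K a) {a..b}"
  proof (rule fundamental_theorem_of_calculus_interior_strong[OF _ _ _ cK])
    show "finite ?Z" using Z by simp
    fix t assume "t \<in> {a<..<b} - ?Z"
    then have "?y t \<noteq> 0" by auto
    from dK[OF this] show "(K has_vector_derivative ((g' t)\<^sup>2 + (t\<^sup>2 - e) * (g t)\<^sup>2) - (g' t - g t * ?y' t / ?y t)\<^sup>2) (at t)"
      by (simp add: has_real_derivative_iff_has_vector_derivative)
  qed (use ab in auto)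
  moreover have "K b - K a = 0" by (simp add: K_def g0)
  ultimately have h1: "((\<lambda>t. ((g' t)\<^sup>2 + (t\<^sup>2 - e) * (g t)\<^sup>2) - (g' t - g t * ?y' t / ?y t)\<^sup>2) has_integral 0) {a..b}"
    by simp
  have "((\<lambda>t. (g' t)\<^sup>2 + (t\<^sup>2 - e) * (g t)\<^sup>2) has_integral integral {a..b} (\<lambda>t. (g' t)\<^sup>2 + (t\<^sup>2 - e) * (g t)\<^sup>2)) {a..b}"
    using cg by (intro integrable_integral integrable_continuous_interval continuous_intros cg'2) (auto intro: continuous_at_imp_continuous_on)
  from has_integral_le[OF h1 this] show ?thesis by simp
qed

lemma power_exp_le_fact: "0 \<le> x \<Longrightarrow> x ^ n \<le> fact n * exp (x::real)"
proof -
  assume x: "0 \<le> x"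
  have "(\<lambda>i. x ^ i / fact i) sums exp x" using exp_converges[of x] by (simp add: field_simps)
  then have "(\<Sum>i\<in>{n}. x ^ i / fact i) \<le> exp x"
    using x by (metis (no_types, lifting) sum_le_suminf sums_iff divide_nonneg_nonneg finite.emptyI finite.insertI fact_ge_zero zero_le_power)
  then show ?thesis by (simp add: field_simps)
qed

text \<open>An integrable majorant whose integral over any interval is elementary, being at most a multiple of \<open>\<pi>\<close>.\<close>

lemma poly_gauss_bound:
  "\<exists>K::real\<ge>0. \<forall>t. \<bar>poly q t\<bar> * exp (- t\<^sup>2) \<le> K / (1 + t\<^sup>2)"
proof -
  define r where "r = [:1, 0, 1:] * q"
  define K where "K = (\<Sum>i\<le>degree r. \<bar>coeff r i\<bar> * (fact i * exp 1))"
  have K0: "0 \<le> K" unfolding K_def by (intro sum_nonneg) auto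
  have mono: "\<bar>t\<bar> ^ i * exp (- t\<^sup>2) \<le> fact i * exp 1" for t :: real and i
  proof -
    have "\<bar>t\<bar> * 1 \<le> 1 + t\<^sup>2" using zero_le_power2[of "\<bar>t\<bar> - 1/2"] by (simp add: power2_eq_square algebra_simps)
    then have "exp (- t\<^sup>2) \<le> exp (1 - \<bar>t\<bar>)" by simp
    then have "\<bar>t\<bar> ^ i * exp (- t\<^sup>2) \<le> (fact i * exp \<bar>t\<bar>) * exp (1 - \<bar>t\<bar>)"
      using power_exp_le_fact[of "\<bar>t\<bar>" i] by (intro mult_mono) auto
    also have "\<dots> = fact i * exp 1" by (simp add: exp_diff)
    finally show ?thesis .
  qed
  have "\<bar>poly q t\<bar> * exp (- t\<^sup>2) \<le> K / (1 + t\<^sup>2)" for t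
  proof -
    have t1: "0 < 1 + t\<^sup>2" by (simp add: add_pos_nonneg)
    have "\<bar>poly r t\<bar> \<le> (\<Sum>i\<le>degree r. \<bar>coeff r i\<bar> * \<bar>t\<bar> ^ i)"
      unfolding poly_altdef by (rule order_trans[OF sum_abs]) (simp add: abs_mult power_abs)
    then have "\<bar>poly r t\<bar> * exp (- t\<^sup>2) \<le> (\<Sum>i\<le>degree r. \<bar>coeff r i\<bar> * \<bar>t\<bar> ^ i) * exp (- t\<^sup>2)"
      by (intro mult_right_mono) auto
    also have "\<dots> \<le> K" unfolding K_def sum_distrib_right
      using mono by (intro sum_mono) (simp add: mult.assoc mult_left_mono)
    finally have "\<bar>poly r t\<bar> * exp (- t\<^sup>2) \<le> K" .
    moreover have rq: "poly r t = (1 + t\<^sup>2) * poly q t" by (simp add: r_def power2_eq_square algebra_simps)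
    have "\<bar>poly r t\<bar> * exp (- t\<^sup>2) = (\<bar>poly q t\<bar> * exp (- t\<^sup>2)) * (1 + t\<^sup>2)"
      unfolding rq abs_mult using t1 by simp
    ultimately show ?thesis by (simp only: pos_le_divide_eq[OF t1])
  qed
  with K0 show ?thesis by blast
qed

lemma hermite_fun_mult: "hermite_fun i t * hermite_fun j t = poly (herm i * herm j) t * exp (- t\<^sup>2)"
proof -
  have "exp (- t\<^sup>2 / 2) * exp (- t\<^sup>2 / 2) = exp (- t\<^sup>2)" by (simp flip: exp_add)
  then show ?thesis by (simp add: hermite_fun_def mult_ac)
qed

lemma integral_lorentzian_bound:
  assumes "a \<le> b" and f: "continuous_on {a..b} f" and bd: "\<And>t. t \<in> {a..b} \<Longrightarrow> \<bar>f t\<bar> \<le> K / (1 + t\<^sup>2)"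
    and K: "0 \<le> K"
  shows "\<bar>integral {a..b} f\<bar> \<le> K * pi"
proof -
  have "((\<lambda>t. K * arctan t) has_real_derivative K / (1 + t\<^sup>2)) (at t)" for t
    by (auto intro!: derivative_eq_intros simp: divide_inverse)
  from integral_by_ftc[OF assms(1) this]
  have I: "((\<lambda>t. K / (1 + t\<^sup>2)) has_integral K * arctan b - K * arctan a) {a..b}" .
  have "norm (integral {a..b} f) \<le> integral {a..b} (\<lambda>t. K / (1 + t\<^sup>2))"
  proof (rule integral_norm_bound_integral)
    show "f integrable_on {a..b}" by (rule integrable_continuous_interval[OF f])
    show "(\<lambda>t. K / (1 + t\<^sup>2)) integrable_on {a..b}" by (rule has_integral_integrable[OF I])
  qed (use bd in auto)
  also have "\<dots> = K * (arctan b - arctan a)" using I by (simp add: integral_unique algebra_simps)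
  also have "\<dots> \<le> K * pi" using arctan_bounded[of a] arctan_bounded[of b] K by (intro mult_left_mono) auto
  finally show ?thesis by simp
qed

definition hermite_fun' :: "nat \<Rightarrow> real \<Rightarrow> real" where
  "hermite_fun' j t = t * hermite_fun j t - hermite_fun (Suc j) t"

lemma hermite_fun_deriv: "(hermite_fun j has_real_derivative hermite_fun' j t) (at t)"
  unfolding hermite_fun'_def by (rule hermite_fun_deriv_raise)

lemma hermite_fun'_deriv:
  "(hermite_fun' j has_real_derivative (t\<^sup>2 - (2 * real j + 1)) * hermite_fun j t) (at t)"
  unfolding hermite_fun'_def[abs_def]
  by (rule derivative_eq_intros hermite_fun_deriv_raise hermite_fun_deriv_lower refl)+
     (simp add: power2_eq_square algebra_simps)

lemma hermite_fun_norm_pos: "0 < integral {-1..1} (\<lambda>t. (hermite_fun j t)\<^sup>2)"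
proof -
  have h0: "herm j \<noteq> 0"
  proof (induction j)
    case (Suc j)
    then show ?case using pderiv_herm[of j] by (metis pderiv_0 smult_eq_0_iff mult_eq_0_iff of_nat_eq_0_iff nat.distinct(1) zero_neq_numeral)
  qed simp
  have c: "continuous_on {-1..1} (\<lambda>t. (hermite_fun j t)\<^sup>2)" by (intro continuous_intros)
  have "integral {-1..1} (\<lambda>t. (hermite_fun j t)\<^sup>2) \<noteq> 0"
  proof
    assume "integral {-1..1} (\<lambda>t. (hermite_fun j t)\<^sup>2) = 0"
    then have "\<forall>t\<in>{-1..1}. hermite_fun j t = 0" using integral_eq_0_iff[OF c] by simp
    then have "{-1..1} \<subseteq> {t. poly (herm j) t = 0}" by (auto simp: hermite_fun_def)
    then have "finite {-1..1::real}" using poly_roots_finite[OF h0] finite_subset by blast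
    then show False by (simp add: infinite_Icc)
  qed
  moreover have "0 \<le> integral {-1..1} (\<lambda>t. (hermite_fun j t)\<^sup>2)"
    by (intro integral_nonneg integrable_continuous_interval c) auto
  ultimately show ?thesis by linarith
qed

text \<open>
  Up to the difference of the levels, the pairing is the increment of the Wronskian, which is small at
  both ends of a long interval.
\<close>

lemma hermite_fun_almost_orthogonal:
  assumes "i \<noteq> j"
  shows "\<exists>K\<ge>0. \<forall>a b R. 1 \<le> R \<longrightarrow> a \<le> - R \<longrightarrow> R \<le> b \<longrightarrow>
    \<bar>integral {a..b} (\<lambda>t. hermite_fun i t * hermite_fun j t)\<bar> \<le> K / R"
proof -
  let ?q = "herm i * herm (Suc j) - herm (Suc i) * herm j"
  obtain K where K: "0 \<le> K" "\<And>t. \<bar>poly ?q t\<bar> * exp (- t\<^sup>2) \<le> K / (1 + t\<^sup>2)"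
    using poly_gauss_bound[of ?q] by blast
  let ?W = "\<lambda>t. hermite_fun' i t * hermite_fun j t - hermite_fun i t * hermite_fun' j t"
  have W: "?W t = poly ?q t * exp (- t\<^sup>2)" for t
  proof -
    have "?W t = hermite_fun i t * hermite_fun (Suc j) t - hermite_fun (Suc i) t * hermite_fun j t"
      by (simp add: hermite_fun'_def algebra_simps)
    then show ?thesis unfolding hermite_fun_mult by (simp add: algebra_simps)
  qed
  have Wb: "\<bar>?W t\<bar> \<le> K / R" if "1 \<le> R" "R \<le> \<bar>t\<bar>" for R t
  proof -
    have "R * 1 \<le> \<bar>t\<bar> * \<bar>t\<bar>" using that by (intro mult_mono) auto
    then have "R \<le> 1 + t\<^sup>2" by (simp add: power2_eq_square)
    then have "K / (1 + t\<^sup>2) \<le> K / R" using that K(1) by (intro divide_left_mono) auto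
    then show ?thesis using K(2)[of t] unfolding W by (simp add: abs_mult)
  qed
  have dd: "1 \<le> \<bar>2 * (real j - real i)\<bar>" 
  proof -
    have "real (Suc i) \<le> real j \<or> real (Suc j) \<le> real i"
      using assms by (simp only: of_nat_le_iff) linarith
    then show ?thesis by auto
  qed
  have "\<bar>integral {a..b} (\<lambda>t. hermite_fun i t * hermite_fun j t)\<bar> \<le> (2 * K) / R"
    if R: "1 \<le> R" "a \<le> - R" "R \<le> b" for a b R
  proof -
    have ab: "a \<le> b" using R by linarith
    have "(?W has_real_derivative 2 * (real j - real i) * (hermite_fun i t * hermite_fun j t)) (at t)" for t
      by (rule derivative_eq_intros hermite_fun_deriv hermite_fun'_deriv refl)+ (simp add: algebra_simps)
    from integral_by_ftc[OF ab this]
    have "integral {a..b} (\<lambda>t. 2 * (real j - real i) * (hermite_fun i t * hermite_fun j t)) = ?W b - ?W a"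
      by (rule integral_unique)
    then have eq: "2 * (real j - real i) * integral {a..b} (\<lambda>t. hermite_fun i t * hermite_fun j t) = ?W b - ?W a"
      by simp
    have "1 * \<bar>integral {a..b} (\<lambda>t. hermite_fun i t * hermite_fun j t)\<bar>
        \<le> \<bar>2 * (real j - real i)\<bar> * \<bar>integral {a..b} (\<lambda>t. hermite_fun i t * hermite_fun j t)\<bar>"
      using dd by (rule mult_right_mono) auto
    also have "\<dots> = \<bar>?W b - ?W a\<bar>" by (simp only: eq flip: abs_mult)
    also have "\<dots> \<le> \<bar>?W b\<bar> + \<bar>?W a\<bar>" by (rule abs_triangle_ineq4)
    also have "\<dots> \<le> K / R + K / R" using R by (intro add_mono Wb) auto
    finally show ?thesis by simp
  qed
  then show ?thesis using K(1) by (intro exI[of _ "2 * K"]) auto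
qed

text \<open>
  A polynomial cut-off vanishes at both ends of a long interval and is close to 1 where the Hermite
  functions live. Its polynomial growth far out is harmless against the Gaussian.
\<close>

definition cutoff :: "real \<Rightarrow> real \<Rightarrow> real \<Rightarrow> real" where
  "cutoff a b t = (1 - t / a) * (1 - t / b)"

definition cutoff' :: "real \<Rightarrow> real \<Rightarrow> real \<Rightarrow> real" where
  "cutoff' a b t = - (1 / a) * (1 - t / b) - (1 - t / a) * (1 / b)"

lemma cutoff_deriv: "(cutoff a b has_real_derivative cutoff' a b t) (at t)"
  unfolding cutoff_def[abs_def] cutoff'_def
  unfolding divide_inverse by (auto intro!: derivative_eq_intros simp: algebra_simps)

lemma cutoff_bounds:
  assumes "1 \<le> R" "a \<le> - R" "R \<le> b"
  shows "\<bar>(cutoff a b t)\<^sup>2 - 1\<bar> \<le> 8 * (1 + t\<^sup>2)\<^sup>2 / R" "(cutoff' a b t)\<^sup>2 \<le> 9 * (1 + t\<^sup>2)\<^sup>2 / R"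
proof -
  define x where "x = 1 / a"
  define y where "y = 1 / b"
  define r where "r = 1 / R"
  have r: "0 < r" "r \<le> 1" using assms by (auto simp: r_def)
  have x: "\<bar>x\<bar> \<le> r" "\<bar>y\<bar> \<le> r" using assms by (auto simp: x_def y_def r_def abs_if frac_le divide_simps)
  have xy: "\<bar>x * y\<bar> \<le> r"
  proof -
    have "\<bar>x\<bar> * \<bar>y\<bar> \<le> r * 1" using x r by (intro mult_mono) auto
    then show ?thesis by (simp add: abs_mult)
  qed
  have t2: "2 * \<bar>t\<bar> \<le> 1 + t\<^sup>2" using zero_le_power2[of "\<bar>t\<bar> - 1"] by (simp add: power2_eq_square algebra_simps)
  have d: "cutoff a b t - 1 = - t * x - t * y + t\<^sup>2 * (x * y)"
    by (simp add: cutoff_def x_def y_def power2_eq_square algebra_simps)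
  have "\<bar>cutoff a b t - 1\<bar> \<le> \<bar>t * x\<bar> + \<bar>t * y\<bar> + \<bar>t\<^sup>2 * (x * y)\<bar>" unfolding d by linarith
  also have "\<dots> \<le> \<bar>t\<bar> * r + \<bar>t\<bar> * r + t\<^sup>2 * r"
  proof -
    have "\<bar>t * x\<bar> \<le> \<bar>t\<bar> * r" "\<bar>t * y\<bar> \<le> \<bar>t\<bar> * r" using x by (simp_all add: abs_mult mult_left_mono)
    moreover have "\<bar>t\<^sup>2 * (x * y)\<bar> \<le> t\<^sup>2 * r" using mult_left_mono[OF xy, of "t\<^sup>2"] by (simp add: abs_mult)
    ultimately show ?thesis by linarith
  qed
  also have "\<dots> = (2 * \<bar>t\<bar> + t\<^sup>2) * r" by (simp add: algebra_simps)
  also have "\<dots> \<le> (2 * (1 + t\<^sup>2)) * r" using t2 r by (intro mult_right_mono) auto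
  finally have c1: "\<bar>cutoff a b t - 1\<bar> \<le> 2 * (1 + t\<^sup>2) * r" .
  also have "2 * (1 + t\<^sup>2) * r \<le> 2 * (1 + t\<^sup>2) * 1" using r by (intro mult_left_mono) auto
  finally have c2: "\<bar>cutoff a b t - 1\<bar> \<le> 2 * (1 + t\<^sup>2) * 1" .
  have "\<bar>v + 1\<bar> \<le> 4 * (1 + u)" if "\<bar>v - 1\<bar> \<le> 2 * (1 + u) * 1" "0 \<le> u" for u v :: real
    using that unfolding distrib_left mult_1_right by linarith
  from this[OF c2] have "\<bar>cutoff a b t + 1\<bar> \<le> 4 * (1 + t\<^sup>2)" by simp
  with c1 have "\<bar>cutoff a b t - 1\<bar> * \<bar>cutoff a b t + 1\<bar> \<le> (2 * (1 + t\<^sup>2) * r) * (4 * (1 + t\<^sup>2))"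
    by (intro mult_mono) auto
  moreover have "\<bar>(cutoff a b t)\<^sup>2 - 1\<bar> = \<bar>cutoff a b t - 1\<bar> * \<bar>cutoff a b t + 1\<bar>"
    by (simp add: power2_eq_square algebra_simps flip: abs_mult)
  moreover have "(2 * s * r) * (4 * s) = 8 * s\<^sup>2 / R" for s
    by (simp add: r_def power2_eq_square)
  ultimately show "\<bar>(cutoff a b t)\<^sup>2 - 1\<bar> \<le> 8 * (1 + t\<^sup>2)\<^sup>2 / R" by (simp only:)
  have d': "cutoff' a b t = - x - y + 2 * t * (x * y)"
    by (simp add: cutoff'_def x_def y_def algebra_simps)
  have "\<bar>cutoff' a b t\<bar> \<le> \<bar>x\<bar> + \<bar>y\<bar> + \<bar>2 * t * (x * y)\<bar>" unfolding d' by linarith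
  also have "\<dots> \<le> r + r + 2 * \<bar>t\<bar> * r"
  proof -
    have "\<bar>2 * t * (x * y)\<bar> \<le> 2 * \<bar>t\<bar> * r" using mult_left_mono[OF xy, of "2 * \<bar>t\<bar>"] by (simp add: abs_mult)
    then show ?thesis using x by linarith
  qed
  also have "\<dots> = (2 + 2 * \<bar>t\<bar>) * r" by (simp add: algebra_simps)
  also have "\<dots> \<le> (3 * (1 + t\<^sup>2)) * r"
  proof (rule mult_right_mono)
    have "2 + 2 * \<bar>t\<bar> \<le> 3 * (1 + u)" if "2 * \<bar>t\<bar> \<le> 1 + u" "0 \<le> u" for u
      using that unfolding distrib_left mult_1_right by linarith
    from this[OF t2] show "2 + 2 * \<bar>t\<bar> \<le> 3 * (1 + t\<^sup>2)" by simp
  qed (use r in simp)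
  finally have "\<bar>cutoff' a b t\<bar>\<^sup>2 \<le> (3 * (1 + t\<^sup>2) * r)\<^sup>2" by (intro power_mono) auto
  then have c3: "(cutoff' a b t)\<^sup>2 \<le> (3 * (1 + t\<^sup>2) * r)\<^sup>2" by simp
  have s: "(3 * s * r)\<^sup>2 \<le> 9 * s\<^sup>2 / R" for s
  proof -
    have "(3 * s * r)\<^sup>2 = 9 * s\<^sup>2 * (r * r)" by (simp add: power2_eq_square)
    also have "\<dots> \<le> 9 * s\<^sup>2 * (r * 1)" using r by (intro mult_left_mono) auto
    finally show ?thesis by (simp add: r_def)
  qed
  show "(cutoff' a b t)\<^sup>2 \<le> 9 * (1 + t\<^sup>2)\<^sup>2 / R" by (rule order_trans[OF c3 s])
qed

text \<open>
  The matrix of the energy form minus \<open>e\<close> times the squared norm on the cut-off Hermite functions. The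
  derivatives of the Hermite functions have been removed by an integration by parts, which leaves
  their levels and the square of the derivative of the cut-off.
\<close>

definition trial_entry :: "real \<Rightarrow> real \<Rightarrow> real \<Rightarrow> nat \<Rightarrow> nat \<Rightarrow> real \<Rightarrow> real" where
  "trial_entry a b e i j t = ((cutoff' a b t)\<^sup>2 + (cutoff a b t)\<^sup>2 * (2 * real j + 1 - e)) * (hermite_fun i t * hermite_fun j t)"

lemma continuous_on_cutoff: "continuous_on S (cutoff a b)" "continuous_on S (cutoff' a b)"
  unfolding cutoff_def[abs_def] cutoff'_def[abs_def] by (auto simp: divide_inverse intro!: continuous_intros)

lemma continuous_on_trial_entry: "continuous_on S (trial_entry a b e i j)"
  unfolding trial_entry_def[abs_def] by (intro continuous_intros continuous_on_cutoff)

lemma trial_entry_error: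
  "\<exists>K\<ge>0. \<forall>a b R. 1 \<le> R \<longrightarrow> a \<le> - R \<longrightarrow> R \<le> b \<longrightarrow>
    \<bar>integral {a..b} (trial_entry a b e i j) - (2 * real j + 1 - e) * integral {a..b} (\<lambda>t. hermite_fun i t * hermite_fun j t)\<bar> \<le> K / R"
proof -
  define c where "c = 2 * real j + 1 - e"
  define q where "q = [:1, 0, 1:] * [:1, 0, 1:] * (herm i * herm j)"
  obtain K where K: "0 \<le> K" "\<And>t. \<bar>poly q t\<bar> * exp (- t\<^sup>2) \<le> K / (1 + t\<^sup>2)"
    using poly_gauss_bound[of q] by blast
  define C where "C = 9 + 8 * \<bar>c\<bar>"
  have C: "0 \<le> C" by (simp add: C_def)
  have "\<bar>integral {a..b} (trial_entry a b e i j) - c * integral {a..b} (\<lambda>t. hermite_fun i t * hermite_fun j t)\<bar> \<le> (C * K * pi) / R"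
    if R: "1 \<le> R" "a \<le> - R" "R \<le> b" for a b R
  proof -
    let ?h = "\<lambda>t. trial_entry a b e i j t - c * (hermite_fun i t * hermite_fun j t)"
    have eq: "integral {a..b} (trial_entry a b e i j) - c * integral {a..b} (\<lambda>t. hermite_fun i t * hermite_fun j t) = integral {a..b} ?h"
      by (subst Henstock_Kurzweil_Integration.integral_diff)
         (auto intro!: integrable_continuous_interval continuous_intros continuous_on_trial_entry)
    have "\<bar>?h t\<bar> \<le> (C * K / R) / (1 + t\<^sup>2)" for t
    proof -
      have "\<bar>(cutoff' a b t)\<^sup>2 + ((cutoff a b t)\<^sup>2 - 1) * c\<bar> \<le> (cutoff' a b t)\<^sup>2 + \<bar>(cutoff a b t)\<^sup>2 - 1\<bar> * \<bar>c\<bar>"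
        by (rule order_trans[OF abs_triangle_ineq]) (simp add: abs_mult)
      also have "\<dots> \<le> 9 * (1 + t\<^sup>2)\<^sup>2 / R + 8 * (1 + t\<^sup>2)\<^sup>2 / R * \<bar>c\<bar>"
        using cutoff_bounds[OF R, of t] by (intro add_mono mult_right_mono) auto
      also have "\<dots> = C / R * (1 + t\<^sup>2)\<^sup>2" by (simp add: C_def add_divide_distrib algebra_simps)
      finally have b1: "\<bar>(cutoff' a b t)\<^sup>2 + ((cutoff a b t)\<^sup>2 - 1) * c\<bar> \<le> C / R * (1 + t\<^sup>2)\<^sup>2" .
      have h: "?h t = ((cutoff' a b t)\<^sup>2 + ((cutoff a b t)\<^sup>2 - 1) * c) * (hermite_fun i t * hermite_fun j t)"
        by (simp add: trial_entry_def c_def algebra_simps)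
      have "\<bar>?h t\<bar> \<le> C / R * (1 + t\<^sup>2)\<^sup>2 * \<bar>hermite_fun i t * hermite_fun j t\<bar>"
        unfolding h abs_mult using b1 by (intro mult_right_mono) auto
      also have "\<dots> = C / R * (\<bar>poly q t\<bar> * exp (- t\<^sup>2))"
      proof -
        have "poly q t = (1 + t\<^sup>2)\<^sup>2 * poly (herm i * herm j) t" by (simp add: q_def power2_eq_square algebra_simps)
        then show ?thesis unfolding hermite_fun_mult by (simp add: abs_mult)
      qed
      also have "\<dots> \<le> C / R * (K / (1 + t\<^sup>2))"
        using K(2)[of t] C R by (intro mult_left_mono) auto
      finally show ?thesis by simp
    qed
    then have "\<bar>integral {a..b} ?h\<bar> \<le> (C * K / R) * pi"
      using R C K(1) by (intro integral_lorentzian_bound continuous_intros continuous_on_trial_entry) auto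
    then show ?thesis unfolding eq by simp
  qed
  then show ?thesis using C K(1) by (intro exI[of _ "C * K * pi"]) (auto simp: c_def)
qed

text \<open>
  The diagonal entries stay below a fixed negative number, while all other contributions are
  \<open>O(1/R)\<close>.
\<close>

lemma trial_form_negative:
  assumes e: "2 * real J - 1 < e"
  shows "\<exists>R\<ge>1. \<forall>a b c. a \<le> - R \<longrightarrow> R \<le> b \<longrightarrow> (\<exists>i<J. c i \<noteq> 0) \<longrightarrow>
    (\<Sum>i<J. \<Sum>j<J. c i * c j * integral {a..b} (trial_entry a b e i j)) < 0"
proof (cases "J = 0")
  case True
  then show ?thesis by (intro exI[of _ 1]) auto
next
  case False
  have "\<forall>i j. \<exists>K. 0 \<le> K \<and> (\<forall>a b R. 1 \<le> R \<longrightarrow> a \<le> - R \<longrightarrow> R \<le> b \<longrightarrow>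
    \<bar>integral {a..b} (trial_entry a b e i j) - (if i = j then (2 * real j + 1 - e) * integral {a..b} (\<lambda>t. (hermite_fun j t)\<^sup>2) else 0)\<bar> \<le> K / R)"
  proof (intro allI)
    fix i j
    obtain K1 where K1: "0 \<le> K1" "\<And>a b R. 1 \<le> R \<Longrightarrow> a \<le> - R \<Longrightarrow> R \<le> b \<Longrightarrow>
      \<bar>integral {a..b} (trial_entry a b e i j) - (2 * real j + 1 - e) * integral {a..b} (\<lambda>t. hermite_fun i t * hermite_fun j t)\<bar> \<le> K1 / R"
      using trial_entry_error[of e i j] by blast
    show "\<exists>K. 0 \<le> K \<and> (\<forall>a b R. 1 \<le> R \<longrightarrow> a \<le> - R \<longrightarrow> R \<le> b \<longrightarrow>
    \<bar>integral {a..b} (trial_entry a b e i j) - (if i = j then (2 * real j + 1 - e) * integral {a..b} (\<lambda>t. (hermite_fun j t)\<^sup>2) else 0)\<bar> \<le> K / R)"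
    proof (cases "i = j")
      case True
      then show ?thesis using K1 by (intro exI[of _ K1]) (auto simp: power2_eq_square)
    next
      case False
      obtain K2 where K2: "0 \<le> K2" "\<And>a b R. 1 \<le> R \<Longrightarrow> a \<le> - R \<Longrightarrow> R \<le> b \<Longrightarrow>
          \<bar>integral {a..b} (\<lambda>t. hermite_fun i t * hermite_fun j t)\<bar> \<le> K2 / R"
        using hermite_fun_almost_orthogonal[OF False] by blast
      let ?c = "2 * real j + 1 - e"
      have "\<bar>integral {a..b} (trial_entry a b e i j)\<bar> \<le> (K1 + \<bar>?c\<bar> * K2) / R"
        if R: "1 \<le> R" "a \<le> - R" "R \<le> b" for a b R
      proof -
        let ?M = "integral {a..b} (\<lambda>t. hermite_fun i t * hermite_fun j t)"
        have "\<bar>?c * ?M\<bar> \<le> \<bar>?c\<bar> * (K2 / R)"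
          unfolding abs_mult using K2(2)[OF R] by (intro mult_left_mono) auto
        then show ?thesis using K1(2)[OF R] by (simp add: add_divide_distrib)
      qed
      then show ?thesis using K1 K2 False by (intro exI[of _ "K1 + \<bar>?c\<bar> * K2"]) auto
    qed
  qed
  then obtain K where K: "\<And>i j. 0 \<le> K i j" "\<And>i j a b R. 1 \<le> R \<Longrightarrow> a \<le> - R \<Longrightarrow> R \<le> b \<Longrightarrow>
    \<bar>integral {a..b} (trial_entry a b e i j) - (if i = j then (2 * real j + 1 - e) * integral {a..b} (\<lambda>t. (hermite_fun j t)\<^sup>2) else 0)\<bar> \<le> K i j / R"
    by metis
  define L where "L = (\<Sum>i<J. \<Sum>j<J. K i j)"
  have KL: "K i j \<le> L" if "i < J" "j < J" for i j
  proof -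
    have "K i j \<le> (\<Sum>j<J. K i j)" using that K(1) by (intro member_le_sum) auto
    also have "\<dots> \<le> L" unfolding L_def using that K(1)
      by (intro member_le_sum[of i _ "\<lambda>i. \<Sum>j<J. K i j"]) (auto intro!: sum_nonneg)
    finally show ?thesis .
  qed
  have L0: "0 \<le> L" unfolding L_def using K(1) by (intro sum_nonneg) auto
  define n where "n j = integral {-1..1} (\<lambda>t. (hermite_fun j t)\<^sup>2)" for j
  define m where "m = Min (n ` {..<J})"
  have "m \<in> n ` {..<J}" unfolding m_def using False by (intro Min_in) auto
  then have m: "0 < m" "\<And>j. j < J \<Longrightarrow> m \<le> n j"
    using hermite_fun_norm_pos by (auto simp: m_def n_def)
  define \<delta> where "\<delta> = e - (2 * real J - 1)"
  have \<delta>: "0 < \<delta>" using e by (simp add: \<delta>_def)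
  define R where "R = L * real J / (\<delta> * m) + 1"
  have R1: "1 \<le> R" using L0 \<delta> m(1) by (simp add: R_def)
  have RL: "L / R * real J < \<delta> * m"
  proof -
    have "L * real J < R * (\<delta> * m)" using \<delta> m(1) by (simp add: R_def distrib_right)
    then show ?thesis using R1 by (simp add: field_simps)
  qed
  have "(\<Sum>i<J. \<Sum>j<J. c i * c j * integral {a..b} (trial_entry a b e i j)) < 0"
    if ab: "a \<le> - R" "R \<le> b" and c: "\<exists>i<J. c i \<noteq> 0" for a b and c :: "nat \<Rightarrow> real"
  proof -
    define s where "s = (\<Sum>i<J. (c i)\<^sup>2)"
    have s0: "0 < s"
    proof -
      obtain k where k: "k < J" "c k \<noteq> 0" using c by blast
      have "0 < (c k)\<^sup>2" using k by simp
      also have "\<dots> \<le> s" unfolding s_def using k by (intro member_le_sum) auto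
      finally show ?thesis .
    qed
    define D where "D j = (2 * real j + 1 - e) * integral {a..b} (\<lambda>t. (hermite_fun j t)\<^sup>2)" for j
    have D: "D j \<le> - (\<delta> * m)" if j: "j < J" for j
    proof -
      have "m \<le> n j" using m j by simp
      also have "n j \<le> integral {a..b} (\<lambda>t. (hermite_fun j t)\<^sup>2)"
        unfolding n_def using ab R1
        by (intro integral_subset_le integrable_continuous_interval continuous_intros) auto
      finally have "\<delta> * m \<le> (e - (2 * real j + 1)) * integral {a..b} (\<lambda>t. (hermite_fun j t)\<^sup>2)"
        using \<delta> m(1) j by (intro mult_mono) (auto simp: \<delta>_def)
      then show ?thesis by (simp add: D_def algebra_simps)
    qed
    have "(\<Sum>i<J. \<Sum>j<J. c i * c j * integral {a..b} (trial_entry a b e i j))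
        \<le> (\<Sum>i<J. \<Sum>j<J. (if i = j then (c i)\<^sup>2 * - (\<delta> * m) else 0) + ((c i)\<^sup>2 + (c j)\<^sup>2) / 2 * (L / R))"
    proof (intro sum_mono)
      fix i j assume "i \<in> {..<J}" "j \<in> {..<J}"
      then have ij: "i < J" "j < J" by auto
      define E where "E = integral {a..b} (trial_entry a b e i j) - (if i = j then D j else 0)"
      have "\<bar>E\<bar> \<le> K i j / R" unfolding E_def D_def using K(2)[OF R1 ab] .
      also have "\<dots> \<le> L / R" using KL[OF ij] R1 by (intro divide_right_mono) auto
      finally have E: "\<bar>E\<bar> \<le> L / R" .
      have cc: "\<bar>c i * c j\<bar> \<le> ((c i)\<^sup>2 + (c j)\<^sup>2) / 2"
        using zero_le_power2[of "\<bar>c i\<bar> - \<bar>c j\<bar>"] by (simp add: power2_diff abs_mult)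
      have "c i * c j * E \<le> \<bar>c i * c j\<bar> * \<bar>E\<bar>" by (metis abs_ge_self abs_mult)
      also have "\<dots> \<le> ((c i)\<^sup>2 + (c j)\<^sup>2) / 2 * (L / R)" using cc E by (intro mult_mono) auto
      finally have 1: "c i * c j * E \<le> ((c i)\<^sup>2 + (c j)\<^sup>2) / 2 * (L / R)" .
      have 2: "c i * c j * (if i = j then D j else 0) \<le> (if i = j then (c i)\<^sup>2 * - (\<delta> * m) else 0)"
      proof (cases "i = j")
        case True
        have "(c j)\<^sup>2 * D j \<le> (c j)\<^sup>2 * - (\<delta> * m)" using D[OF ij(2)] by (intro mult_left_mono) auto
        then show ?thesis using True by (simp add: power2_eq_square)
      qed simp
      have "c i * c j * integral {a..b} (trial_entry a b e i j) = c i * c j * (if i = j then D j else 0) + c i * c j * E"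
        unfolding E_def by (simp add: algebra_simps)
      then show "c i * c j * integral {a..b} (trial_entry a b e i j) \<le> (if i = j then (c i)\<^sup>2 * - (\<delta> * m) else 0) + ((c i)\<^sup>2 + (c j)\<^sup>2) / 2 * (L / R)"
        using 1 2 by linarith
    qed
    also have "\<dots> = - (\<delta> * m) * s + real J * s * (L / R)"
    proof -
      have 1: "(\<Sum>i<J. \<Sum>j<J. if i = j then (c i)\<^sup>2 * - (\<delta> * m) else 0) = - (\<delta> * m) * s"
        by (simp add: s_def sum_distrib_left mult.commute sum_negf)
      have 2: "(\<Sum>i<J. \<Sum>j<J. ((c i)\<^sup>2 + (c j)\<^sup>2) / 2 * (L / R)) = real J * s * (L / R)"
        by (simp add: s_def sum.distrib add_divide_distrib sum_divide_distrib[symmetric] sum_distrib_right[symmetric] sum_distrib_left[symmetric])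
      show ?thesis by (simp only: sum.distrib 1 2)
    qed
    also have "\<dots> = s * (L / R * real J - \<delta> * m)" by (simp add: algebra_simps)
    also have "\<dots> < 0" using s0 RL by (simp add: mult_pos_neg)
    finally show ?thesis .
  qed
  then show ?thesis using R1 by blast
qed

text \<open>
  If the solution at level \<open>e\<close> had fewer than \<open>J\<close> zeros, some combination of the cut-off
  Hermite functions would vanish at all of them. Its energy is negative as a trial function
  and nonnegative by Jacobi's condition.
\<close>

lemma dirichlet_eigenvalues_ge:
  assumes e: "2 * real J - 1 < e"
  shows "\<exists>R\<ge>1. \<forall>a b. a \<le> - R \<longrightarrow> R \<le> b \<longrightarrow>
    (\<exists>S. finite S \<and> card S = J \<and> S \<subseteq> {\<nu>. \<nu> \<le> e \<and> dsol a \<nu> b = 0})"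
proof -
  obtain R where R: "1 \<le> R" "\<And>a b c. a \<le> - R \<Longrightarrow> R \<le> b \<Longrightarrow> \<exists>i<J. c i \<noteq> 0 \<Longrightarrow>
    (\<Sum>i<J. \<Sum>j<J. c i * c j * integral {a..b} (trial_entry a b e i j)) < 0"
    using trial_form_negative[OF e] by blast
  have "\<exists>S. finite S \<and> card S = J \<and> S \<subseteq> {\<nu>. \<nu> \<le> e \<and> dsol a \<nu> b = 0}"
    if ab: "a \<le> - R" "R \<le> b" for a b
  proof (cases "J = 0")
    case True
    then show ?thesis by (intro exI[of _ "{}"]) auto
  next
    case False
    have lt: "a < b" "a < 0" "0 < b" using ab R(1) by auto
    let ?Z = "{t\<in>{a<..<b}. dsol a e t = 0}"
    show ?thesis
    proof (rule ccontr)
      assume neg: "\<nexists>S. finite S \<and> card S = J \<and> S \<subseteq> {\<nu>. \<nu> \<le> e \<and> dsol a \<nu> b = 0}"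
      then have Z: "finite ?Z" "card ?Z < J"
        using few_zeros_or_many_eigenvalues[OF lt(1), of J e] False by auto
      obtain z where bij: "bij_betw z {..<card ?Z} ?Z"
        using ex_bij_betw_nat_finite[OF Z(1)] by (auto simp: atLeast0LessThan)
      obtain c where c: "\<exists>i<J. c i \<noteq> 0" "\<forall>r<card ?Z. (\<Sum>i<J. c i * hermite_fun i (z r)) = 0"
        using exists_nontrivial_solution[OF Z(2), of "\<lambda>r i. hermite_fun i (z r)"] by blast
      define f where "f t = (\<Sum>i<J. c i * hermite_fun i t)" for t
      define f' where "f' t = (\<Sum>i<J. c i * hermite_fun' i t)" for t
      define f2 where "f2 t = (\<Sum>i<J. c i * ((t\<^sup>2 - (2 * real i + 1)) * hermite_fun i t))" for t
      have df: "(f has_real_derivative f' t) (at t)" for t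
        unfolding f_def[abs_def] f'_def by (auto intro!: derivative_eq_intros hermite_fun_deriv simp: mult_ac)
      have df': "(f' has_real_derivative f2 t) (at t)" for t
        unfolding f2_def f'_def[abs_def] by (auto intro!: derivative_eq_intros hermite_fun'_deriv simp: mult_ac)
      have cf: "continuous_on S f" for S using df by (meson DERIV_continuous continuous_at_imp_continuous_on)
      have cf': "continuous_on S f'" for S using df' by (meson DERIV_continuous continuous_at_imp_continuous_on)
      let ?k = "cutoff a b" and ?k' = "cutoff' a b"
      define g where "g t = ?k t * f t" for t
      define g' where "g' t = ?k' t * f t + ?k t * f' t" for t
      have dg: "(g has_real_derivative g' t) (at t)" for t
        unfolding g_def[abs_def] g'_def by (auto intro!: derivative_eq_intros cutoff_deriv df)
      have cg': "continuous_on UNIV g'"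
        unfolding g'_def[abs_def] by (intro continuous_intros continuous_on_cutoff cf cf')
      have cg: "continuous_on S g" for S
        unfolding g_def[abs_def] by (intro continuous_intros continuous_on_cutoff cf)
      have cg'2: "continuous_on S g'" for S using cg' continuous_on_subset by blast
      have k0: "?k a = 0" "?k b = 0" using lt by (auto simp: cutoff_def)
      have "g t = 0" if "t \<in> {a<..<b}" "dsol a e t = 0" for t
      proof -
        have "t \<in> z ` {..<card ?Z}" unfolding bij_betw_imp_surj_on[OF bij] using that by simp
        then obtain r where "r < card ?Z" "t = z r" by auto
        then show ?thesis using c(2) by (simp add: g_def f_def)
      qed
      then have "0 \<le> integral {a..b} (\<lambda>t. (g' t)\<^sup>2 + (t\<^sup>2 - e) * (g t)\<^sup>2)"
        using jacobi_form_nonneg[OF lt(1) Z(1) dg cg'] k0 by (simp add: g_def)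
      also have "integral {a..b} (\<lambda>t. (g' t)\<^sup>2 + (t\<^sup>2 - e) * (g t)\<^sup>2)
          = integral {a..b} (\<lambda>t. \<Sum>i<J. \<Sum>j<J. c i * c j * trial_entry a b e i j t)"
      proof -
        let ?T = "\<lambda>t. \<Sum>i<J. \<Sum>j<J. c i * c j * trial_entry a b e i j t"
        have T: "?T t = (?k' t)\<^sup>2 * (f t)\<^sup>2 + (?k t)\<^sup>2 * (f t * (t\<^sup>2 * f t - f2 t - e * f t))" for t
        proof -
          have "t\<^sup>2 * f t - f2 t - e * f t = (\<Sum>j<J. c j * ((2 * real j + 1 - e) * hermite_fun j t))"
            by (simp add: f_def f2_def sum_distrib_left algebra_simps sum_subtractf sum.distrib)
          then have "f t * (t\<^sup>2 * f t - f2 t - e * f t) = (\<Sum>i<J. \<Sum>j<J. c i * c j * ((2 * real j + 1 - e) * (hermite_fun i t * hermite_fun j t)))"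
            by (simp add: f_def sum_product mult_ac)
          moreover have "(f t)\<^sup>2 = (\<Sum>i<J. \<Sum>j<J. c i * c j * (hermite_fun i t * hermite_fun j t))"
            by (simp add: f_def power2_eq_square sum_product mult_ac)
          moreover have "?T t = (\<Sum>i<J. \<Sum>j<J. (?k' t)\<^sup>2 * (c i * c j * (hermite_fun i t * hermite_fun j t))
              + (?k t)\<^sup>2 * (c i * c j * ((2 * real j + 1 - e) * (hermite_fun i t * hermite_fun j t))))"
            by (intro sum.cong refl) (simp add: trial_entry_def algebra_simps)
          ultimately show ?thesis by (simp add: sum.distrib sum_distrib_left)
        qed
        have "((\<lambda>t. (?k t)\<^sup>2 * (f t * f' t)) has_real_derivative ((g' t)\<^sup>2 + (t\<^sup>2 - e) * (g t)\<^sup>2) - ?T t) (at t)" for t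
          unfolding T
          by (rule derivative_eq_intros df df' cutoff_deriv refl)+ (simp add: g_def g'_def power2_eq_square algebra_simps)
        from integral_by_ftc[OF less_imp_le[OF lt(1)] this]
        have h1: "((\<lambda>t. ((g' t)\<^sup>2 + (t\<^sup>2 - e) * (g t)\<^sup>2) - ?T t) has_integral 0) {a..b}"
          by (simp add: k0)
        have h2: "((\<lambda>t. ((g' t)\<^sup>2 + (t\<^sup>2 - e) * (g t)\<^sup>2) - ?T t) has_integral
            integral {a..b} (\<lambda>t. (g' t)\<^sup>2 + (t\<^sup>2 - e) * (g t)\<^sup>2) - integral {a..b} ?T) {a..b}"
          by (intro has_integral_diff integrable_integral integrable_continuous_interval continuous_intros cg cg'2 continuous_on_trial_entry)
        show ?thesis using has_integral_unique[OF h1 h2] by simp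
      qed
      also have "\<dots> = (\<Sum>i<J. \<Sum>j<J. c i * c j * integral {a..b} (trial_entry a b e i j))"
        by (subst integral_sum, auto intro!: integrable_continuous_interval continuous_intros continuous_on_trial_entry)
           (subst integral_sum, auto intro!: integrable_continuous_interval continuous_intros continuous_on_trial_entry)
      also have "\<dots> < 0" using R(2)[OF ab c(1)] .
      finally show False by simp
    qed
  qed
  then show ?thesis using R(1) by blast
qed

section \<open>Integration by parts on the cube\<close>

lemma partial_eqI: "(u has_derivative u') (at x) \<Longrightarrow> partial j u x = u' (axis j 1)"
  unfolding partial_def using frechet_derivative_at by metis

lemma C1_fun_has_derivative:
  assumes "C1_fun u"
  shows "(u has_derivative frechet_derivative u (at x)) (at x)"
  using assms by (simp add: C1_fun_def differentiable_on_def frechet_derivative_works)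

lemma C1_fun_continuous: "C1_fun u \<Longrightarrow> continuous_on S u"
  by (meson C1_fun_has_derivative continuous_at_imp_continuous_on has_derivative_continuous)

lemma C1_fun_continuous_partial: "C1_fun u \<Longrightarrow> continuous_on S (partial j u)"
  by (auto simp: C1_fun_def intro: continuous_on_subset)

lemma C1_funI:
  assumes "\<And>x. (u has_derivative u' x) (at x)" "\<And>j. continuous_on UNIV (\<lambda>x. u' x (axis j 1))"
  shows "C1_fun u"
proof -
  have "partial j u = (\<lambda>x. u' x (axis j 1))" for j using assms(1) partial_eqI by blast
  moreover have "u differentiable_on UNIV"
    using assms(1) by (auto simp: differentiable_on_def differentiable_def)
  ultimately show ?thesis using assms(2) by (simp add: C1_fun_def)
qed

lemma C1_fun_mult:
  assumes "C1_fun u" "C1_fun v"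
  shows "C1_fun (\<lambda>x. u x * v x)" "partial j (\<lambda>x. u x * v x) = (\<lambda>x. partial j u x * v x + u x * partial j v x)"
proof -
  have d: "((\<lambda>x. u x * v x) has_derivative
      (\<lambda>h. u x * frechet_derivative v (at x) h + frechet_derivative u (at x) h * v x)) (at x)" for x
    by (rule has_derivative_mult[OF C1_fun_has_derivative[OF assms(1)] C1_fun_has_derivative[OF assms(2)]])
  show "partial j (\<lambda>x. u x * v x) = (\<lambda>x. partial j u x * v x + u x * partial j v x)"
    using partial_eqI[OF d] by (simp add: fun_eq_iff partial_def add.commute)
  have "continuous_on UNIV (\<lambda>x. u x * frechet_derivative v (at x) (axis j 1) + frechet_derivative u (at x) (axis j 1) * v x)" for j
    by (intro continuous_intros C1_fun_continuous[OF assms(1)] C1_fun_continuous[OF assms(2)]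
      C1_fun_continuous_partial[OF assms(1), unfolded partial_def]
      C1_fun_continuous_partial[OF assms(2), unfolded partial_def])
  then show "C1_fun (\<lambda>x. u x * v x)" by (rule C1_funI[OF d])
qed

lemma C1_fun_add:
  assumes "C1_fun u" "C1_fun v"
  shows "C1_fun (\<lambda>x. u x + v x)" "partial j (\<lambda>x. u x + v x) = (\<lambda>x. partial j u x + partial j v x)"
proof -
  have d: "((\<lambda>x. u x + v x) has_derivative
      (\<lambda>h. frechet_derivative u (at x) h + frechet_derivative v (at x) h)) (at x)" for x
    by (rule has_derivative_add[OF C1_fun_has_derivative[OF assms(1)] C1_fun_has_derivative[OF assms(2)]])
  show "partial j (\<lambda>x. u x + v x) = (\<lambda>x. partial j u x + partial j v x)"
    using partial_eqI[OF d] by (simp add: fun_eq_iff partial_def)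
  have "continuous_on UNIV (\<lambda>x. frechet_derivative u (at x) (axis j 1) + frechet_derivative v (at x) (axis j 1))" for j
    by (intro continuous_intros C1_fun_continuous_partial[OF assms(1), unfolded partial_def]
      C1_fun_continuous_partial[OF assms(2), unfolded partial_def])
  then show "C1_fun (\<lambda>x. u x + v x)" by (rule C1_funI[OF d])
qed

lemma C1_fun_coord:
  assumes f: "\<And>t. (f has_vector_derivative f' t) (at t)" and c: "continuous_on UNIV f'"
  shows "C1_fun (\<lambda>x. f (x $ i))" "partial j (\<lambda>x. f (x $ i)) = (\<lambda>x. if j = i then f' (x $ i) else 0)"
proof -
  have d: "((\<lambda>x. f (x $ i)) has_derivative (\<lambda>h. h $ i *\<^sub>R f' (x $ i))) (at x)" for x :: "real^3"
  proof -
    have "(f has_derivative (\<lambda>t. t *\<^sub>R f' (x $ i))) (at (x $ i))"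
      using f by (simp add: has_vector_derivative_def)
    moreover have "((\<lambda>x. x $ i) has_derivative (\<lambda>h. h $ i)) (at x)"
      by (rule bounded_linear_imp_has_derivative) (rule bounded_linear_vec_nth)
    ultimately show ?thesis using has_derivative_compose by blast
  qed
  have e: "axis j 1 $ i *\<^sub>R f' (x $ i) = (if j = i then f' (x $ i) else 0)" for x :: "real^3" and j
    by (simp add: axis_def)
  show "partial j (\<lambda>x. f (x $ i)) = (\<lambda>x. if j = i then f' (x $ i) else 0)"
    using partial_eqI[OF d] by (simp add: fun_eq_iff e)
  have "continuous_on UNIV (\<lambda>x::real^3. axis j 1 $ i *\<^sub>R f' (x $ i))" for j
    by (intro continuous_intros continuous_on_compose2[OF c]) auto
  then show "C1_fun (\<lambda>x. f (x $ i))" by (rule C1_funI[OF d])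
qed

lemma C1_fun_const: "C1_fun (\<lambda>x. c)" "partial j (\<lambda>x. c) = (\<lambda>x. 0)"
  using C1_fun_coord[of "\<lambda>t. c" "\<lambda>t. 0"] by auto

lemma C1_fun_cmult:
  assumes "C1_fun u"
  shows "C1_fun (\<lambda>x. c * u x)" "partial j (\<lambda>x. c * u x) = (\<lambda>x. c * partial j u x)"
  using C1_fun_mult[OF C1_fun_const(1) assms] by (simp_all add: C1_fun_const)

lemma C1_fun_x2: "C1_fun (\<lambda>x. complex_of_real (x $ 2))" "partial j (\<lambda>x. complex_of_real (x $ 2)) = (\<lambda>x. if j = 2 then 1 else 0)"
proof -
  have "((\<lambda>t. complex_of_real t) has_vector_derivative 1) (at t)" for t
    using has_vector_derivative_of_real[of "\<lambda>t. t" 1 "at t"] by simp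
  note c = C1_fun_coord[OF this continuous_on_const, where i = 2]
  show "C1_fun (\<lambda>x. complex_of_real (x $ 2))"
      "partial j (\<lambda>x. complex_of_real (x $ 2)) = (\<lambda>x. if j = 2 then 1 else 0)"
    by (rule c)+
qed

lemma C1_fun_line:
  assumes "C1_fun u"
  shows "((\<lambda>s. u (x + s *\<^sub>R axis j 1)) has_vector_derivative partial j u (x + s *\<^sub>R axis j 1)) (at s)"
proof -
  let ?y = "x + s *\<^sub>R axis j 1"
  have "((\<lambda>s. x + s *\<^sub>R axis j 1) has_derivative (\<lambda>h. h *\<^sub>R axis j 1)) (at s)"
    by (auto intro!: derivative_eq_intros)
  from has_derivative_compose[OF this C1_fun_has_derivative[OF assms]]
  have "((\<lambda>s. u (x + s *\<^sub>R axis j 1)) has_derivative (\<lambda>h. frechet_derivative u (at ?y) (h *\<^sub>R axis j 1))) (at s)" .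
  moreover have "frechet_derivative u (at ?y) (h *\<^sub>R axis j 1) = h *\<^sub>R partial j u ?y" for h
    using C1_fun_has_derivative[OF assms, of ?y] unfolding partial_def
    by (simp add: has_derivative_def bounded_linear.linear linear_cmul)
  ultimately show ?thesis by (simp add: has_vector_derivative_def)
qed

lemma mem_cube: "x \<in> cube L \<longleftrightarrow> (\<forall>i. 0 \<le> x $ i \<and> x $ i \<le> L)"
  by (simp add: cube_def mem_box_cart)

text \<open>
  Fubini with the coordinate \<open>j\<close> innermost reduces the claim to the fundamental theorem of calculus,
  and the boundary values cancel. The hypothesis covers periodicity as well as vanishing on both faces.
\<close>

lemma integral_partial_eq_0:
  assumes L: "0 < L" and X: "C1_fun X"
    and bd: "\<And>x. x \<in> cube L \<Longrightarrow> x $ j = 0 \<Longrightarrow> X (x + L *\<^sub>R axis j 1) = X x"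
  shows "integral (cube L) (partial j X) = 0"
proof -
  obtain k l :: 3 where kl: "j \<noteq> k" "j \<noteq> l" "k \<noteq> l" "\<And>i. i = j \<or> i = k \<or> i = l"
  proof -
    consider "j = 1" | "j = 2" | "j = 3" using exhaust_3 by blast
    then show ?thesis
    proof cases
      case 1
      then show ?thesis using that[of 2 3] exhaust_3 by auto
    next
      case 2
      then show ?thesis using that[of 1 3] exhaust_3 by auto
    next
      case 3
      then show ?thesis using that[of 1 2] exhaust_3 by auto
    qed
  qed
  have U: "UNIV = {j, k, l}" using kl(4) by blast
  define G :: "(real \<times> real) \<times> real \<Rightarrow> real^3" where
    "G = (\<lambda>p. snd p *\<^sub>R axis j 1 + fst (fst p) *\<^sub>R axis k 1 + snd (fst p) *\<^sub>R axis l 1)"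
  define T :: "real^3 \<Rightarrow> (real \<times> real) \<times> real" where "T = (\<lambda>x. ((x $ k, x $ l), x $ j))"
  have G: "G p $ j = snd p" "G p $ k = fst (fst p)" "G p $ l = snd (fst p)" for p
    using kl by (auto simp: G_def axis_def)
  have TG: "T (G p) = p" for p by (simp add: T_def G)
  have GT: "G (T x) = x" for x
  proof (rule vec_eq_iff[THEN iffD2], intro allI)
    fix i show "G (T x) $ i = x $ i" using kl(4)[of i] by (auto simp: G T_def)
  qed
  have all: "(\<forall>i. P i) \<longleftrightarrow> P j \<and> P k \<and> P l" for P using kl(4) by metis
  have memG: "x \<in> cbox u v \<longleftrightarrow> G x \<in> cbox (G u) (G v)" for x u v
    by (cases x; cases u; cases v) (auto simp: mem_box_cart all G cbox_Pair_eq)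
  have Gim: "G ` cbox u v = cbox (G u) (G v)" for u v
  proof (intro set_eqI iffI)
    fix x assume "x \<in> cbox (G u) (G v)"
    then have "G (T x) \<in> cbox (G u) (G v)" by (simp add: GT)
    then have "T x \<in> cbox u v" by (simp add: memG)
    then show "x \<in> G ` cbox u v" by (metis GT imageI)
  qed (auto simp: memG)
  have Tim: "T ` cbox u v = cbox (T u) (T v)" for u v
  proof -
    have "T ` cbox u v = T ` cbox (G (T u)) (G (T v))" by (simp add: GT)
    also have "\<dots> = cbox (T u) (T v)" unfolding Gim[symmetric] by (simp add: image_image TG)
    finally show ?thesis .
  qed
  have cont_G: "continuous_on S G" for S
    unfolding G_def by (intro continuous_intros)
  have content: "measure lborel (G ` cbox u v) = 1 * measure lborel (cbox u v)" for u v
  proof (cases "cbox u v = {}")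
    case False
    then have "cbox (G u) (G v) \<noteq> {}" using Gim[of u v] by auto
    then have "measure lborel (G ` cbox u v) = (\<Prod>i\<in>UNIV. G v $ i - G u $ i)"
      unfolding Gim by (rule content_cbox_cart)
    also have "\<dots> = (snd v - snd u) * ((fst (fst v) - fst (fst u)) * (snd (fst v) - snd (fst u)))"
      unfolding U using kl by (simp add: G)
    also have "\<dots> = measure lborel (cbox u v)"
    proof -
      obtain u1 u2 u3 v1 v2 v3 where uv: "u = ((u1, u2), u3)" "v = ((v1, v2), v3)" by (metis surj_pair)
      then have "u1 \<le> v1" "u2 \<le> v2" "u3 \<le> v3" using False by (auto simp: cbox_Pair_eq)
      then show ?thesis by (simp add: uv content_Pair)
    qed
    finally show ?thesis by simp
  qed simp
  have cX: "continuous_on (cube L) (partial j X)" by (rule C1_fun_continuous_partial[OF X])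
  have "(partial j X has_integral integral (cube L) (partial j X)) (cbox 0 (\<chi> i. L))"
    using cX integrable_continuous[of 0 "\<chi> i. L" "partial j X"] unfolding cube_def by (simp add: integrable_integral)
  note I0 = this
  have "isCont G x" for x using cont_G[of UNIV] continuous_on_eq_continuous_at[OF open_UNIV, of G] by blast
  moreover have "\<exists>w z. G ` cbox u v = cbox w z" "\<exists>w z. T ` cbox x y = cbox w z" for u v x y
    using Gim Tim by blast+
  ultimately have "((\<lambda>p. partial j X (G p)) has_integral (1 / 1) *\<^sub>R integral (cube L) (partial j X)) (T ` cbox 0 (\<chi> i. L))"
    using has_integral_twiddle[OF zero_less_one TG GT _ _ _ content I0] by blast
  then have "((\<lambda>p. partial j X (G p)) has_integral integral (cube L) (partial j X)) (T ` cbox 0 (\<chi> i. L))"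
    by simp
  moreover have "T ` cbox 0 (\<chi> i. L) = cbox ((0,0),0) ((L,L),L)" unfolding Tim by (simp add: T_def)
  ultimately have I: "integral (cube L) (partial j X) = integral (cbox ((0,0),0) ((L,L),L)) (\<lambda>p. partial j X (G p))"
    by (simp add: integral_unique)
  have "continuous_on (cbox ((0,0),0) ((L,L),L)) (\<lambda>p. partial j X (G p))"
    by (rule continuous_on_compose2[OF C1_fun_continuous_partial[OF X, of UNIV] cont_G]) auto
  from integral_prod_continuous[OF this]
  have "integral (cube L) (partial j X)
      = integral (cbox (0,0) (L,L)) (\<lambda>q. integral (cbox 0 L) (\<lambda>s. partial j X (G (q, s))))"
    unfolding I .
  also have "\<dots> = integral (cbox (0,0) (L,L)) (\<lambda>q::real \<times> real. 0)"
  proof (rule integral_cong)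
    fix q :: "real \<times> real" assume q: "q \<in> cbox (0,0) (L,L)"
    have Gs: "G (q, s) = G (q, 0) + s *\<^sub>R axis j 1" for s
      unfolding vec_eq_iff all using kl by (auto simp: G axis_def)
    have "((\<lambda>s. partial j X (G (q, s))) has_integral
        X (G (q, 0) + L *\<^sub>R axis j 1) - X (G (q, 0) + 0 *\<^sub>R axis j 1)) {0..L}"
    proof (rule fundamental_theorem_of_calculus)
      fix s assume "s \<in> {0..L}"
      show "((\<lambda>s. X (G (q, 0) + s *\<^sub>R axis j 1)) has_vector_derivative partial j X (G (q, s))) (at s within {0..L})"
        unfolding Gs[of s] by (rule has_vector_derivative_at_within[OF C1_fun_line[OF X]])
    qed (use L in auto)
    then have "((\<lambda>s. partial j X (G (q, s))) has_integral X (G (q, L)) - X (G (q, 0))) {0..L}"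
      by (simp add: Gs[of L])
    moreover have "X (G (q, L)) = X (G (q, 0))"
    proof -
      have "G (q, 0) \<in> cube L" using q L by (cases q) (auto simp: mem_cube all G cbox_Pair_eq)
      then show ?thesis using bd[of "G (q, 0)"] by (simp add: Gs[of L] G)
    qed
    ultimately show "integral (cbox 0 L) (\<lambda>s. partial j X (G (q, s))) = 0"
      by (simp add: integral_unique)
  qed
  finally show ?thesis by simp
qed

lemma integral_by_parts:
  assumes L: "0 < L" and g: "C1_fun g" and v: "C1_fun v"
    and bd: "\<And>x. x \<in> cube L \<Longrightarrow> x $ j = 0 \<Longrightarrow> g (x + L *\<^sub>R axis j 1) * v (x + L *\<^sub>R axis j 1) = g x * v x"
  shows "integral (cube L) (\<lambda>x. partial j g x * v x) = - integral (cube L) (\<lambda>x. g x * partial j v x)"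
proof -
  have "integral (cube L) (\<lambda>x. partial j g x * v x + g x * partial j v x) = 0"
    using integral_partial_eq_0[OF L C1_fun_mult(1)[OF g v], of j] bd unfolding C1_fun_mult(2)[OF g v] by blast
  moreover have "(\<lambda>x. partial j g x * v x) integrable_on cube L" "(\<lambda>x. g x * partial j v x) integrable_on cube L"
    unfolding cube_def by (intro integrable_continuous continuous_intros C1_fun_continuous C1_fun_continuous_partial g v)+
  ultimately show ?thesis by (simp add: Henstock_Kurzweil_Integration.integral_add eq_neg_iff_add_eq_0)
qed

section \<open>Separated modes\<close>

definition mode :: "real \<Rightarrow> (real \<Rightarrow> real) \<Rightarrow> (real \<Rightarrow> real) \<Rightarrow> real^3 \<Rightarrow> complex" where
  "mode \<kappa> f h x = exp ((x $ 1) *\<^sub>R (\<i> * complex_of_real \<kappa>)) * (complex_of_real (f (x $ 2)) * complex_of_real (h (x $ 3)))"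

lemma C1_fun_mode:
  assumes f: "\<And>t. (f has_real_derivative f' t) (at t)" "continuous_on UNIV f'"
    and h: "\<And>t. (h has_real_derivative h' t) (at t)" "continuous_on UNIV h'"
  shows "C1_fun (mode \<kappa> f h)"
    "partial 1 (mode \<kappa> f h) = (\<lambda>x. \<i> * complex_of_real \<kappa> * mode \<kappa> f h x)"
    "partial 2 (mode \<kappa> f h) = mode \<kappa> f' h"
    "partial 3 (mode \<kappa> f h) = mode \<kappa> f h'"
proof -
  let ?E = "\<lambda>t. exp (t *\<^sub>R (\<i> * complex_of_real \<kappa>))"
  have E: "(?E has_vector_derivative ?E t * (\<i> * complex_of_real \<kappa>)) (at t)" for t
    by (rule exp_scaleR_has_vector_derivative_right)
  have cE: "continuous_on UNIV (\<lambda>t. ?E t * (\<i> * complex_of_real \<kappa>))" by (intro continuous_intros)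
  have of: "((\<lambda>t. complex_of_real (f t)) has_vector_derivative complex_of_real (f' t)) (at t)" for t
    by (rule has_vector_derivative_of_real[OF f(1)])
  have cf: "continuous_on UNIV (\<lambda>t. complex_of_real (f' t))" by (intro continuous_intros f)
  have oh: "((\<lambda>t. complex_of_real (h t)) has_vector_derivative complex_of_real (h' t)) (at t)" for t
    by (rule has_vector_derivative_of_real[OF h(1)])
  have ch: "continuous_on UNIV (\<lambda>t. complex_of_real (h' t))" by (intro continuous_intros h)
  note e1 = C1_fun_coord[OF E cE, where i = 1]
  note f1 = C1_fun_coord[OF of cf, where i = 2]
  note h1 = C1_fun_coord[OF oh ch, where i = 3]
  note fh = C1_fun_mult[OF f1(1) h1(1)]
  note efh = C1_fun_mult[OF e1(1) fh(1)]
  have eq: "mode \<kappa> f h = (\<lambda>x. ?E (x $ 1) * (complex_of_real (f (x $ 2)) * complex_of_real (h (x $ 3))))"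
    by (simp add: mode_def fun_eq_iff)
  show "C1_fun (mode \<kappa> f h)" unfolding eq by (rule efh(1))
  show "partial 1 (mode \<kappa> f h) = (\<lambda>x. \<i> * complex_of_real \<kappa> * mode \<kappa> f h x)"
    unfolding eq efh(2) fh(2) e1(2) f1(2) h1(2) by (simp add: fun_eq_iff mult_ac)
  show "partial 2 (mode \<kappa> f h) = mode \<kappa> f' h"
    unfolding eq efh(2) fh(2) e1(2) f1(2) h1(2) by (simp add: fun_eq_iff mode_def)
  show "partial 3 (mode \<kappa> f h) = mode \<kappa> f h'"
    unfolding eq efh(2) fh(2) e1(2) f1(2) h1(2) by (simp add: fun_eq_iff mode_def)
qed

lemma C2_fun_mode:
  assumes f: "\<And>t. (f has_real_derivative f' t) (at t)" "\<And>t. (f' has_real_derivative f'' t) (at t)" "continuous_on UNIV f''"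
    and h: "\<And>t. (h has_real_derivative h' t) (at t)" "\<And>t. (h' has_real_derivative h'' t) (at t)" "continuous_on UNIV h''"
  shows "C2_fun (mode \<kappa> f h)"
proof -
  have cf': "continuous_on UNIV f'" using f(2) by (meson DERIV_continuous continuous_at_imp_continuous_on)
  have ch': "continuous_on UNIV h'" using h(2) by (meson DERIV_continuous continuous_at_imp_continuous_on)
  note m = C1_fun_mode[OF f(1) cf' h(1) ch', of \<kappa>]
  note m2 = C1_fun_mode[OF f(2,3) h(1) ch', of \<kappa>]
  note m3 = C1_fun_mode[OF f(1) cf' h(2,3), of \<kappa>]
  show ?thesis
    unfolding C2_fun_def
  proof (intro conjI allI m(1))
    fix j :: 3
    consider "j = 1" | "j = 2" | "j = 3" using exhaust_3 by blast
    then show "C1_fun (partial j (mode \<kappa> f h))"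
      using C1_fun_cmult(1)[OF m(1), of "\<i> * complex_of_real \<kappa>"]
      by cases (simp_all only: m(2-4) m2(1) m3(1))
  qed
qed

lemma mode_periodic:
  assumes "L \<noteq> 0" "\<kappa> = 2 * pi * of_int n / L"
  shows "mode \<kappa> f h (x + L *\<^sub>R axis 1 1) = mode \<kappa> f h x"
proof -
  have "L * \<kappa> = of_int (2 * n) * pi" using assms by simp
  then have "exp (L *\<^sub>R (\<i> * complex_of_real \<kappa>)) = 1"
    unfolding exp_eq_1 by (intro conjI exI[of _ n]) simp_all
  then show ?thesis by (simp add: mode_def axis_def scaleR_add_left exp_add)
qed

lemma partial_periodic:
  assumes "C1_fun u" "\<And>x. u (x + c) = u x"
  shows "partial j u (x + c) = partial j u x"
proof -
  have "((\<lambda>y. u (y + c)) has_derivative frechet_derivative u (at (x + c))) (at x)"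
  proof -
    have "((\<lambda>y. y + c) has_derivative (\<lambda>h. h)) (at x)" by (auto intro!: derivative_eq_intros)
    from has_derivative_compose[OF this C1_fun_has_derivative[OF assms(1)]] show ?thesis .
  qed
  then have "(u has_derivative frechet_derivative u (at (x + c))) (at x)" by (simp add: assms(2))
  from partial_eqI[OF this] show ?thesis by (simp add: partial_def)
qed

lemma C1_fun_D: "C1_fun (partial j u) \<Longrightarrow> C1_fun (D j u)"
  unfolding D_def[abs_def] by (rule C1_fun_cmult)

lemma C1_fun_magnetic_D1: "C2_fun u \<Longrightarrow> C1_fun (magnetic_D1 u)"
  unfolding magnetic_D1_def[abs_def]
  by (intro C1_fun_add C1_fun_D C1_fun_mult C1_fun_x2) (auto simp: C2_fun_def)

lemma D_D: "C2_fun u \<Longrightarrow> D j (D j u) = (\<lambda>x. - partial j (partial j u) x)"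
  unfolding D_def[abs_def] using C1_fun_cmult(2)[of "partial j u", where c = "-\<i>" and j = j] by (simp add: C2_fun_def fun_eq_iff)

text \<open>
  The pairing is bilinear, without complex conjugation, so functions of frequency \<open>k\<close> are tested with
  modes of frequency \<open>- k\<close>. On the latter the transpose of \<open>D\<^sub>1\<close> is multiplication by \<open>k\<close>.
\<close>

lemma magnetic_D1_by_parts:
  assumes L: "0 < L" and g: "C1_fun g" "\<And>x. g (x + L *\<^sub>R axis 1 1) = g x"
    and k: "k = 2 * pi * of_int n / L"
    and f: "\<And>t. (f has_real_derivative f' t) (at t)" "continuous_on UNIV f'"
    and h: "\<And>t. (h has_real_derivative h' t) (at t)" "continuous_on UNIV h'"
  shows "integral (cube L) (\<lambda>x. magnetic_D1 g x * mode (-k) f h x)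
    = integral (cube L) (\<lambda>x. g x * mode (-k) (\<lambda>t. (t + k) * f t) h x)"
proof -
  note m = C1_fun_mode[OF f h, of "-k"]
  have per: "mode (-k) f h (x + L *\<^sub>R axis 1 1) = mode (-k) f h x" for x
    using L k by (intro mode_periodic[of L _ "-n"]) auto
  have cont: "continuous_on S g" "continuous_on S (partial j g)" "continuous_on S (mode (-k) f h)" for S j
    by (intro C1_fun_continuous C1_fun_continuous_partial g m)+
  have "integral (cube L) (\<lambda>x. partial 1 g x * mode (-k) f h x) = - integral (cube L) (\<lambda>x. g x * partial 1 (mode (-k) f h) x)"
    by (rule integral_by_parts[OF L g(1) m(1)]) (simp add: g per)
  also have "\<dots> = integral (cube L) (\<lambda>x. \<i> * complex_of_real k * (g x * mode (-k) f h x))"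
    unfolding m(2) by (simp add: mult_ac flip: integral_neg)
  finally have 1: "integral (cube L) (\<lambda>x. partial 1 g x * mode (-k) f h x) = \<i> * complex_of_real k * integral (cube L) (\<lambda>x. g x * mode (-k) f h x)"
    by simp
  have int: "(\<lambda>x. partial 1 g x * mode (-k) f h x) integrable_on cube L"
     "(\<lambda>x. complex_of_real (x $ 2) * (g x * mode (-k) f h x)) integrable_on cube L"
     "(\<lambda>x. g x * mode (-k) f h x) integrable_on cube L"
    unfolding cube_def by (intro integrable_continuous continuous_intros cont)+
  have "((\<lambda>x. - \<i> * (partial 1 g x * mode (-k) f h x) + complex_of_real (x $ 2) * (g x * mode (-k) f h x)) has_integral
      - \<i> * integral (cube L) (\<lambda>x. partial 1 g x * mode (-k) f h x)
       + integral (cube L) (\<lambda>x. complex_of_real (x $ 2) * (g x * mode (-k) f h x))) (cube L)"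
    by (intro has_integral_add has_integral_mult_right integrable_integral int)
  moreover have "((\<lambda>x. complex_of_real k * (g x * mode (-k) f h x) + complex_of_real (x $ 2) * (g x * mode (-k) f h x)) has_integral
      complex_of_real k * integral (cube L) (\<lambda>x. g x * mode (-k) f h x)
       + integral (cube L) (\<lambda>x. complex_of_real (x $ 2) * (g x * mode (-k) f h x))) (cube L)"
    by (intro has_integral_add has_integral_mult_right integrable_integral int)
  moreover have "magnetic_D1 g x * mode (-k) f h x = - \<i> * (partial 1 g x * mode (-k) f h x) + complex_of_real (x $ 2) * (g x * mode (-k) f h x)" for x
    by (simp add: magnetic_D1_def D_def algebra_simps)
  moreover have "g x * mode (-k) (\<lambda>t. (t + k) * f t) h x = complex_of_real k * (g x * mode (-k) f h x) + complex_of_real (x $ 2) * (g x * mode (-k) f h x)" for x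
    by (simp add: mode_def algebra_simps)
  moreover have "- \<i> * (\<i> * complex_of_real k * z) = complex_of_real k * z" for z
    by (simp flip: mult.assoc)
  ultimately show ?thesis by (simp only: 1 integral_unique)
qed

lemma second_by_parts:
  assumes L: "0 < L" and g: "C2_fun g" and v: "C2_fun v"
    and g0: "\<And>x. x \<in> cube L \<Longrightarrow> x $ j = 0 \<or> x $ j = L \<Longrightarrow> g x = 0"
    and v0: "\<And>x. x \<in> cube L \<Longrightarrow> x $ j = 0 \<or> x $ j = L \<Longrightarrow> v x = 0"
  shows "integral (cube L) (\<lambda>x. D j (D j g) x * v x) = - integral (cube L) (\<lambda>x. g x * partial j (partial j v) x)"
proof -
  have g1: "C1_fun g" "C1_fun (partial j g)" and v1: "C1_fun v" "C1_fun (partial j v)"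
    using g v by (auto simp: C2_fun_def)
  have shift: "x + L *\<^sub>R axis j 1 \<in> cube L" "(x + L *\<^sub>R axis j 1) $ j = L" if "x \<in> cube L" "x $ j = 0" for x
    using that L by (auto simp: mem_cube axis_def)
  have "integral (cube L) (\<lambda>x. D j (D j g) x * v x) = - integral (cube L) (\<lambda>x. partial j (partial j g) x * v x)"
    unfolding D_D[OF g] by (simp flip: integral_neg)
  also have "integral (cube L) (\<lambda>x. partial j (partial j g) x * v x) = - integral (cube L) (\<lambda>x. partial j g x * partial j v x)"
    by (rule integral_by_parts[OF L g1(2) v1(1)]) (simp add: v0 shift)
  also have "integral (cube L) (\<lambda>x. partial j g x * partial j v x) = - integral (cube L) (\<lambda>x. g x * partial j (partial j v) x)"
    by (rule integral_by_parts[OF L g1(1) v1(2)]) (simp add: g0 shift)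
  finally show ?thesis by simp
qed

text \<open>
  The Hamiltonian is moved to a mode, on which it acts as the oscillator shifted by \<open>k\<close> in the second
  direction and as minus the second derivative in the third one. The Dirichlet conditions on
  both factors remove the boundary terms.
\<close>

lemma landau_H_transpose:
  assumes L: "0 < L" and u: "u \<in> landau_core L" and k: "k = 2 * pi * of_int n / L"
    and f: "\<And>t. (f has_real_derivative f' t) (at t)" "\<And>t. (f' has_real_derivative f'' t) (at t)"
      "continuous_on UNIV f''" "f 0 = 0" "f L = 0"
    and h: "\<And>t. (h has_real_derivative h' t) (at t)" "\<And>t. (h' has_real_derivative h'' t) (at t)"
      "continuous_on UNIV h''" "h 0 = 0" "h L = 0"
  shows "integral (cube L) (\<lambda>x. landau_H u x * mode (-k) f h x)
    = integral (cube L) (\<lambda>x. u x * (mode (-k) (\<lambda>t. (t + k)\<^sup>2 * f t - f'' t) h x - mode (-k) f h'' x))"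
proof -
  have u2: "C2_fun u" and per: "\<And>x. u (x + L *\<^sub>R axis 1 1) = u x"
    and u0: "\<And>x. x \<in> cube L \<Longrightarrow> x $ 2 = 0 \<or> x $ 2 = L \<or> x $ 3 = 0 \<or> x $ 3 = L \<Longrightarrow> u x = 0"
    using u by (auto simp: landau_core_def scaleR_vec_def axis_def vec_eq_iff if_distrib cong: if_cong)
  have u1: "C1_fun u" "C1_fun (partial j u)" for j using u2 by (auto simp: C2_fun_def)
  have cf': "continuous_on UNIV f'" using f(2) by (meson DERIV_continuous continuous_at_imp_continuous_on)
  have cf: "continuous_on UNIV f" using f(1) by (meson DERIV_continuous continuous_at_imp_continuous_on)
  have ch': "continuous_on UNIV h'" using h(2) by (meson DERIV_continuous continuous_at_imp_continuous_on)
  note m = C1_fun_mode[OF f(1) cf' h(1) ch', of "-k"]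
  note m2 = C1_fun_mode[OF f(2,3) h(1) ch', of "-k"]
  note m3 = C1_fun_mode[OF f(1) cf' h(2,3), of "-k"]
  have v2: "C2_fun (mode (-k) f h)" by (rule C2_fun_mode[OF f(1-3) h(1-3)])
  have kf: "((\<lambda>t. (t + k) * f t) has_real_derivative f t + (t + k) * f' t) (at t)" for t
    by (rule derivative_eq_intros f(1) refl)+ simp
  have ckf: "continuous_on UNIV (\<lambda>t. f t + (t + k) * f' t)" by (intro continuous_intros cf cf')
  have mper: "magnetic_D1 u (x + L *\<^sub>R axis 1 1) = magnetic_D1 u x" for x
  proof -
    have "(x + L *\<^sub>R axis 1 1) $ 2 = x $ 2" by (simp add: axis_def)
    then show ?thesis using partial_periodic[OF u1(1) per, of 1 x] by (simp add: magnetic_D1_def D_def per)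
  qed
  let ?v = "mode (-k) f h"
  have I1: "integral (cube L) (\<lambda>x. magnetic_D1 (magnetic_D1 u) x * ?v x)
      = integral (cube L) (\<lambda>x. u x * mode (-k) (\<lambda>t. (t + k) * ((t + k) * f t)) h x)"
    using magnetic_D1_by_parts[OF L C1_fun_magnetic_D1[OF u2] mper k f(1) cf' h(1) ch']
      magnetic_D1_by_parts[OF L u1(1) per k kf ckf h(1) ch'] by simp
  have I2: "integral (cube L) (\<lambda>x. D 2 (D 2 u) x * ?v x) = - integral (cube L) (\<lambda>x. u x * mode (-k) f'' h x)"
  proof -
    have "integral (cube L) (\<lambda>x. D 2 (D 2 u) x * ?v x) = - integral (cube L) (\<lambda>x. u x * partial 2 (partial 2 ?v) x)"
      by (rule second_by_parts[OF L u2 v2]) (use u0 f(4,5) in \<open>auto simp: mode_def\<close>)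
    then show ?thesis unfolding m(3) m2(3) .
  qed
  have I3: "integral (cube L) (\<lambda>x. D 3 (D 3 u) x * ?v x) = - integral (cube L) (\<lambda>x. u x * mode (-k) f h'' x)"
  proof -
    have "integral (cube L) (\<lambda>x. D 3 (D 3 u) x * ?v x) = - integral (cube L) (\<lambda>x. u x * partial 3 (partial 3 ?v) x)"
      by (rule second_by_parts[OF L u2 v2]) (use u0 h(4,5) in \<open>auto simp: mode_def\<close>)
    then show ?thesis unfolding m(4) m3(4) .
  qed
  have cont: "continuous_on S u" "continuous_on S ?v" "continuous_on S (magnetic_D1 (magnetic_D1 u))"
    "continuous_on S (D j (D j u))" for S j
  proof -
    show "continuous_on S u" "continuous_on S ?v" by (intro C1_fun_continuous u1 m)+
    show "continuous_on S (D j (D j u))" unfolding D_D[OF u2]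
      by (intro continuous_intros C1_fun_continuous_partial u1)
    have "continuous_on S (\<lambda>x. - \<i> * partial 1 (magnetic_D1 u) x + complex_of_real (x $ 2) * magnetic_D1 u x)"
      by (intro continuous_intros C1_fun_continuous_partial C1_fun_continuous C1_fun_magnetic_D1 u2)
    then show "continuous_on S (magnetic_D1 (magnetic_D1 u))"
      by (simp add: magnetic_D1_def[of "magnetic_D1 u", abs_def] D_def)
  qed
  have cm: "continuous_on S (mode \<kappa> p q)" if "continuous_on UNIV p" "continuous_on UNIV q" for S \<kappa> p q
    unfolding mode_def[abs_def]
    by (intro continuous_intros continuous_on_compose2[OF that(1)] continuous_on_compose2[OF that(2)]) auto
  have ch: "continuous_on UNIV h" using h(1) by (meson DERIV_continuous continuous_at_imp_continuous_on)
  have cmm: "continuous_on S (mode (-k) (\<lambda>t. (t + k) * ((t + k) * f t)) h)" "continuous_on S (mode (-k) f'' h)" "continuous_on S (mode (-k) f h'')" for S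
    by (intro cm continuous_intros cf ch f(3) h(3))+
  have int: "(\<lambda>x. magnetic_D1 (magnetic_D1 u) x * ?v x) integrable_on cube L" "(\<lambda>x. D j (D j u) x * ?v x) integrable_on cube L"
    "(\<lambda>x. u x * mode (-k) (\<lambda>t. (t + k) * ((t + k) * f t)) h x) integrable_on cube L"
    "(\<lambda>x. u x * mode (-k) f'' h x) integrable_on cube L" "(\<lambda>x. u x * mode (-k) f h'' x) integrable_on cube L" for j
    unfolding cube_def by (intro integrable_continuous continuous_intros cont cmm)+
  have "((\<lambda>x. magnetic_D1 (magnetic_D1 u) x * ?v x + D 2 (D 2 u) x * ?v x + D 3 (D 3 u) x * ?v x) has_integral
     integral (cube L) (\<lambda>x. u x * mode (-k) (\<lambda>t. (t + k) * ((t + k) * f t)) h x)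
       + - integral (cube L) (\<lambda>x. u x * mode (-k) f'' h x) + - integral (cube L) (\<lambda>x. u x * mode (-k) f h'' x)) (cube L)"
    unfolding I1[symmetric] I2[symmetric] I3[symmetric]
    by (intro has_integral_add integrable_integral int)
  moreover have "((\<lambda>x. u x * mode (-k) (\<lambda>t. (t + k) * ((t + k) * f t)) h x - u x * mode (-k) f'' h x - u x * mode (-k) f h'' x) has_integral
     integral (cube L) (\<lambda>x. u x * mode (-k) (\<lambda>t. (t + k) * ((t + k) * f t)) h x)
       - integral (cube L) (\<lambda>x. u x * mode (-k) f'' h x) - integral (cube L) (\<lambda>x. u x * mode (-k) f h'' x)) (cube L)"
    by (intro has_integral_diff integrable_integral int)
  moreover have "landau_H u x * ?v x = magnetic_D1 (magnetic_D1 u) x * ?v x + D 2 (D 2 u) x * ?v x + D 3 (D 3 u) x * ?v x" for x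
    by (simp add: landau_H_def algebra_simps)
  moreover have "u x * (mode (-k) (\<lambda>t. (t + k)\<^sup>2 * f t - f'' t) h x - mode (-k) f h'' x)
      = u x * mode (-k) (\<lambda>t. (t + k) * ((t + k) * f t)) h x - u x * mode (-k) f'' h x - u x * mode (-k) f h'' x" for x
    by (simp add: mode_def power2_eq_square algebra_simps)
  ultimately show ?thesis by (simp add: integral_unique)
qed

section \<open>Completeness of the separated modes\<close>

text \<open>
  Vanishing moments of a bounded function \<open>q\<close> allow to pass from powers of \<open>q\<close> to polynomials,
  to continuous functions and by dominated convergence to indicator functions of
  superlevel sets.
\<close>

lemma integral_superlevel_zero:
  fixes U :: "'a \<Rightarrow> complex" and q :: "'a \<Rightarrow> real"
  assumes U: "integrable M U" and q: "q \<in> borel_measurable M"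
    and B: "\<And>x. x \<in> space M \<Longrightarrow> \<bar>q x\<bar> \<le> B"
    and mom: "\<And>p. (LINT x|M. U x * complex_of_real (q x) ^ p) = 0"
  shows "(LINT x|M. U x * complex_of_real (indicator {x. s < q x} x)) = 0"
proof -
  note [measurable] = q borel_measurable_integrable[OF U]
  have bdint: "integrable M (\<lambda>x. U x * complex_of_real (h (q x)))"
    if [measurable]: "h \<in> borel_measurable borel" and hb: "\<And>y. \<bar>y\<bar> \<le> B \<Longrightarrow> \<bar>h y\<bar> \<le> K" for h K
  proof (rule Bochner_Integration.integrable_bound[of M "\<lambda>x. complex_of_real K * U x"])
    show "integrable M (\<lambda>x. complex_of_real K * U x)" using U by simp
    have "norm (U x * complex_of_real (h (q x))) \<le> norm (complex_of_real K * U x)" if "x \<in> space M" for x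
    proof -
      have "\<bar>h (q x)\<bar> \<le> \<bar>K\<bar>" using hb[OF B[OF that]] by linarith
      from mult_right_mono[OF this, of "norm (U x)"] show ?thesis by (simp add: norm_mult mult.commute)
    qed
    then show "AE x in M. norm (U x * complex_of_real (h (q x))) \<le> norm (complex_of_real K * U x)" by auto
  qed measurable
  have cont: "(LINT x|M. U x * complex_of_real (h (q x))) = 0"
    if ch: "continuous_on UNIV h" for h :: "real \<Rightarrow> real"
  proof -
    have [measurable]: "h \<in> borel_measurable borel" using ch by (rule borel_measurable_continuous_onI)
    have cB: "continuous_on {-B..B} h" using ch continuous_on_subset by blast
    obtain K where K: "\<And>y. \<bar>y\<bar> \<le> B \<Longrightarrow> \<bar>h y\<bar> \<le> K"
    proof -
      have "bounded (h ` {-B..B})" by (intro compact_imp_bounded compact_continuous_image cB) auto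
      then obtain K where "\<forall>z\<in>h ` {-B..B}. norm z \<le> K" unfolding bounded_iff by blast
      then show ?thesis using that[of K] by (auto simp: abs_le_iff)
    qed
    have small: "norm (LINT x|M. U x * complex_of_real (h (q x))) \<le> e * (LINT x|M. norm (U x))" if e: "0 < e" for e
    proof -
      obtain g where g: "real_polynomial_function g" "\<And>y. y \<in> {-B..B} \<Longrightarrow> \<bar>h y - g y\<bar> < e"
        using Stone_Weierstrass_real_polynomial_function[OF _ cB e] by auto
      obtain a n where gs: "g = (\<lambda>y. \<Sum>i\<le>n::nat. a i * y ^ i)"
        using g(1) real_polynomial_function_imp_sum by blast
      have [measurable]: "g \<in> borel_measurable borel" unfolding gs by measurable
      have pw: "integrable M (\<lambda>x. U x * complex_of_real (q x) ^ i)" for i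
      proof -
        have "integrable M (\<lambda>x. U x * complex_of_real ((\<lambda>y. y ^ i) (q x)))"
          by (rule bdint[of _ "B ^ i"]) (auto simp: power_abs intro!: power_mono)
        then show ?thesis by simp
      qed
      have "(LINT x|M. U x * complex_of_real (g (q x))) = (LINT x|M. (\<Sum>i\<le>n. complex_of_real (a i) * (U x * complex_of_real (q x) ^ i)))"
        by (simp add: gs sum_distrib_left mult_ac)
      also have "\<dots> = (\<Sum>i\<le>n. complex_of_real (a i) * (LINT x|M. U x * complex_of_real (q x) ^ i))"
        using pw by (simp add: Bochner_Integration.integral_sum)
      finally have g0: "(LINT x|M. U x * complex_of_real (g (q x))) = 0" by (simp add: mom)
      have ig: "integrable M (\<lambda>x. U x * complex_of_real (g (q x)))"
      proof (rule bdint[of _ "K + e"])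
        fix y assume y: "\<bar>y\<bar> \<le> B"
        then have "y \<in> {-B..B}" by auto
        from g(2)[OF this] K[OF y] show "\<bar>g y\<bar> \<le> K + e" by linarith
      qed measurable
      have ih: "integrable M (\<lambda>x. U x * complex_of_real (h (q x)))" by (rule bdint[OF _ K]) measurable
      have "(LINT x|M. U x * complex_of_real (h (q x))) = (LINT x|M. U x * complex_of_real (h (q x)) - U x * complex_of_real (g (q x)))"
        using ig ih g0 by simp
      also have "norm \<dots> \<le> (LINT x|M. norm (U x * complex_of_real (h (q x)) - U x * complex_of_real (g (q x))))"
        by (rule integral_norm_bound)
      also have "\<dots> \<le> (LINT x|M. e * norm (U x))"
      proof (rule integral_mono)
        fix x assume x: "x \<in> space M"
        have "q x \<in> {-B..B}" using B[OF x] by auto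
        then have "\<bar>h (q x) - g (q x)\<bar> * norm (U x) \<le> e * norm (U x)" using g(2) by (intro mult_right_mono) (auto intro: less_imp_le)
        moreover have "U x * complex_of_real (h (q x)) - U x * complex_of_real (g (q x)) = complex_of_real (h (q x) - g (q x)) * U x"
          by (simp add: algebra_simps)
        ultimately show "norm (U x * complex_of_real (h (q x)) - U x * complex_of_real (g (q x))) \<le> e * norm (U x)"
          by (simp only: norm_mult norm_of_real)
      qed (use ig ih U in \<open>auto intro!: integrable_norm Bochner_Integration.integrable_diff\<close>)
      also have "\<dots> = e * (LINT x|M. norm (U x))" by simp
      finally show ?thesis .
    qed
    have "norm (LINT x|M. U x * complex_of_real (h (q x))) \<le> 0"
    proof (rule field_le_epsilon)
      fix e :: real assume e: "0 < e"
      define N where "N = (LINT x|M. norm (U x))"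
      have N: "0 \<le> N" unfolding N_def by (rule integral_nonneg_AE) auto
      have "0 < N + 1" using N by linarith
      from small[OF divide_pos_pos[OF e this]]
      have "norm (LINT x|M. U x * complex_of_real (h (q x))) \<le> e / (N + 1) * N"
        by (simp only: N_def)
      also have "\<dots> \<le> e" using e N by (simp add: field_simps)
      finally show "norm (LINT x|M. U x * complex_of_real (h (q x))) \<le> 0 + e" by simp
    qed
    then show ?thesis by simp
  qed
  define h where "h j y = min 1 (max 0 (real j * (y - s)))" for j :: nat and y :: real
  have ch: "continuous_on UNIV (h j)" for j unfolding h_def[abs_def] by (intro continuous_intros)
  then have [measurable]: "h j \<in> borel_measurable borel" for j by (rule borel_measurable_continuous_onI)
  have "(\<lambda>j. LINT x|M. U x * complex_of_real (h j (q x))) \<longlonglongrightarrow> (LINT x|M. U x * complex_of_real (indicator {x. s < q x} x))"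
  proof (rule integral_dominated_convergence[where w = "\<lambda>x. norm (U x)"])
    show "AE x in M. (\<lambda>j. U x * complex_of_real (h j (q x))) \<longlonglongrightarrow> U x * complex_of_real (indicator {x. s < q x} x)"
    proof (rule AE_I2)
      fix x
      have "(\<lambda>j. h j (q x)) \<longlonglongrightarrow> indicator {x. s < q x} x"
      proof (cases "s < q x")
        case True
        obtain N :: nat where "1 / (q x - s) \<le> real N" using real_arch_simple by blast
        then have N: "1 \<le> real N * (q x - s)" using True by (simp add: field_simps)
        have "h j (q x) = 1" if "N \<le> j" for j
        proof -
          have "real N * (q x - s) \<le> real j * (q x - s)" using that True by (intro mult_right_mono) auto
          then show ?thesis using N by (simp add: h_def)
        qed
        then have "\<forall>\<^sub>F j in sequentially. h j (q x) = 1" by (auto simp: eventually_sequentially)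
        then show ?thesis using True by (simp add: tendsto_eventually)
      next
        case False
        then have "real j * (q x - s) \<le> 0" for j by (intro mult_nonneg_nonpos) auto
        then have "h j (q x) = 0" for j by (simp add: h_def)
        then show ?thesis using False by simp
      qed
      then show "(\<lambda>j. U x * complex_of_real (h j (q x))) \<longlonglongrightarrow> U x * complex_of_real (indicator {x. s < q x} x)"
        by (intro tendsto_intros)
    qed
    have "\<bar>h j y\<bar> \<le> 1" for j y by (auto simp: h_def)
    then show "AE x in M. norm (U x * complex_of_real (h j (q x))) \<le> norm (U x)" for j
      by (auto simp: norm_mult mult_left_le)
    show "(\<lambda>x. U x * complex_of_real (indicator {x. s < q x} x)) \<in> borel_measurable M"
      unfolding indicator_def by measurable
  qed (use U in auto)
  then show ?thesis using cont[OF ch] by (simp add: LIMSEQ_const_iff)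
qed

text \<open>
  Orthants are stable under intersection and generate the Borel sets, so the integral of the function
  over every measurable set is 0.
\<close>

lemma AE_zero_if_orthant_integrals_zero:
  fixes W :: "real^'n \<Rightarrow> complex"
  assumes S: "S \<in> lmeasurable" and W: "integrable (lebesgue_on S) W"
    and z: "\<And>a. (LINT x|lebesgue_on S. W x * complex_of_real (indicator {x. \<forall>i. a $ i < x $ i} x)) = 0"
  shows "AE x in lebesgue_on S. W x = 0"
proof -
  have Sl: "S \<in> sets lebesgue" using S by auto
  then have SI: "S \<inter> space lebesgue \<in> sets lebesgue" by simp
  define F where "F x = indicator S x *\<^sub>R W x" for x
  have F: "integrable lebesgue F" unfolding F_def using W integrable_restrict_space[OF SI] by blast
  have sF: "set_integrable lebesgue B F" if "B \<in> sets lebesgue" for B :: "(real^'n) set"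
    unfolding set_integrable_def by (rule integrable_mult_indicator[OF that F])
  let ?Z = "\<lambda>B. (LINT x:B|lebesgue. F x) = 0"
  let ?G = "range (\<lambda>a::real^'n. {x. eucl_less a x})"
  have G0: "?Z B" if BG: "B \<in> ?G" for B :: "(real^'n) set"
  proof -
    obtain a where B: "B = {x. \<forall>i. a $ i < x $ i}"
    proof -
      obtain a where "B = {x. eucl_less a x}" using BG by blast
      then have "B = {x. \<forall>i. a $ i < x $ i}"
        by (auto simp: eucl_less_def Basis_vec_def inner_axis)
      then show ?thesis by (rule that)
    qed
    have "(LINT x|lebesgue_on S. W x * complex_of_real (indicator B x)) = (LINT x:B|lebesgue. F x)"
      unfolding integral_restrict_space[OF SI] set_lebesgue_integral_def F_def
      by (intro Bochner_Integration.integral_cong) (auto simp: indicator_def)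
    then show ?thesis using z[of a] B by simp
  qed
  have total: "?Z UNIV"
  proof -
    let ?A = "\<lambda>n::nat. {x::real^'n. eucl_less (\<chi> i. - real n) x}"
    have "(\<lambda>n. LINT x:?A n|lebesgue. F x) \<longlonglongrightarrow> (LINT x:(\<Union>n. ?A n)|lebesgue. F x)"
    proof (rule set_integral_cont_up)
      show A: "?A n \<in> sets lebesgue" for n by (rule sets_completionI_sets) simp
      show "incseq ?A" by (auto simp: incseq_def eucl_less_def Basis_vec_def inner_axis) (meson le_less_trans neg_le_iff_le of_nat_le_iff)
      show "set_integrable lebesgue (\<Union>n. ?A n) F" by (rule sF) (use A in auto)
    qed
    moreover have "(LINT x:?A n|lebesgue. F x) = 0" for n by (rule G0) blast
    moreover have "(\<Union>n. ?A n) = UNIV"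
    proof -
      have "\<exists>n. x \<in> ?A n" for x :: "real^'n"
      proof -
        obtain n :: nat where n: "norm x < real n" using reals_Archimedean2 by blast
        have "- real n < x $ i" for i using component_le_norm_cart[of x i] n by linarith
        then show ?thesis by (auto simp: eucl_less_def Basis_vec_def inner_axis)
      qed
      then show ?thesis by blast
    qed
    ultimately show ?thesis by (simp add: LIMSEQ_const_iff)
  qed
  have borel_zero: "?Z B" if "B \<in> sets borel" for B :: "(real^'n) set"
  proof -
    have st: "Int_stable ?G"
    proof (rule Int_stableI)
      fix A B assume "A \<in> ?G" "B \<in> ?G"
      then obtain a b where "A = {x. eucl_less a x}" "B = {x. eucl_less b x}" by blast
      then have "A \<inter> B = {x. eucl_less (\<chi> i. max (a $ i) (b $ i)) x}"
        by (auto simp: eucl_less_def Basis_vec_def inner_axis)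
      then show "A \<inter> B \<in> ?G" by blast
    qed
    have "B \<in> sigma_sets UNIV ?G" using that unfolding borel_eq_greaterThan by (simp add: sets_measure_of_conv)
    from st subset_UNIV[of ?G, folded Pow_UNIV] this show ?thesis
    proof (induction rule: sigma_sets_induct_disjoint)
      case (basic A)
      then show ?case by (rule G0)
    next
      case empty
      show ?case by (simp add: set_lebesgue_integral_def)
    next
      case (compl A)
      have A: "A \<in> sets lebesgue"
        using compl(1) unfolding sets_measure_of_conv[symmetric]
        by (intro sets_completionI_sets) (simp add: borel_eq_greaterThan sets_measure_of_conv)
      have "(LINT x:UNIV|lebesgue. F x) = (LINT x:A \<union> (UNIV - A)|lebesgue. F x)" by simp
      also have "\<dots> = (LINT x:A|lebesgue. F x) + (LINT x:UNIV - A|lebesgue. F x)"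
        using A by (intro set_integral_Un sF) auto
      finally show ?case using compl(2) total by simp
    next
      case (union A)
      have A: "A i \<in> sets lebesgue" for i
        using union(2) by (intro sets_completionI_sets) (auto simp: borel_eq_greaterThan sets_measure_of_conv)
      have "(LINT x:(\<Union>i. A i)|lebesgue. F x) = (\<Sum>i. (LINT x:A i|lebesgue. F x))"
      proof (rule lebesgue_integral_countable_add[OF A])
        show "A i \<inter> A j = {}" if "i \<noteq> j" for i j using union(1) that by (auto simp: disjoint_family_on_def)
        show "set_integrable lebesgue (\<Union>i. A i) F" by (rule sF) (use A in auto)
      qed
      then show ?case using union(3) by simp
    qed
  qed
  interpret finite_measure "lebesgue_on S" using S by (rule finite_measure_lebesgue_on)
  show ?thesis
  proof (rule density_zero[OF W])
    fix A assume "A \<in> sets (lebesgue_on S)"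
    then have A: "A \<in> sets lebesgue" "A \<subseteq> S" using Sl by (auto simp: sets_restrict_space)
    obtain B N N' where B: "A = B \<union> N" "N \<subseteq> N'" "N' \<in> null_sets lborel" "B \<in> sets lborel"
      using sets_completionE[OF A(1)] .
    have N: "N' \<in> null_sets lebesgue" using B(3) by (rule null_sets_completionI)
    have "set_lebesgue_integral (lebesgue_on S) A W = (LINT x:A|lebesgue. F x)"
      unfolding set_lebesgue_integral_def integral_restrict_space[OF SI] F_def
      by (intro Bochner_Integration.integral_cong) (auto simp: indicator_def)
    also have "\<dots> = (LINT x:B|lebesgue. F x)"
      unfolding set_lebesgue_integral_def
    proof (rule integral_cong_AE)
      have Bl: "B \<in> sets lebesgue" using B(4) by (rule sets_completionI_sets)
      show "(\<lambda>x. indicat_real A x *\<^sub>R F x) \<in> borel_measurable lebesgue" "(\<lambda>x. indicat_real B x *\<^sub>R F x) \<in> borel_measurable lebesgue"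
        using sF[OF A(1)] sF[OF Bl] by (auto simp: set_integrable_def)
      show "AE x in lebesgue. indicat_real A x *\<^sub>R F x = indicat_real B x *\<^sub>R F x"
        using AE_not_in[OF N] by eventually_elim (use B in \<open>auto simp: indicator_def\<close>)
    qed
    also have "\<dots> = 0" using borel_zero B(4) by simp
    finally show "set_lebesgue_integral (lebesgue_on S) A W = 0" .
  qed
qed

lemma cube_lmeasurable: "cube L \<in> lmeasurable"
  unfolding cube_def by simp

lemma borel_measurable_cube_coord [measurable]: "(\<lambda>x. x $ i) \<in> borel_measurable (lebesgue_on (cube L))"
proof -
  have "continuous_on (cube L) (\<lambda>x. x $ i)" by (intro continuous_intros)
  then show ?thesis using cube_lmeasurable by (intro continuous_imp_measurable_on_sets_lebesgue) auto
qed

lemma AE_cube_coord_neq: "AE x in lebesgue_on (cube L). x $ i \<noteq> c"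
proof -
  have "negligible {x :: real^3. x $ i = c}"
    using negligible_hyperplane[of "axis i (1::real) :: real^3" c] by (simp add: inner_axis' axis_eq_0_iff)
  then have "AE x in lebesgue. x \<notin> {x :: real^3. x $ i = c}"
    unfolding negligible_iff_null_sets by (rule AE_not_in)
  then have "AE x in lebesgue. x $ i \<noteq> c" by simp
  then show ?thesis
    using cube_lmeasurable[of L] by (subst AE_restrict_space_iff) auto
qed

text \<open>
  Within the cube, the half-spaces that cut out an orthant are superlevel sets of trigonometric functions
  of the first and of the third coordinate, whose moments are accessible through the modes. In the third
  coordinate a monotone cosine serves; in the periodic one a half-line becomes an arc.
\<close>

lemma interval_as_superlevel_cos:
  assumes L: "0 < L" obtains s where "\<And>x. x \<in> {0..L} \<Longrightarrow> s < - cos (pi * x / L) \<longleftrightarrow> c < x"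
proof (cases "c < 0 \<or> L \<le> c")
  case True
  then show ?thesis
  proof
    assume "c < 0"
    have "-2 < - cos y" for y :: real using cos_le_one[of y] by linarith
    then show ?thesis using \<open>c < 0\<close> by (intro that[of "-2"]) auto
  next
    assume "L \<le> c"
    have "\<not> 2 < - cos y" for y :: real using cos_ge_minus_one[of y] by linarith
    then show ?thesis using \<open>L \<le> c\<close> by (intro that[of 2]) auto
  qed
next
  case False
  show ?thesis
  proof (rule that)
    fix x assume x: "x \<in> {0..L}"
    have "0 \<le> pi * y / L \<and> pi * y / L \<le> pi" if "y \<in> {0..L}" for y
      using that L by (auto simp: field_simps)
    then have "cos (pi * x / L) < cos (pi * c / L) \<longleftrightarrow> pi * c / L < pi * x / L"
      using x False by (intro cos_mono_less_eq) auto
    also have "\<dots> \<longleftrightarrow> c < x" using L by (simp add: divide_less_cancel)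
    finally show "- cos (pi * c / L) < - cos (pi * x / L) \<longleftrightarrow> c < x" by simp
  qed
qed

lemma interval_as_arc:
  assumes L: "0 < L"
  obtains s \<alpha> where "\<And>x. x \<in> {0..<L} \<Longrightarrow> s < cos (2 * pi * x / L - \<alpha>) \<longleftrightarrow> c < x"
proof (cases "c < 0 \<or> L \<le> c")
  case True
  then show ?thesis
  proof
    assume "c < 0"
    have "-2 < cos y" for y :: real using cos_ge_minus_one[of y] by linarith
    then show ?thesis using \<open>c < 0\<close> by (intro that[of "-2"]) auto
  next
    assume "L \<le> c"
    have "\<not> 2 < cos y" for y :: real using cos_le_one[of y] by linarith
    then show ?thesis using \<open>L \<le> c\<close> by (intro that[of 2]) auto
  qed
next
  case False
  \<comment> \<open>The arc from c to L is centred at (c + L)/2, and \<beta> is half its length as an angle.\<close>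
  define \<beta> where "\<beta> = pi * (L - c) / L"
  have \<beta>: "0 \<le> \<beta>" "\<beta> \<le> pi" using False L by (auto simp: \<beta>_def field_simps)
  show ?thesis
  proof (rule that)
    fix x assume x: "x \<in> {0..<L}"
    define y where "y = 2 * pi * x / L - pi * (c + L) / L"
    have y: "y = pi * ((2 * x - c - L) / L)" using L by (simp add: y_def field_simps)
    show "cos \<beta> < cos (2 * pi * x / L - pi * (c + L) / L) \<longleftrightarrow> c < x"
      unfolding y_def[symmetric]
    proof (cases "c < x")
      case True
      have "\<bar>2 * x - c - L\<bar> < L - c" using True x by auto
      then have "pi * \<bar>2 * x - c - L\<bar> / L < \<beta>"
        unfolding \<beta>_def using L by (intro divide_strict_right_mono mult_strict_left_mono) auto
      then have "\<bar>y\<bar> < \<beta>" unfolding y using L by (simp add: abs_mult)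
      then have "cos \<beta> < cos \<bar>y\<bar>" using \<beta> by (intro cos_monotone_0_pi) auto
      then show "cos \<beta> < cos y \<longleftrightarrow> c < x" using True by simp
    next
      case False
      have b: "L - c \<le> L + c - 2 * x" "L + c - 2 * x \<le> L + c" using False x by auto
      then have "\<beta> \<le> - y" "- y \<le> pi * ((L + c) / L)"
        unfolding y \<beta>_def using L by (auto simp: field_simps)
      moreover have "pi * ((L + c) / L) = 2 * pi - \<beta>" unfolding \<beta>_def using L by (simp add: field_simps)
      ultimately have r: "\<beta> \<le> - y" "- y \<le> 2 * pi - \<beta>" by auto
      have "cos y \<le> cos \<beta>"
      proof (cases "- y \<le> pi")
        case True
        then have "cos (- y) \<le> cos \<beta>" using r \<beta> by (intro cos_monotone_0_pi_le) auto
        then show ?thesis by simp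
      next
        case False
        then have "cos (2 * pi - - y) \<le> cos \<beta>" using r \<beta> by (intro cos_monotone_0_pi_le) auto
        then show ?thesis by (simp add: cos_add)
      qed
      then show "cos \<beta> < cos y \<longleftrightarrow> c < x" using False by simp
    qed
  qed
qed

text \<open>
  One direction after the other, vanishing moments are exchanged for indicator functions of half-spaces.
  Products of the exponentials in the periodic direction with powers of
  \<open>cos (2 \<pi> x\<^sub>1 / L - \<alpha>)\<close> are again combinations of exponentials. Multiplication by
  \<open>cos (\<pi> x\<^sub>3 / L)\<close> maps the sine modes to combinations of sine modes. What remains is that \<open>u\<close> times
  the positive function \<open>sin (\<pi> x\<^sub>3 / L)\<close> vanishes.
\<close>

lemma modes_complete:
  assumes L: "0 < L" and u: "integrable (lebesgue_on (cube L)) u"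
    and orth: "\<And>n l m. (LINT x|lebesgue_on (cube L). u x *
        mode (2 * pi * of_int n / L) (\<lambda>t. t ^ l) (\<lambda>t. sin (pi * real (Suc m) * t / L)) x) = 0"
  shows "AE x in lebesgue_on (cube L). u x = 0"
proof -
  let ?M = "lebesgue_on (cube L)"
  have mem: "0 \<le> x $ i" "x $ i \<le> L" if "x \<in> space ?M" for x i using that by (auto simp: mem_cube)
  have [measurable]: "u \<in> borel_measurable ?M" using u by simp
  have bnd: "integrable ?M (\<lambda>x. u x * p x)"
    if [measurable]: "p \<in> borel_measurable ?M" and "\<And>x. x \<in> cube L \<Longrightarrow> norm (p x) \<le> K" for p K
  proof (rule Bochner_Integration.integrable_bound[of ?M "\<lambda>x. complex_of_real K * u x"])
    have "norm (u x * p x) \<le> norm (complex_of_real K * u x)" if "x \<in> space ?M" for x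
    proof -
      have "norm (p x) \<le> K" using that \<open>\<And>x. x \<in> cube L \<Longrightarrow> norm (p x) \<le> K\<close> by simp
      then have "norm (p x) \<le> \<bar>K\<bar>" by linarith
      then show ?thesis by (simp add: norm_mult mult.commute mult_right_mono)
    qed
    then show "AE x in ?M. norm (u x * p x) \<le> norm (complex_of_real K * u x)" by auto
  qed (use u in auto)
  define e where "e n x = exp ((x $ 1) *\<^sub>R (\<i> * complex_of_real (2 * pi * of_int n / L)))" for n and x :: "real^3"
  define S where "S m x = complex_of_real (sin (pi * real m * x $ 3 / L))" for m and x :: "real^3"
  define q3 where "q3 x = - cos (pi * x $ 3 / L)" for x :: "real^3"
  have e_bd: "norm (e n x) = 1" for n x by (simp add: e_def norm_exp_eq_Re)
  have S_bd: "norm (S m x) \<le> 1" for m x by (simp add: S_def)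
  have q3_bd: "\<bar>q3 x\<bar> \<le> 1" for x by (simp add: q3_def)
  have [measurable]: "e n \<in> borel_measurable ?M" for n unfolding e_def[abs_def] by measurable
  have [measurable]: "S m \<in> borel_measurable ?M" for m unfolding S_def[abs_def] by measurable
  have [measurable]: "q3 \<in> borel_measurable ?M" unfolding q3_def[abs_def] by measurable
  have x2_bd: "norm (complex_of_real (x $ 2) ^ l) \<le> L ^ l" if "x \<in> cube L" for x l
    using that by (auto simp: norm_power mem_cube intro!: power_mono)
  have I1: "(LINT x|?M. u x * (e n x * complex_of_real (x $ 2) ^ l * S m x) * complex_of_real (q3 x) ^ p) = 0" for n l m p
  proof (induction p arbitrary: m)
    case 0
    show ?case
    proof (cases m)
      case (Suc m')
      then show ?thesis using orth[of n l m'] by (simp add: mode_def e_def S_def mult_ac)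
    qed (simp add: S_def)
  next
    case (Suc p)
    have int: "integrable ?M (\<lambda>x. u x * (e n x * complex_of_real (x $ 2) ^ l * S m x) * complex_of_real (q3 x) ^ p)" for m
    proof -
      have "integrable ?M (\<lambda>x. u x * (e n x * complex_of_real (x $ 2) ^ l * S m x * complex_of_real (q3 x) ^ p))"
      proof (rule bnd[of _ "1 * L ^ l * 1 * 1"])
        show "norm (e n x * complex_of_real (x $ 2) ^ l * S m x * complex_of_real (q3 x) ^ p) \<le> 1 * L ^ l * 1 * 1" if "x \<in> cube L" for x
          unfolding norm_mult using that L e_bd S_bd x2_bd q3_bd
          by (intro mult_mono) (auto simp: norm_power power_le_one)
      qed measurable
      then show ?thesis by (simp add: mult.assoc)
    qed
    show ?case
    proof (cases m)
      case 0
      then show ?thesis by (simp add: S_def)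
    next
      case (Suc m')
      have "S m x * complex_of_real (q3 x) = - (S (Suc m) x + S m' x) / 2" for x
      proof -
        let ?b = "pi * x $ 3 / L"
        have b: "pi * real (Suc m) * x $ 3 / L = real m * ?b + ?b" "pi * real m' * x $ 3 / L = real m * ?b - ?b"
          "pi * real m * x $ 3 / L = real m * ?b"
          using Suc L by (simp_all add: field_simps)
        have "sin (pi * real m * x $ 3 / L) * q3 x = - (sin (pi * real (Suc m) * x $ 3 / L) + sin (pi * real m' * x $ 3 / L)) / 2"
          unfolding b q3_def by (simp add: sin_add sin_diff)
        then have "complex_of_real (sin (pi * real m * x $ 3 / L) * q3 x)
          = complex_of_real (- (sin (pi * real (Suc m) * x $ 3 / L) + sin (pi * real m' * x $ 3 / L)) / 2)"
          by (simp only:)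
        then show ?thesis unfolding S_def by simp
      qed
      then have "u x * (e n x * complex_of_real (x $ 2) ^ l * S m x) * complex_of_real (q3 x) ^ Suc p
        = (-1/2) * (u x * (e n x * complex_of_real (x $ 2) ^ l * S (Suc m) x) * complex_of_real (q3 x) ^ p)
          + (-1/2) * (u x * (e n x * complex_of_real (x $ 2) ^ l * S m' x) * complex_of_real (q3 x) ^ p)" for x
      proof -
        have "u x * (e n x * complex_of_real (x $ 2) ^ l * S m x) * complex_of_real (q3 x) ^ Suc p
          = u x * (e n x * complex_of_real (x $ 2) ^ l * (S m x * complex_of_real (q3 x))) * complex_of_real (q3 x) ^ p"
          by (simp add: mult_ac)
        then show ?thesis unfolding \<open>S m x * complex_of_real (q3 x) = _\<close> by (simp add: field_simps)
      qed
      then show ?thesis using int Suc.IH by simp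
    qed
  qed
  have I2: "(LINT x|?M. u x * (e n x * complex_of_real (x $ 2) ^ l * S 1 x) * complex_of_real (indicator {x. t3 < q3 x} x)) = 0" for n l t3
  proof (rule integral_superlevel_zero[where B = 1])
    show "integrable ?M (\<lambda>x. u x * (e n x * complex_of_real (x $ 2) ^ l * S 1 x))"
    proof (rule bnd[of _ "1 * L ^ l * 1"])
      show "norm (e n x * complex_of_real (x $ 2) ^ l * S 1 x) \<le> 1 * L ^ l * 1" if "x \<in> cube L" for x
        unfolding norm_mult using that L e_bd S_bd x2_bd by (intro mult_mono) auto
    qed measurable
  qed (use q3_bd I1 in auto)
  define i3 where "i3 t x = complex_of_real (indicator {x. t < q3 x} x)" for t and x :: "real^3"
  define i2 where "i2 t x = complex_of_real (indicator {x::real^3. t < x $ 2} x)" for t and x :: "real^3"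
  have [measurable]: "i3 t \<in> borel_measurable ?M" "i2 t \<in> borel_measurable ?M" for t
    unfolding i3_def[abs_def] i2_def[abs_def] indicator_def by measurable
  have i_bd: "norm (i3 t x) \<le> 1" "norm (i2 t x) \<le> 1" for t x by (auto simp: i3_def i2_def indicator_def)
  have I3: "(LINT x|?M. u x * (e n x * S 1 x * i3 t3 x) * complex_of_real (indicator {x. t2 < x $ 2} x)) = 0" for n t3 t2
  proof (rule integral_superlevel_zero[where B = L])
    show "integrable ?M (\<lambda>x. u x * (e n x * S 1 x * i3 t3 x))"
    proof (rule bnd[of _ "1 * 1 * 1"])
      show "norm (e n x * S 1 x * i3 t3 x) \<le> 1 * 1 * 1" for x
        unfolding norm_mult using e_bd S_bd i_bd by (intro mult_mono) auto
    qed measurable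
    show "(LINT x|?M. u x * (e n x * S 1 x * i3 t3 x) * complex_of_real (x $ 2) ^ p) = 0" for p
      using I2[of n p t3] by (simp add: i3_def mult_ac)
  qed (use mem in \<open>auto simp: abs_le_iff\<close>)
  define q1 where "q1 \<alpha> x = cos (2 * pi * x $ 1 / L - \<alpha>)" for \<alpha> and x :: "real^3"
  have [measurable]: "q1 \<alpha> \<in> borel_measurable ?M" for \<alpha> unfolding q1_def[abs_def] by measurable
  have q1_bd: "\<bar>q1 \<alpha> x\<bar> \<le> 1" for \<alpha> x by (simp add: q1_def)
  have I4: "(LINT x|?M. u x * (S 1 x * i3 t3 x * i2 t2 x * e n x) * complex_of_real (q1 \<alpha> x) ^ p) = 0" for n t3 t2 \<alpha> p
  proof (induction p arbitrary: n)
    case 0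
    show ?case using I3[of n t3 t2] by (simp add: i2_def mult_ac)
  next
    case (Suc p)
    have int: "integrable ?M (\<lambda>x. u x * (S 1 x * i3 t3 x * i2 t2 x * e n x) * complex_of_real (q1 \<alpha> x) ^ p)" for n
    proof -
      have "integrable ?M (\<lambda>x. u x * (S 1 x * i3 t3 x * i2 t2 x * e n x * complex_of_real (q1 \<alpha> x) ^ p))"
      proof (rule bnd[of _ "1 * 1 * 1 * 1 * 1"])
        show "norm (S 1 x * i3 t3 x * i2 t2 x * e n x * complex_of_real (q1 \<alpha> x) ^ p) \<le> 1 * 1 * 1 * 1 * 1" for x
          unfolding norm_mult using e_bd S_bd i_bd q1_bd
          by (intro mult_mono) (auto simp: norm_power power_le_one)
      qed measurable
      then show ?thesis by (simp add: mult.assoc)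
    qed
    have eq: "e n x * complex_of_real (q1 \<alpha> x) = exp (- \<i> * complex_of_real \<alpha>) / 2 * e (n + 1) x + exp (\<i> * complex_of_real \<alpha>) / 2 * e (n - 1) x" for x
    proof -
      define y where "y = complex_of_real (2 * pi * x $ 1 / L)"
      have en: "e k x = exp (\<i> * (of_int k * y))" for k by (simp add: e_def y_def scaleR_conv_of_real mult_ac)
      have q1e: "complex_of_real (q1 \<alpha> x) = (exp (\<i> * (y - complex_of_real \<alpha>)) + exp (- (\<i> * (y - complex_of_real \<alpha>)))) / 2"
        unfolding q1_def cos_of_real[symmetric] cos_exp_eq y_def by simp
      have "e n x * complex_of_real (q1 \<alpha> x) = (exp (\<i> * (of_int n * y) + \<i> * (y - complex_of_real \<alpha>)) + exp (\<i> * (of_int n * y) - \<i> * (y - complex_of_real \<alpha>))) / 2"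
        unfolding en q1e by (simp only: exp_add exp_diff exp_minus divide_inverse distrib_left distrib_right mult.assoc)
      also have "\<i> * (of_int n * y) + \<i> * (y - complex_of_real \<alpha>) = - \<i> * complex_of_real \<alpha> + \<i> * (of_int (n + 1) * y)"
        by (simp add: algebra_simps)
      also have "\<i> * (of_int n * y) - \<i> * (y - complex_of_real \<alpha>) = \<i> * complex_of_real \<alpha> + \<i> * (of_int (n - 1) * y)"
        by (simp add: algebra_simps)
      finally show ?thesis unfolding en by (simp only: exp_add) (simp add: add_divide_distrib)
    qed
    let ?a = "exp (- \<i> * complex_of_real \<alpha>) / 2" and ?b = "exp (\<i> * complex_of_real \<alpha>) / 2"
    have "u x * (S 1 x * i3 t3 x * i2 t2 x * e n x) * complex_of_real (q1 \<alpha> x) ^ Suc p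
       = ?a * (u x * (S 1 x * i3 t3 x * i2 t2 x * e (n+1) x) * complex_of_real (q1 \<alpha> x) ^ p)
         + ?b * (u x * (S 1 x * i3 t3 x * i2 t2 x * e (n-1) x) * complex_of_real (q1 \<alpha> x) ^ p)" for x
    proof -
      have "u x * (S 1 x * i3 t3 x * i2 t2 x * e n x) * complex_of_real (q1 \<alpha> x) ^ Suc p
        = u x * (S 1 x * i3 t3 x * i2 t2 x * (e n x * complex_of_real (q1 \<alpha> x))) * complex_of_real (q1 \<alpha> x) ^ p"
        by (simp add: mult_ac)
      also have "\<dots> = ?a * (u x * (S 1 x * i3 t3 x * i2 t2 x * e (n+1) x) * complex_of_real (q1 \<alpha> x) ^ p)
         + ?b * (u x * (S 1 x * i3 t3 x * i2 t2 x * e (n-1) x) * complex_of_real (q1 \<alpha> x) ^ p)"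
        unfolding eq by (simp only: distrib_left distrib_right mult_ac)
      finally show ?thesis .
    qed
    then have "(LINT x|?M. u x * (S 1 x * i3 t3 x * i2 t2 x * e n x) * complex_of_real (q1 \<alpha> x) ^ Suc p)
      = ?a * (LINT x|?M. u x * (S 1 x * i3 t3 x * i2 t2 x * e (n+1) x) * complex_of_real (q1 \<alpha> x) ^ p)
        + ?b * (LINT x|?M. u x * (S 1 x * i3 t3 x * i2 t2 x * e (n-1) x) * complex_of_real (q1 \<alpha> x) ^ p)"
      using int by (simp only: Bochner_Integration.integral_add integrable_mult_right integral_mult_right_zero)
    then show ?case using Suc.IH by simp
  qed
  have I5: "(LINT x|?M. u x * (S 1 x * i3 t3 x * i2 t2 x * e 0 x) * complex_of_real (indicator {x. t1 < q1 \<alpha> x} x)) = 0" for t1 t2 t3 \<alpha>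
  proof (rule integral_superlevel_zero[where B = 1])
    show "integrable ?M (\<lambda>x. u x * (S 1 x * i3 t3 x * i2 t2 x * e 0 x))"
    proof (rule bnd[of _ "1 * 1 * 1 * 1"])
      show "norm (S 1 x * i3 t3 x * i2 t2 x * e 0 x) \<le> 1 * 1 * 1 * 1" for x
        unfolding norm_mult using e_bd S_bd i_bd by (intro mult_mono) auto
    qed measurable
  qed (use q1_bd I4 in auto)
  have W: "integrable ?M (\<lambda>x. u x * S 1 x)" by (rule bnd[OF _ S_bd]) measurable
  have "AE x in ?M. u x * S 1 x = 0"
  proof (rule AE_zero_if_orthant_integrals_zero[OF cube_lmeasurable W])
    fix a :: "real^3"
    obtain t3 where t3: "\<And>y. y \<in> {0..L} \<Longrightarrow> t3 < - cos (pi * y / L) \<longleftrightarrow> a $ 3 < y"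
      using interval_as_superlevel_cos[OF L, of "a $ 3"] by blast
    obtain t1 \<alpha> where t1: "\<And>y. y \<in> {0..<L} \<Longrightarrow> t1 < cos (2 * pi * y / L - \<alpha>) \<longleftrightarrow> a $ 1 < y"
      using interval_as_arc[OF L, of "a $ 1"] by blast
    have "(LINT x|?M. u x * S 1 x * complex_of_real (indicator {x. \<forall>i. a $ i < x $ i} x))
       = (LINT x|?M. u x * (S 1 x * i3 t3 x * i2 (a $ 2) x * e 0 x) * complex_of_real (indicator {x. t1 < q1 \<alpha> x} x))"
    proof (rule integral_cong_AE)
      have eq3: "{x :: real^3. \<forall>i. a $ i < x $ i} = {x. a $ 1 < x $ 1 \<and> a $ 2 < x $ 2 \<and> a $ 3 < x $ 3}" by (simp add: forall_3)
      show "(\<lambda>x. u x * S 1 x * complex_of_real (indicator {x. \<forall>i. a $ i < x $ i} x)) \<in> borel_measurable ?M"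
        unfolding eq3 indicator_def by measurable
      show "(\<lambda>x. u x * (S 1 x * i3 t3 x * i2 (a $ 2) x * e 0 x) * complex_of_real (indicator {x. t1 < q1 \<alpha> x} x)) \<in> borel_measurable ?M"
        unfolding indicator_def by measurable
      have "AE x in ?M. x \<in> cube L" by (rule AE_I2) simp
      with AE_cube_coord_neq[where L = L and i = 1 and c = L]
      show "AE x in ?M. u x * S 1 x * complex_of_real (indicator {x. \<forall>i. a $ i < x $ i} x)
        = u x * (S 1 x * i3 t3 x * i2 (a $ 2) x * e 0 x) * complex_of_real (indicator {x. t1 < q1 \<alpha> x} x)"
      proof eventually_elim
        case (elim x)
        have "x $ 1 \<in> {0..<L}" "x $ 3 \<in> {0..L}" using elim by (auto simp: mem_cube less_le)
        then have "t3 < q3 x \<longleftrightarrow> a $ 3 < x $ 3" "t1 < q1 \<alpha> x \<longleftrightarrow> a $ 1 < x $ 1"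
          using t3[of "x $ 3"] t1[of "x $ 1"] by (auto simp: q3_def q1_def)
        then show ?case by (auto simp: i3_def i2_def e_def indicator_def forall_3)
      qed
    qed
    then show "(LINT x|?M. u x * S 1 x * complex_of_real (indicator {x. \<forall>i. a $ i < x $ i} x)) = 0"
      unfolding I5 .
  qed
  moreover have "AE x in ?M. x \<in> cube L" by (rule AE_I2) simp
  ultimately show ?thesis using AE_cube_coord_neq[where L = L and i = 3 and c = 0] AE_cube_coord_neq[where L = L and i = 3 and c = L]
  proof eventually_elim
    case (elim x)
    have "0 < x $ 3" "x $ 3 < L" using elim by (auto simp: mem_cube less_le)
    then have "0 < pi * x $ 3 / L" "pi * x $ 3 / L < pi" using L by (auto simp: field_simps)
    then have "S 1 x \<noteq> 0" using sin_gt_zero by (force simp: S_def)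
    then show ?case using elim by simp
  qed
qed

section \<open>Multiplicities\<close>

lemma integrable_cube_continuous:
  fixes v :: "real^3 \<Rightarrow> 'a::euclidean_space"
  assumes "continuous_on UNIV v"
  shows "integrable (lebesgue_on (cube L)) v"
  unfolding cube_def by (rule continuous_imp_integrable) (rule continuous_on_subset[OF assms subset_UNIV])

lemma bounded_on_cube:
  fixes v :: "real^3 \<Rightarrow> complex"
  assumes "continuous_on UNIV v"
  obtains K where "0 \<le> K" "\<And>x. x \<in> cube L \<Longrightarrow> norm (v x) \<le> K"
proof -
  have "continuous_on (cube L) v" by (rule continuous_on_subset[OF assms subset_UNIV])
  moreover have "compact (cube L)" unfolding cube_def by (rule compact_cbox)
  ultimately have "bounded (v ` cube L)" by (intro compact_imp_bounded compact_continuous_image)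
  then obtain K where "0 < K" "\<forall>z\<in>v ` cube L. norm z \<le> K" unfolding bounded_pos by blast
  then show ?thesis using that[of K] by auto
qed

lemma integrable_mult_continuous:
  fixes u v :: "real^3 \<Rightarrow> complex"
  assumes u: "integrable (lebesgue_on (cube L)) u" and v: "continuous_on UNIV v"
  shows "integrable (lebesgue_on (cube L)) (\<lambda>x. u x * v x)"
proof -
  obtain K where K: "0 \<le> K" "\<And>x. x \<in> cube L \<Longrightarrow> norm (v x) \<le> K" using bounded_on_cube[OF v] by blast
  have [measurable]: "v \<in> borel_measurable (lebesgue_on (cube L))" "u \<in> borel_measurable (lebesgue_on (cube L))"
    using integrable_cube_continuous[OF v] u by auto
  show ?thesis
  proof (rule Bochner_Integration.integrable_bound[of _ "\<lambda>x. complex_of_real K * u x"])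
    have "norm (u x * v x) \<le> norm (complex_of_real K * u x)" if "x \<in> cube L" for x
      using mult_right_mono[OF K(2)[OF that], of "norm (u x)"] K(1) by (simp add: norm_mult mult.commute)
    then show "AE x in lebesgue_on (cube L). norm (u x * v x) \<le> norm (complex_of_real K * u x)"
      by (intro AE_I2) simp
  qed (use u in auto)
qed

lemma finite_measure_cube: "finite_measure (lebesgue_on (cube L))"
  by (rule finite_measure_lebesgue_on) (rule cube_lmeasurable)

text \<open>
  A substitute for the Cauchy-Schwarz inequality in the comparison of first and second moments.
\<close>

lemma le_add_square_div: "0 < (e::real) \<Longrightarrow> z \<le> e + z\<^sup>2 / e"
proof -
  assume e: "0 < e"
  have "0 \<le> (z - e)\<^sup>2 + z\<^sup>2 + e\<^sup>2" by simp
  then have "z * e \<le> e * e + z\<^sup>2" by (simp add: power2_eq_square algebra_simps)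
  then show ?thesis using e by (simp add: field_simps power2_eq_square)
qed

lemma L2_cube_integrable:
  assumes "u \<in> L2_cube L"
  shows "integrable (lebesgue_on (cube L)) u"
proof -
  interpret finite_measure "lebesgue_on (cube L)" by (rule finite_measure_cube)
  have u: "u \<in> borel_measurable (lebesgue_on (cube L))" "integrable (lebesgue_on (cube L)) (\<lambda>x. (norm (u x))\<^sup>2)"
    using assms by (auto simp: L2_cube_def)
  show ?thesis
  proof (rule Bochner_Integration.integrable_bound[of _ "\<lambda>x. 1 + (norm (u x))\<^sup>2"])
    have "norm (u x) \<le> norm (1 + (norm (u x))\<^sup>2)" for x
      using le_add_square_div[of 1 "norm (u x)"] by simp
    then show "AE x in lebesgue_on (cube L). norm (u x) \<le> norm (1 + (norm (u x))\<^sup>2)" by simp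
  qed (use u in auto)
qed

lemma L2_cube_diff:
  assumes "u \<in> L2_cube L" "v \<in> L2_cube L"
  shows "integrable (lebesgue_on (cube L)) (\<lambda>x. (norm (u x - v x))\<^sup>2)"
proof -
  have [measurable]: "u \<in> borel_measurable (lebesgue_on (cube L))" "v \<in> borel_measurable (lebesgue_on (cube L))"
    and i: "integrable (lebesgue_on (cube L)) (\<lambda>x. (norm (u x))\<^sup>2)" "integrable (lebesgue_on (cube L)) (\<lambda>x. (norm (v x))\<^sup>2)"
    using assms by (auto simp: L2_cube_def)
  show ?thesis
  proof (rule Bochner_Integration.integrable_bound[of _ "\<lambda>x. 2 * (norm (u x))\<^sup>2 + 2 * (norm (v x))\<^sup>2"])
    have "(norm (u x - v x))\<^sup>2 \<le> 2 * (norm (u x))\<^sup>2 + 2 * (norm (v x))\<^sup>2" for x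
    proof -
      have "(norm (u x - v x))\<^sup>2 \<le> (norm (u x) + norm (v x))\<^sup>2"
        by (intro power_mono norm_triangle_ineq4) auto
      moreover have "0 \<le> (norm (u x) - norm (v x))\<^sup>2" by simp
      ultimately show ?thesis by (simp add: power2_eq_square algebra_simps)
    qed
    then show "AE x in lebesgue_on (cube L). norm ((norm (u x - v x))\<^sup>2) \<le> norm (2 * (norm (u x))\<^sup>2 + 2 * (norm (v x))\<^sup>2)"
      by simp
  qed (use i in auto)
qed

lemma L2_cube_continuous:
  assumes "continuous_on UNIV v"
  shows "v \<in> L2_cube L"
proof -
  have "continuous_on UNIV (\<lambda>x. (norm (v x))\<^sup>2)" by (intro continuous_intros assms)
  from integrable_cube_continuous[OF this] integrable_cube_continuous[OF assms]
  show ?thesis by (auto simp: L2_cube_def)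
qed

text \<open>
  The graph of the operator is a closure, so identities for core functions reach eigenfunctions only
  through limits of pairings with continuous functions.
\<close>

lemma L2_tendsto_pairing:
  assumes f: "\<And>n. f n \<in> L2_cube L" and u: "u \<in> L2_cube L" and lim: "L2_tendsto L f u"
    and v: "continuous_on UNIV v"
  shows "(\<lambda>n. LINT x|lebesgue_on (cube L). f n x * v x) \<longlonglongrightarrow> (LINT x|lebesgue_on (cube L). u x * v x)"
proof -
  let ?M = "lebesgue_on (cube L)"
  interpret finite_measure ?M by (rule finite_measure_cube)
  obtain K where K: "0 \<le> K" "\<And>x. x \<in> cube L \<Longrightarrow> norm (v x) \<le> K" using bounded_on_cube[OF v] by blast
  define a where "a n = (LINT x|?M. (norm (f n x - u x))\<^sup>2)" for n
  define V where "V = measure ?M (space ?M)"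
  have a0: "0 \<le> a n" for n unfolding a_def by (rule integral_nonneg_AE) auto
  have a: "a \<longlonglongrightarrow> 0" using lim unfolding L2_tendsto_def a_def .
  have fi: "integrable ?M (f n)" and ui: "integrable ?M u" for n using f u L2_cube_integrable by auto
  have di: "integrable ?M (\<lambda>x. (norm (f n x - u x))\<^sup>2)" for n using L2_cube_diff[OF f u] .
  define e where "e n = sqrt (a n) + 1 / real (Suc n)" for n
  have e: "0 < e n" "sqrt (a n) \<le> e n" for n using a0[of n] by (auto simp: e_def add_nonneg_pos)
  have bound: "norm ((LINT x|?M. f n x * v x) - (LINT x|?M. u x * v x)) \<le> K * (e n * V + sqrt (a n))" for n
  proof -
    have "(LINT x|?M. f n x * v x) - (LINT x|?M. u x * v x) = (LINT x|?M. (f n x - u x) * v x)"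
      using integrable_mult_continuous[OF fi v] integrable_mult_continuous[OF ui v]
      by (simp add: left_diff_distrib)
    also have "norm \<dots> \<le> (LINT x|?M. norm ((f n x - u x) * v x))" by (rule integral_norm_bound)
    also have "\<dots> \<le> (LINT x|?M. K * (e n + (norm (f n x - u x))\<^sup>2 / e n))"
    proof (rule integral_mono)
      have "integrable ?M (\<lambda>x. (f n x - u x) * v x)"
        by (rule integrable_mult_continuous[OF _ v]) (use fi ui in auto)
      then show "integrable ?M (\<lambda>x. norm ((f n x - u x) * v x))" by (rule integrable_norm)
      show "integrable ?M (\<lambda>x. K * (e n + (norm (f n x - u x))\<^sup>2 / e n))" using di by auto
      fix x assume "x \<in> space ?M"
      then have "norm (v x) \<le> K" using K(2) by simp
      then have "norm (f n x - u x) * norm (v x) \<le> (e n + (norm (f n x - u x))\<^sup>2 / e n) * K"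
        using le_add_square_div[OF e(1)[of n]] e(1)[of n]
        by (intro mult_mono add_nonneg_nonneg divide_nonneg_pos) auto
      then show "norm ((f n x - u x) * v x) \<le> K * (e n + (norm (f n x - u x))\<^sup>2 / e n)"
        by (simp add: norm_mult mult.commute)
    qed
    also have "\<dots> = K * (e n * V + a n / e n)"
      using di by (simp add: V_def a_def mult.commute)
    also have "\<dots> \<le> K * (e n * V + sqrt (a n))"
    proof -
      have "a n = sqrt (a n) * sqrt (a n)" using a0 by simp
      also have "\<dots> \<le> sqrt (a n) * e n" using e a0 by (intro mult_left_mono) auto
      finally have "a n / e n \<le> sqrt (a n)" using e(1)[of n] by (simp add: divide_le_eq)
      then show ?thesis using K(1) by (intro mult_left_mono) auto
    qed
    finally show ?thesis .
  qed
  have "(\<lambda>n. sqrt (a n)) \<longlonglongrightarrow> 0" using tendsto_real_sqrt[OF a] by simp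
  moreover have "(\<lambda>n. 1 / real (Suc n)) \<longlonglongrightarrow> 0" using LIMSEQ_inverse_real_of_nat by (simp add: divide_inverse)
  ultimately have "e \<longlonglongrightarrow> 0 + 0" unfolding e_def[abs_def] by (rule tendsto_add)
  then have "(\<lambda>n. K * (e n * V + sqrt (a n))) \<longlonglongrightarrow> K * ((0 + 0) * V + 0)"
    by (intro tendsto_mult tendsto_add tendsto_const \<open>(\<lambda>n. sqrt (a n)) \<longlonglongrightarrow> 0\<close>)
  then have "(\<lambda>n. K * (e n * V + sqrt (a n))) \<longlonglongrightarrow> 0" by simp
  then have "(\<lambda>n. (LINT x|?M. f n x * v x) - (LINT x|?M. u x * v x)) \<longlonglongrightarrow> 0"
    by (rule Lim_null_comparison[OF always_eventually[OF allI[OF bound]]])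
  then show ?thesis by (rule LIM_zero_cancel)
qed

lemma continuous_on_landau_H:
  assumes u: "C2_fun u"
  shows "continuous_on S (landau_H u)"
proof -
  have u1: "C1_fun (partial j u)" for j using u by (auto simp: C2_fun_def)
  have "continuous_on S (\<lambda>x. - \<i> * partial 1 (magnetic_D1 u) x + complex_of_real (x $ 2) * magnetic_D1 u x
      - partial 2 (partial 2 u) x - partial 3 (partial 3 u) x)"
    by (intro continuous_intros C1_fun_continuous_partial C1_fun_continuous C1_fun_magnetic_D1 u u1)
  also have "(\<lambda>x. - \<i> * partial 1 (magnetic_D1 u) x + complex_of_real (x $ 2) * magnetic_D1 u x
      - partial 2 (partial 2 u) x - partial 3 (partial 3 u) x) = landau_H u"
    unfolding landau_H_def[abs_def] D_D[OF u] magnetic_D1_def[of "magnetic_D1 u", abs_def] D_def[of 1 "magnetic_D1 u", abs_def]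
    by simp
  finally show ?thesis .
qed

definition freq :: "real \<Rightarrow> int \<Rightarrow> real" where
  "freq L n = 2 * pi * of_int n / L"

definition sine :: "real \<Rightarrow> nat \<Rightarrow> real \<Rightarrow> real" where
  "sine L m t = sin (pi * real (Suc m) * t / L)"

definition sine' :: "real \<Rightarrow> nat \<Rightarrow> real \<Rightarrow> real" where
  "sine' L m t = pi * real (Suc m) / L * cos (pi * real (Suc m) * t / L)"

lemma sine_deriv:
  "(sine L m has_real_derivative sine' L m t) (at t)"
  "(sine' L m has_real_derivative - (pi * real (Suc m) / L)\<^sup>2 * sine L m t) (at t)"
  unfolding sine_def[abs_def] sine'_def[abs_def] divide_inverse
  by (auto intro!: derivative_eq_intros simp: power2_eq_square)

lemma sine_boundary: "sine L m 0 = 0" "0 < L \<Longrightarrow> sine L m L = 0"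
proof -
  show "sine L m 0 = 0" by (simp add: sine_def)
  assume "0 < L"
  then have "sine L m L = sin (real (Suc m) * pi)" by (simp add: sine_def mult.commute)
  then show "sine L m L = 0" by (simp only: sin_npi)
qed

lemma continuous_on_sine: "continuous_on S (sine L m)"
  unfolding sine_def[abs_def] divide_inverse by (intro continuous_intros)

lemma continuous_on_mode:
  assumes "continuous_on UNIV f" "continuous_on UNIV h"
  shows "continuous_on S (mode \<kappa> f h)"
  unfolding mode_def[abs_def]
  by (intro continuous_intros continuous_on_compose2[OF assms(1)] continuous_on_compose2[OF assms(2)]) auto

lemma mode_algebra:
  "mode \<kappa> (\<lambda>t. c * f t + g t) h x = complex_of_real c * mode \<kappa> f h x + mode \<kappa> g h x"
  "mode \<kappa> f (\<lambda>t. c * h t) x = complex_of_real c * mode \<kappa> f h x"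
  by (simp_all add: mode_def algebra_simps)

text \<open>
  Testing an eigenfunction with a separated mode whose profile solves the Dirichlet problem with
  right hand side \<open>g\<close> shows that it is orthogonal to the mode with profile \<open>g\<close>.
\<close>

lemma eigenfunction_orthogonal_mode:
  assumes L: "0 < L" and u: "u \<in> eigenspace L \<mu>"
    and k: "k = freq L n" and \<nu>: "\<nu> = \<mu> - (pi * real (Suc m) / L)\<^sup>2"
    and \<phi>: "\<And>t. (\<phi> has_real_derivative \<phi>' t) (at t)"
      "\<And>t. (\<phi>' has_real_derivative (t\<^sup>2 - \<nu>) * \<phi> t - poly g t) (at t)" "\<phi> k = 0" "\<phi> (k + L) = 0"
  shows "(LINT x|lebesgue_on (cube L). u x * mode (-k) (\<lambda>s. poly g (s + k)) (sine L m) x) = 0"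
proof -
  let ?M = "lebesgue_on (cube L)"
  define w where "w x = complex_of_real \<mu> * u x" for x
  obtain f where f: "\<And>n. f n \<in> landau_core L" and fu: "L2_tendsto L f u" and fw: "L2_tendsto L (\<lambda>n. landau_H (f n)) w"
    and uL: "u \<in> L2_cube L" and wL: "w \<in> L2_cube L"
    using u unfolding eigenspace_def landau_op_def w_def by blast
  define p where "p s = \<phi> (s + k)" for s
  define p' where "p' s = \<phi>' (s + k)" for s
  define p'' where "p'' s = ((s + k)\<^sup>2 - \<nu>) * p s - poly g (s + k)" for s
  have p: "(p has_real_derivative p' t) (at t)" for t
    unfolding p_def[abs_def] p'_def using DERIV_shift[of \<phi> "\<phi>' (t + k)" t k] \<phi>(1)[of "t + k"] by simp
  have p': "(p' has_real_derivative p'' t) (at t)" for t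
    unfolding p'_def[abs_def] p''_def p_def using DERIV_shift[of \<phi>' _ t k] \<phi>(2)[of "t + k"] by simp
  have cp: "continuous_on S p" for S using p by (meson DERIV_continuous continuous_at_imp_continuous_on)
  have cp'': "continuous_on UNIV p''" unfolding p''_def[abs_def] by (intro continuous_intros cp)
  have p0: "p 0 = 0" "p L = 0" using \<phi>(3,4) by (simp_all add: p_def add.commute)
  have kn: "k = 2 * pi * of_int n / L" by (simp add: k freq_def)
  let ?v = "mode (-k) p (sine L m)" and ?g = "mode (-k) (\<lambda>s. poly g (s + k)) (sine L m)"
  have cv: "continuous_on UNIV ?v" by (intro continuous_on_mode cp continuous_on_sine)
  have cg: "continuous_on UNIV ?g" by (intro continuous_on_mode continuous_on_sine continuous_intros)
  have cs: "continuous_on UNIV (\<lambda>t. - (pi * real (Suc m) / L)\<^sup>2 * sine L m t)"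
    by (intro continuous_intros continuous_on_sine)
  have transp: "mode (-k) (\<lambda>t. (t + k)\<^sup>2 * p t - p'' t) (sine L m) x - mode (-k) p (\<lambda>t. - (pi * real (Suc m) / L)\<^sup>2 * sine L m t) x
      = complex_of_real \<mu> * ?v x + ?g x" for x
  proof -
    have "(\<lambda>t. (t + k)\<^sup>2 * p t - p'' t) = (\<lambda>t. \<nu> * p t + poly g (t + k))" by (simp add: p''_def fun_eq_iff algebra_simps)
    then have "mode (-k) (\<lambda>t. (t + k)\<^sup>2 * p t - p'' t) (sine L m) x - mode (-k) p (\<lambda>t. - (pi * real (Suc m) / L)\<^sup>2 * sine L m t) x
      = (complex_of_real \<nu> * ?v x + ?g x) - complex_of_real (- (pi * real (Suc m) / L)\<^sup>2) * ?v x"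
      by (simp only: mode_algebra)
    also have "\<dots> = complex_of_real (\<nu> + (pi * real (Suc m) / L)\<^sup>2) * ?v x + ?g x"
      by (simp only: of_real_add of_real_minus) (simp add: algebra_simps)
    finally show ?thesis by (simp add: \<nu>)
  qed
  have cont_core: "continuous_on UNIV (f j)" "continuous_on UNIV (landau_H (f j))" for j
    using f[of j] C1_fun_continuous continuous_on_landau_H by (auto simp: landau_core_def C2_fun_def)
  have eq: "(LINT x|?M. landau_H (f j) x * ?v x) = (LINT x|?M. f j x * (complex_of_real \<mu> * ?v x + ?g x))" for j
  proof -
    have "(LINT x|?M. landau_H (f j) x * ?v x) = integral (cube L) (\<lambda>x. landau_H (f j) x * ?v x)"
      by (intro lebesgue_integral_eq_integral integrable_cube_continuous continuous_intros cont_core cv)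
         (use cube_lmeasurable in auto)
    also have "\<dots> = integral (cube L) (\<lambda>x. f j x * (complex_of_real \<mu> * ?v x + ?g x))"
      unfolding landau_H_transpose[OF L f kn p p' cp'' p0 sine_deriv cs sine_boundary(1) sine_boundary(2)[OF L]] transp ..
    also have "\<dots> = (LINT x|?M. f j x * (complex_of_real \<mu> * ?v x + ?g x))"
      by (intro lebesgue_integral_eq_integral[symmetric] integrable_cube_continuous continuous_intros cont_core cv cg)
         (use cube_lmeasurable in auto)
    finally show ?thesis .
  qed
  have "(\<lambda>j. LINT x|?M. landau_H (f j) x * ?v x) \<longlonglongrightarrow> (LINT x|?M. w x * ?v x)"
    by (rule L2_tendsto_pairing[OF L2_cube_continuous[OF cont_core(2)] wL fw cv])
  moreover have "(\<lambda>j. LINT x|?M. f j x * (complex_of_real \<mu> * ?v x + ?g x)) \<longlonglongrightarrow> (LINT x|?M. u x * (complex_of_real \<mu> * ?v x + ?g x))"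
    by (rule L2_tendsto_pairing[OF L2_cube_continuous[OF cont_core(1)] uL fu]) (intro continuous_intros cv cg)
  ultimately have "(LINT x|?M. w x * ?v x) = (LINT x|?M. u x * (complex_of_real \<mu> * ?v x + ?g x))"
    unfolding eq by (rule LIMSEQ_unique)
  also have "\<dots> = (LINT x|?M. w x * ?v x + u x * ?g x)" by (simp add: w_def algebra_simps)
  also have "\<dots> = (LINT x|?M. w x * ?v x) + (LINT x|?M. u x * ?g x)"
    using L2_cube_integrable[OF wL] L2_cube_integrable[OF uL]
    by (intro Bochner_Integration.integral_add integrable_mult_continuous cv cg)
  finally show ?thesis by simp
qed

text \<open>
  The pairs \<open>(n, m)\<close> of a frequency index in the periodic direction and the index of a sine in the third
  one for which \<open>\<mu>\<close> leaves a Dirichlet eigenvalue to the oscillator on \<open>{k..k + L}\<close>, \<open>k = freq L n\<close>.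
\<close>

definition modes_at :: "real \<Rightarrow> real \<Rightarrow> (int \<times> nat) set" where
  "modes_at L \<mu> = {(n, m). dsol (freq L n) (\<mu> - (pi * real (Suc m) / L)\<^sup>2) (freq L n + L) = 0}"

lemma dsol_zero_imp_low_potential:
  assumes "0 < L" "dsol k \<nu> (k + L) = 0"
  obtains s where "k \<le> s" "s \<le> k + L" "s\<^sup>2 < \<nu>"
proof (rule ccontr)
  assume "\<not> thesis"
  then have "\<And>s. s \<in> {k..k + L} \<Longrightarrow> \<nu> \<le> s\<^sup>2" using that by (meson atLeastAtMost_iff not_less)
  then have "0 < dsol k \<nu> (k + L)" using assms(1) by (intro dsol_pos_below_potential) auto
  then show False using assms(2) by simp
qed

text \<open>
  An eigenvalue requires the interval to reach the region where the potential is below \<open>\<mu>\<close>, which bounds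
  the frequency; the energy in the third direction bounds the other index.
\<close>

lemma finite_modes_at:
  assumes L: "0 < L"
  shows "finite (modes_at L \<mu>)"
proof -
  define c where "c = \<bar>\<mu>\<bar> + 1"
  define N where "N = \<lceil>(c + L) * L\<rceil>"
  have sq: "\<bar>y\<bar> < c" if "y\<^sup>2 < \<mu>" for y
  proof (rule ccontr)
    assume "\<not> \<bar>y\<bar> < c"
    then have "c * c \<le> \<bar>y\<bar> * \<bar>y\<bar>" by (intro mult_mono) (auto simp: c_def)
    moreover have "c * 1 \<le> c * c" by (intro mult_left_mono) (auto simp: c_def)
    ultimately show False using that by (simp add: power2_eq_square c_def)
  qed
  have "modes_at L \<mu> \<subseteq> {- N..N} \<times> {..nat N}"
  proof
    fix p assume "p \<in> modes_at L \<mu>"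
    then obtain n m where p: "p = (n, m)" and z: "dsol (freq L n) (\<mu> - (pi * real (Suc m) / L)\<^sup>2) (freq L n + L) = 0"
      by (auto simp: modes_at_def)
    obtain s where s: "freq L n \<le> s" "s \<le> freq L n + L" "s\<^sup>2 < \<mu> - (pi * real (Suc m) / L)\<^sup>2"
      using dsol_zero_imp_low_potential[OF L z] .
    have sx: "s\<^sup>2 < \<mu>" "(pi * real (Suc m) / L)\<^sup>2 < \<mu>" 
      using s(3) zero_le_power2[of s] zero_le_power2[of "pi * real (Suc m) / L"] by linarith+
    have b: "\<bar>s\<bar> < c" "\<bar>pi * real (Suc m) / L\<bar> < c" by (rule sq[OF sx(1)], rule sq[OF sx(2)])
    have "\<bar>freq L n\<bar> \<le> c + L" using b(1) s L by linarith
    then have "2 * pi * \<bar>real_of_int n\<bar> \<le> (c + L) * L" using L by (simp add: freq_def abs_mult field_simps)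
    moreover have "1 * \<bar>real_of_int n\<bar> \<le> 2 * pi * \<bar>real_of_int n\<bar>" using pi_gt3 by (intro mult_right_mono) auto
    ultimately have "\<bar>real_of_int n\<bar> \<le> (c + L) * L" by linarith
    then have n: "\<bar>n\<bar> \<le> N" unfolding N_def by linarith
    have "pi * real (Suc m) < c * L" using b(2) L by (simp add: abs_mult pos_divide_less_eq del: of_nat_Suc)
    moreover have "1 * real m \<le> pi * real (Suc m)" using pi_gt3 by (intro mult_mono) auto
    moreover have "c * L \<le> (c + L) * L" using L by (simp add: distrib_right)
    ultimately have "real m \<le> (c + L) * L" by linarith
    then have "int m \<le> N" unfolding N_def by linarith
    then show "p \<in> {- N..N} \<times> {..nat N}" using n p by auto
  qed
  then show ?thesis by (rule finite_subset) auto
qed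

text \<open>
  By Weierstrass the solution is approximated by polynomials, so some polynomial is not orthogonal to it.
  Polynomials replace the eigenfunction as witness, because the Dirichlet problem is solved for
  polynomial right hand sides.
\<close>

lemma polynomial_pairing_with_dsol:
  assumes "a < b"
  shows "\<exists>g. integral {a..b} (\<lambda>t. poly g t * dsol a \<nu> t) = 1"
proof -
  let ?y = "dsol a \<nu>"
  note int = integrable_continuous_interval
  have cy: "continuous_on {a..b} ?y" by (rule continuous_on_dsol)
  define Y where "Y = integral {a..b} (\<lambda>t. (?y t)\<^sup>2)"
  define N where "N = integral {a..b} (\<lambda>t. \<bar>?y t\<bar>)"
  have Y: "0 < Y" unfolding Y_def by (rule dsol_norm_pos[OF assms])
  have N: "0 \<le> N" unfolding N_def by (intro integral_nonneg int continuous_intros cy) auto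
  define e where "e = Y / (N + 1)"
  have N1: "0 < N + 1" using N by linarith
  have e: "0 < e" unfolding e_def using Y N1 by (rule divide_pos_pos)
  obtain h where h: "real_polynomial_function h" "\<And>t. t \<in> {a..b} \<Longrightarrow> \<bar>?y t - h t\<bar> < e"
    using Stone_Weierstrass_real_polynomial_function[OF _ cy e] by auto
  obtain c n where hs: "h = (\<lambda>t. \<Sum>i\<le>n::nat. c i * t ^ i)" using real_polynomial_function_imp_sum[OF h(1)] by blast
  define q where "q = (\<Sum>i\<le>n. monom (c i) i)"
  have q: "poly q t = h t" for t by (simp add: q_def hs poly_sum poly_monom)
  define I where "I = integral {a..b} (\<lambda>t. poly q t * ?y t)"
  have "Y - e * N = integral {a..b} (\<lambda>t. (?y t)\<^sup>2 - e * \<bar>?y t\<bar>)"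
    unfolding Y_def N_def by (subst Henstock_Kurzweil_Integration.integral_diff) (auto intro!: int continuous_intros cy)
  also have "\<dots> \<le> I"
    unfolding I_def
  proof (rule integral_le)
    show "(\<lambda>t. (?y t)\<^sup>2 - e * \<bar>?y t\<bar>) integrable_on {a..b}" "(\<lambda>t. poly q t * ?y t) integrable_on {a..b}"
      by (intro int continuous_intros cy)+
    fix t assume t: "t \<in> {a..b}"
    have "(?y t - poly q t) * ?y t \<le> \<bar>?y t - poly q t\<bar> * \<bar>?y t\<bar>" by (metis abs_ge_self abs_mult)
    also have "\<dots> \<le> e * \<bar>?y t\<bar>" using h(2)[OF t] by (intro mult_right_mono) (auto simp: q)
    finally show "(?y t)\<^sup>2 - e * \<bar>?y t\<bar> \<le> poly q t * ?y t" by (simp add: power2_eq_square algebra_simps)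
  qed
  finally have "Y - e * N \<le> I" .
  moreover have "e * (N + 1) = Y" using N1 by (simp add: e_def)
  ultimately have "0 < I" using e by (simp add: distrib_left)
  moreover have "integral {a..b} (\<lambda>t. poly (smult (1 / I) q) t * ?y t) = 1 / I * I"
    unfolding I_def by (simp add: mult.assoc)
  ultimately show ?thesis by (intro exI[of _ "smult (1 / I) q"]) simp
qed

text \<open>
  The eigenspace is determined by one number for each index: by the Fredholm alternative, an
  eigenfunction is orthogonal to all separated modes as soon as its pairings with one witness mode
  for each index vanish, and then completeness makes it vanish.
\<close>

lemma independent_eigenfunctions_le:
  assumes L: "0 < L" and f: "\<And>i. i < p \<Longrightarrow> f i \<in> eigenspace L \<mu>" and ind: "L2_independent L p f"
  shows "p \<le> card (modes_at L \<mu>)"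
proof (rule ccontr)
  let ?M = "lebesgue_on (cube L)" and ?A = "modes_at L \<mu>"
  assume "\<not> p \<le> card ?A"
  then have lt: "card ?A < p" by simp
  obtain a where bij: "bij_betw a {..<card ?A} ?A"
    using ex_bij_betw_nat_finite[OF finite_modes_at[OF L]] by (auto simp: atLeast0LessThan)
  define \<nu> where "\<nu> m = \<mu> - (pi * real (Suc m) / L)\<^sup>2" for m
  have "\<forall>n m. \<exists>g. integral {freq L n..freq L n + L} (\<lambda>t. poly g t * dsol (freq L n) (\<nu> m) t) = 1"
    using L by (intro allI polynomial_pairing_with_dsol) auto
  then obtain G where G: "\<And>n m. integral {freq L n..freq L n + L} (\<lambda>t. poly (G n m) t * dsol (freq L n) (\<nu> m) t) = 1"
    by metis
  define e where "e n m = mode (- freq L n) (\<lambda>s. poly (G n m) (s + freq L n)) (sine L m)" for n m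
  obtain c where c: "\<exists>i<p. c i \<noteq> 0"
    and c0: "\<forall>r<card ?A. (\<Sum>i<p. c i * (LINT x|?M. f i x * e (fst (a r)) (snd (a r)) x)) = 0"
    using exists_nontrivial_solution[OF lt, of "\<lambda>r i. LINT x|?M. f i x * e (fst (a r)) (snd (a r)) x"] by blast
  have fi: "integrable ?M (f i)" if "i < p" for i
    using f[OF that] L2_cube_integrable unfolding eigenspace_def landau_op_def by blast
  define u where "u x = (\<Sum>i<p. c i * f i x)" for x
  have ui: "integrable ?M u" unfolding u_def using fi by auto
  have pair: "(LINT x|?M. u x * v x) = (\<Sum>i<p. c i * (LINT x|?M. f i x * v x))" if "continuous_on UNIV v" for v
  proof -
    have "(LINT x|?M. u x * v x) = (LINT x|?M. (\<Sum>i<p. c i * (f i x * v x)))"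
      by (simp add: u_def sum_distrib_right mult.assoc)
    also have "\<dots> = (\<Sum>i<p. c i * (LINT x|?M. f i x * v x))"
      using fi integrable_mult_continuous[OF _ that] by (simp add: Bochner_Integration.integral_sum)
    finally show ?thesis .
  qed
  have ce: "continuous_on UNIV (e n m)" for n m
    unfolding e_def by (intro continuous_on_mode continuous_on_sine continuous_intros)
  have ue: "(LINT x|?M. u x * e n m x) = 0" if "(n, m) \<in> ?A" for n m
  proof -
    have "(n, m) \<in> a ` {..<card ?A}" unfolding bij_betw_imp_surj_on[OF bij] by (rule that)
    then obtain r where "r < card ?A" "a r = (n, m)" by auto
    then show ?thesis using c0 pair[OF ce] by auto
  qed
  have ug: "(LINT x|?M. u x * mode (- freq L n) (\<lambda>s. poly g (s + freq L n)) (sine L m) x) = 0" for n m g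
  proof -
    let ?k = "freq L n" and ?y = "dsol (freq L n) (\<nu> m)"
    have solv: "(LINT x|?M. u x * mode (- ?k) (\<lambda>s. poly g (s + ?k)) (sine L m) x) = 0"
      if orth: "?y (?k + L) = 0 \<Longrightarrow> integral {?k..?k + L} (\<lambda>t. poly g t * ?y t) = 0" for g
    proof -
      obtain \<phi> \<phi>' where \<phi>: "\<And>t. (\<phi> has_real_derivative \<phi>' t) (at t)"
        "\<And>t. (\<phi>' has_real_derivative (t\<^sup>2 - \<nu> m) * \<phi> t - poly g t) (at t)" "\<phi> ?k = 0" "\<phi> (?k + L) = 0"
        using dirichlet_problem_solvable[of ?k "?k + L" "\<nu> m" g] orth L by auto
      have "(LINT x|?M. f i x * mode (- ?k) (\<lambda>s. poly g (s + ?k)) (sine L m) x) = 0" if "i < p" for i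
        by (rule eigenfunction_orthogonal_mode[OF L f[OF that] refl _ \<phi>]) (simp add: \<nu>_def)
      moreover have "continuous_on UNIV (mode (- ?k) (\<lambda>s. poly g (s + ?k)) (sine L m))"
        by (intro continuous_on_mode continuous_on_sine continuous_intros)
      ultimately show ?thesis using pair by simp
    qed
    show ?thesis
    proof (cases "?y (?k + L) = 0")
      case False
      then show ?thesis by (intro solv) auto
    next
      case True
      then have A: "(n, m) \<in> ?A" by (simp add: modes_at_def \<nu>_def)
      \<comment> \<open>Subtract the multiple of the witness that makes the right hand side orthogonal.\<close>
      define I where "I = integral {?k..?k + L} (\<lambda>t. poly g t * ?y t)"
      let ?g = "g - smult I (G n m)"
      have "integral {?k..?k + L} (\<lambda>t. poly ?g t * ?y t) = integral {?k..?k + L} (\<lambda>t. poly g t * ?y t - I * (poly (G n m) t * ?y t))"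
        by (simp add: algebra_simps)
      also have "\<dots> = I - I * 1"
        unfolding G[of n m, symmetric] I_def
        by (subst Henstock_Kurzweil_Integration.integral_diff)
           (auto intro!: integrable_continuous_interval continuous_intros continuous_on_dsol)
      finally have "(LINT x|?M. u x * mode (- ?k) (\<lambda>s. poly ?g (s + ?k)) (sine L m) x) = 0"
        by (intro solv) simp
      moreover have "u x * mode (- ?k) (\<lambda>s. poly ?g (s + ?k)) (sine L m) x
          = u x * mode (- ?k) (\<lambda>s. poly g (s + ?k)) (sine L m) x - complex_of_real I * (u x * e n m x)" for x
        by (simp add: e_def mode_def algebra_simps)
      moreover have "integrable ?M (\<lambda>x. u x * mode (- ?k) (\<lambda>s. poly g (s + ?k)) (sine L m) x)"
        by (intro integrable_mult_continuous ui continuous_on_mode continuous_on_sine continuous_intros)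
      moreover have "integrable ?M (\<lambda>x. u x * e n m x)" by (rule integrable_mult_continuous[OF ui ce])
      ultimately show ?thesis using ue[OF A] by simp
    qed
  qed
  have "AE x in ?M. u x = 0"
  proof (rule modes_complete[OF L ui])
    fix n l m
    define g where "g = ([:- freq L (-n), 1:] ^ l :: real poly)"
    have "freq L (-n) = - (2 * pi * of_int n / L)" by (simp add: freq_def)
    moreover have "poly g (s + freq L (-n)) = s ^ l" for s by (simp add: g_def poly_power)
    ultimately show "(LINT x|?M. u x * mode (2 * pi * of_int n / L) (\<lambda>t. t ^ l) (\<lambda>t. sin (pi * real (Suc m) * t / L)) x) = 0"
      using ug[of "-n" g m] by (simp add: sine_def[abs_def])
  qed
  then have "\<forall>i<p. c i = 0" using ind unfolding L2_independent_def u_def by blast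
  then show False using c by blast
qed

lemma landau_H_mode:
  assumes f: "\<And>t. (f has_real_derivative f' t) (at t)" "\<And>t. (f' has_real_derivative f'' t) (at t)" "continuous_on UNIV f''"
    and h: "\<And>t. (h has_real_derivative h' t) (at t)" "\<And>t. (h' has_real_derivative h'' t) (at t)" "continuous_on UNIV h''"
  shows "landau_H (mode k f h) x = mode k (\<lambda>t. (t + k)\<^sup>2 * f t - f'' t) h x - mode k f h'' x"
proof -
  have cf': "continuous_on UNIV f'" using f(2) by (meson DERIV_continuous continuous_at_imp_continuous_on)
  have ch': "continuous_on UNIV h'" using h(2) by (meson DERIV_continuous continuous_at_imp_continuous_on)
  have cf: "continuous_on UNIV f" using f(1) by (meson DERIV_continuous continuous_at_imp_continuous_on)
  note m = C1_fun_mode[OF f(1) cf' h(1) ch', of k]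
  note m2 = C1_fun_mode[OF f(2,3) h(1) ch', of k]
  note m3 = C1_fun_mode[OF f(1) cf' h(2,3), of k]
  have kf: "((\<lambda>t. (t + k) * f t) has_real_derivative f t + (t + k) * f' t) (at t)" for t
    by (rule derivative_eq_intros f(1) refl)+ simp
  have ckf: "continuous_on UNIV (\<lambda>t. f t + (t + k) * f' t)" by (intro continuous_intros cf cf')
  have mag: "magnetic_D1 (mode k p h) = mode k (\<lambda>t. (t + k) * p t) h"
    if "\<And>t. (p has_real_derivative p' t) (at t)" "continuous_on UNIV p'" for p p'
    unfolding magnetic_D1_def[abs_def] D_def C1_fun_mode(2)[OF that h(1) ch']
    by (simp add: fun_eq_iff mode_def algebra_simps)
  have v2: "C2_fun (mode k f h)" by (rule C2_fun_mode[OF f h])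
  show ?thesis
    unfolding landau_H_def mag[OF f(1) cf'] mag[OF kf ckf] D_D[OF v2] m(3,4) m2(3) m3(4)
    by (simp add: mode_def power2_eq_square algebra_simps)
qed

text \<open>
  For \<open>\<sigma> = 1\<close> this is the separated eigenfunction with index \<open>p\<close>; for \<open>\<sigma> = -1\<close> it is its complex
  conjugate, which serves as the dual function in the bilinear pairing.
\<close>

definition eigenmode :: "real \<Rightarrow> real \<Rightarrow> int \<times> nat \<Rightarrow> real \<Rightarrow> real^3 \<Rightarrow> complex" where
  "eigenmode L \<mu> p \<sigma> = mode (\<sigma> * freq L (fst p))
     (\<lambda>s. dsol (freq L (fst p)) (\<mu> - (pi * real (Suc (snd p)) / L)\<^sup>2) (s + freq L (fst p))) (sine L (snd p))"

lemma continuous_on_sine'': "continuous_on UNIV (\<lambda>t. - (pi * real (Suc m) / L)\<^sup>2 * sine L m t)"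
  by (intro continuous_intros continuous_on_sine)

lemma dsol_shift_deriv:
  "((\<lambda>s. dsol k \<nu> (s + k)) has_real_derivative dsol' k \<nu> (s + k)) (at s)"
  "((\<lambda>s. dsol' k \<nu> (s + k)) has_real_derivative ((s + k)\<^sup>2 - \<nu>) * dsol k \<nu> (s + k)) (at s)"
  using DERIV_shift[of "dsol k \<nu>" _ s k] DERIV_shift[of "dsol' k \<nu>" _ s k] dsol_deriv[of k \<nu> "s + k"] dsol'_deriv[of k \<nu> "s + k"]
  by auto

lemma continuous_on_dsol_shift: "continuous_on S (\<lambda>s. dsol k \<nu> (s + k))"
  using dsol_shift_deriv(1) by (meson DERIV_continuous continuous_at_imp_continuous_on)

lemma continuous_on_dsol_shift'': "continuous_on UNIV (\<lambda>s. ((s + k)\<^sup>2 - \<nu>) * dsol k \<nu> (s + k))"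
  by (intro continuous_intros continuous_on_dsol_shift)

lemma C2_fun_eigenmode: "C2_fun (eigenmode L \<mu> p \<sigma>)"
  unfolding eigenmode_def
  by (rule C2_fun_mode[OF dsol_shift_deriv continuous_on_dsol_shift'' sine_deriv continuous_on_sine''])

lemma eigenmode_boundary:
  assumes "0 < L" "p \<in> modes_at L \<mu>"
  shows "x $ 2 = 0 \<or> x $ 2 = L \<or> x $ 3 = 0 \<or> x $ 3 = L \<Longrightarrow> eigenmode L \<mu> p \<sigma> x = 0"
  using assms sine_boundary[of L "snd p"]
  by (auto simp: eigenmode_def mode_def modes_at_def dsol_init add.commute)

lemma eigenmode_periodic:
  assumes "0 < L"
  shows "eigenmode L \<mu> p 1 (x + L *\<^sub>R axis 1 1) = eigenmode L \<mu> p 1 x"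
    "eigenmode L \<mu> p (-1) (x + L *\<^sub>R axis 1 1) = eigenmode L \<mu> p (-1) x"
  unfolding eigenmode_def
  by (rule mode_periodic[of L _ "fst p"] mode_periodic[of L _ "- fst p"]; use assms in \<open>simp add: freq_def\<close>)+

lemma eigenmode_in_eigenspace:
  assumes L: "0 < L" and p: "p \<in> modes_at L \<mu>"
  shows "eigenmode L \<mu> p 1 \<in> eigenspace L \<mu>"
proof -
  let ?u = "eigenmode L \<mu> p 1"
  have scaled: "L *\<^sub>R axis 1 1 = (axis 1 L :: real^3)" by (simp add: vec_eq_iff axis_def)
  have core: "?u \<in> landau_core L"
    using C2_fun_eigenmode[of L \<mu> p 1] eigenmode_periodic(1)[OF L, of \<mu> p] eigenmode_boundary[OF L p, of _ 1]
    unfolding landau_core_def scaled by auto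
  have H: "landau_H ?u x = complex_of_real \<mu> * ?u x" for x
    unfolding eigenmode_def mult_1
      landau_H_mode[OF dsol_shift_deriv continuous_on_dsol_shift'' sine_deriv continuous_on_sine'']
    by (simp add: mode_def algebra_simps)
  have cu: "continuous_on UNIV ?u" using C2_fun_eigenmode C1_fun_continuous by (auto simp: C2_fun_def)
  have "landau_op L ?u (\<lambda>x. complex_of_real \<mu> * ?u x)"
    unfolding landau_op_def
  proof (intro conjI exI[of _ "\<lambda>_. ?u"] allI core)
    show "?u \<in> L2_cube L" by (rule L2_cube_continuous[OF cu])
    show "(\<lambda>x. complex_of_real \<mu> * ?u x) \<in> L2_cube L" by (intro L2_cube_continuous continuous_intros cu)
  qed (simp_all add: L2_tendsto_def H)
  then show ?thesis by (simp add: eigenspace_def)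
qed

text \<open>
  Integration by parts in the first or third direction shows that the pairing is multiplied by different
  numbers on both sides, unless frequencies and sine indices agree.
\<close>

lemma eigenmode_orthogonal:
  assumes L: "0 < L" and p: "p \<in> modes_at L \<mu>" and q: "q \<in> modes_at L \<mu>" and "p \<noteq> q"
  shows "integral (cube L) (\<lambda>x. eigenmode L \<mu> p 1 x * eigenmode L \<mu> q (-1) x) = 0"
proof -
  let ?u = "eigenmode L \<mu> p 1" and ?v = "eigenmode L \<mu> q (-1)"
  let ?I = "integral (cube L) (\<lambda>x. ?u x * ?v x)"
  have u2: "C2_fun ?u" and v2: "C2_fun ?v" by (rule C2_fun_eigenmode)+
  then have u1: "C1_fun ?u" and v1: "C1_fun ?v" by (auto simp: C2_fun_def)
  have cs': "continuous_on UNIV (sine' L m)" for m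
    using sine_deriv(2) by (meson DERIV_continuous continuous_at_imp_continuous_on)
  have cd': "continuous_on UNIV (\<lambda>s. dsol' k \<nu> (s + k))" for k \<nu>
    using dsol_shift_deriv(2) by (meson DERIV_continuous continuous_at_imp_continuous_on)
  have P1: "partial 1 (eigenmode L \<mu> r \<sigma>) = (\<lambda>x. \<i> * complex_of_real (\<sigma> * freq L (fst r)) * eigenmode L \<mu> r \<sigma> x)" for r \<sigma>
    unfolding eigenmode_def by (rule C1_fun_mode(2)[OF dsol_shift_deriv(1) cd' sine_deriv(1) cs'])
  have P3: "partial 3 (partial 3 (eigenmode L \<mu> r \<sigma>)) = (\<lambda>x. - complex_of_real ((pi * real (Suc (snd r)) / L)\<^sup>2) * eigenmode L \<mu> r \<sigma> x)" for r \<sigma>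
    unfolding eigenmode_def C1_fun_mode(4)[OF dsol_shift_deriv(1) cd' sine_deriv(1) cs']
      C1_fun_mode(4)[OF dsol_shift_deriv(1) cd' sine_deriv(2) continuous_on_sine''] fun_eq_iff mode_algebra(2) by simp
  have "integral (cube L) (\<lambda>x. partial 1 ?u x * ?v x) = - integral (cube L) (\<lambda>x. ?u x * partial 1 ?v x)"
    by (rule integral_by_parts[OF L u1 v1]) (simp add: eigenmode_periodic[OF L])
  then have "integral (cube L) (\<lambda>x. \<i> * complex_of_real (freq L (fst p)) * (?u x * ?v x))
      = - integral (cube L) (\<lambda>x. - \<i> * complex_of_real (freq L (fst q)) * (?u x * ?v x))"
    unfolding P1 by (simp add: mult_ac)
  then have "\<i> * complex_of_real (freq L (fst p)) * ?I = \<i> * complex_of_real (freq L (fst q)) * ?I"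
    by (simp only: integral_mult_right) simp
  then have 1: "fst p = fst q \<or> ?I = 0" using L by (auto simp: freq_def)
  have "integral (cube L) (\<lambda>x. D 3 (D 3 ?u) x * ?v x) = - integral (cube L) (\<lambda>x. ?u x * partial 3 (partial 3 ?v) x)"
    by (rule second_by_parts[OF L u2 v2]) (use eigenmode_boundary[OF L] p q in auto)
  then have "integral (cube L) (\<lambda>x. complex_of_real ((pi * real (Suc (snd p)) / L)\<^sup>2) * (?u x * ?v x))
      = - integral (cube L) (\<lambda>x. - complex_of_real ((pi * real (Suc (snd q)) / L)\<^sup>2) * (?u x * ?v x))"
    unfolding D_D[OF u2] P3 by (simp add: mult_ac)
  then have "complex_of_real ((pi * real (Suc (snd p)) / L)\<^sup>2) * ?I = complex_of_real ((pi * real (Suc (snd q)) / L)\<^sup>2) * ?I"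
    by (simp only: integral_mult_right) simp
  then have "(pi * real (Suc (snd p)) / L)\<^sup>2 = (pi * real (Suc (snd q)) / L)\<^sup>2 \<or> ?I = 0"
    by (simp only: mult_cancel_right of_real_eq_iff disj_commute)
  moreover have "snd p = snd q" if "(pi * real (Suc (snd p)) / L)\<^sup>2 = (pi * real (Suc (snd q)) / L)\<^sup>2"
  proof -
    have "pi * real (Suc (snd p)) / L = pi * real (Suc (snd q)) / L"
      using L by (intro power2_eq_imp_eq[OF that]) (simp_all del: of_nat_Suc)
    then show ?thesis using L by simp
  qed
  ultimately show ?thesis using 1 \<open>p \<noteq> q\<close> by (auto simp: prod_eq_iff)
qed

lemma eigenmode_norm:
  assumes L: "0 < L"
  shows "integral (cube L) (\<lambda>x. eigenmode L \<mu> p 1 x * eigenmode L \<mu> p (-1) x) \<noteq> 0"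
proof
  define k where "k = freq L (fst p)"
  define \<nu> where "\<nu> = \<mu> - (pi * real (Suc (snd p)) / L)\<^sup>2"
  define h where "h x = (dsol k \<nu> (x $ 2 + k) * sine L (snd p) (x $ 3))\<^sup>2" for x :: "real^3"
  have eq: "eigenmode L \<mu> p 1 x * eigenmode L \<mu> p (-1) x = complex_of_real (h x)" for x
  proof -
    have "exp (x $ 1 *\<^sub>R (\<i> * complex_of_real (1 * k))) * exp (x $ 1 *\<^sub>R (\<i> * complex_of_real (-1 * k))) = 1"
      by (simp flip: exp_add)
    then have e: "(exp (x $ 1 *\<^sub>R (\<i> * complex_of_real (1 * k))) * z) * (exp (x $ 1 *\<^sub>R (\<i> * complex_of_real (-1 * k))) * z) = z * z" for z
      by (metis mult.assoc mult.left_commute mult_1)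
    show ?thesis
      unfolding eigenmode_def mode_def k_def[symmetric] \<nu>_def[symmetric] e
      by (simp add: h_def power2_eq_square mult_ac)
  qed
  have ch: "continuous_on S h" for S
    unfolding h_def[abs_def]
    by (intro continuous_intros continuous_on_compose2[OF continuous_on_dsol_shift[of UNIV k \<nu>]]
        continuous_on_compose2[OF continuous_on_sine[of UNIV L "snd p"]]) auto
  assume "integral (cube L) (\<lambda>x. eigenmode L \<mu> p 1 x * eigenmode L \<mu> p (-1) x) = 0"
  then have "integral (cube L) (\<lambda>x. complex_of_real (h x)) = 0" unfolding eq .
  moreover have hi: "h integrable_on cube L" unfolding cube_def by (rule integrable_continuous[OF ch])
  have "integral (cube L) (\<lambda>x. complex_of_real (h x)) = complex_of_real (integral (cube L) h)"
    by (rule integral_unique[OF has_integral_of_real[OF integrable_integral[OF hi]]])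
  ultimately have "integral (cube L) h = 0" by simp
  with integrable_integral[OF hi] have h0: "(h has_integral 0) (cbox 0 (\<chi> i. L))" by (simp add: cube_def)
  have "box (0 :: real^3) (\<chi> i. L) \<noteq> {}" using L by (auto simp: interval_ne_empty_cart)
  then have z: "h x = 0" if "x \<in> cube L" for x
    using has_integral_0_cbox_imp_0[OF ch _ h0, of x] that by (auto simp: h_def cube_def)
  define m where "m = L / (2 * real (Suc (snd p)))"
  have m: "0 \<le> m" "m \<le> L" using L by (auto simp: m_def divide_le_eq mult_le_cancel_left1)
  have sm: "sine L (snd p) m = 1"
  proof -
    have "pi * real (Suc (snd p)) * m / L = pi / 2" using L by (simp add: m_def del: of_nat_Suc)
    then show ?thesis unfolding sine_def by (simp only: sin_pi_half)
  qed
  have "dsol k \<nu> t = 0" if "t \<in> {k..k + L}" for t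
  proof -
    define x :: "real^3" where "x = (\<chi> i. if i = 2 then t - k else m)"
    have "x \<in> cube L" using that m by (auto simp: mem_cube x_def)
    from z[OF this] show ?thesis by (simp add: h_def x_def sm)
  qed
  then have "integral {k..k + L} (\<lambda>t. (dsol k \<nu> t)\<^sup>2) = 0" by (subst integral_cong[where g = "\<lambda>_. 0"]) auto
  then show False using dsol_norm_pos[of k "k + L" \<nu>] L by simp
qed

text \<open>
  The lower bound is the independence of the separated eigenfunctions, by pairing with their conjugates.
\<close>

lemma multiplicity_at_eq:
  assumes L: "0 < L"
  shows "multiplicity_at L \<mu> = of_nat (card (modes_at L \<mu>))"
proof -
  let ?M = "lebesgue_on (cube L)" and ?A = "modes_at L \<mu>"
  let ?N = "{n. \<exists>f. (\<forall>i<n. f i \<in> eigenspace L \<mu>) \<and> L2_independent L n f}"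
  have le: "n \<le> card ?A" if "n \<in> ?N" for n using that independent_eigenfunctions_le[OF L] by blast
  have "card ?A \<in> ?N"
  proof -
    obtain a where bij: "bij_betw a {..<card ?A} ?A"
      using ex_bij_betw_nat_finite[OF finite_modes_at[OF L]] by (auto simp: atLeast0LessThan)
    have a: "a i \<in> ?A" if "i < card ?A" for i using bij_betwE[OF bij] that by auto
    define f where "f i = eigenmode L \<mu> (a i) 1" for i
    define v where "v i = eigenmode L \<mu> (a i) (-1)" for i
    have cont: "continuous_on UNIV (f i)" "continuous_on UNIV (v i)" for i
      unfolding f_def v_def using C2_fun_eigenmode C1_fun_continuous by (auto simp: C2_fun_def)
    have "L2_independent L (card ?A) f"
      unfolding L2_independent_def
    proof (intro allI impI)
      fix c :: "nat \<Rightarrow> complex" and j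
      assume ae: "AE x in ?M. (\<Sum>i<card ?A. c i * f i x) = 0" and j: "j < card ?A"
      have ci: "integrable ?M (\<lambda>x. f i x * v j x)" for i
        by (intro integrable_cube_continuous continuous_intros cont)
      have pair: "(LINT x|?M. f i x * v j x) = integral (cube L) (\<lambda>x. f i x * v j x)" for i
        using ci cube_lmeasurable by (intro lebesgue_integral_eq_integral) auto
      have "0 = (LINT x|?M. (\<Sum>i<card ?A. c i * f i x) * v j x)"
      proof -
        have "(LINT x|?M. (\<Sum>i<card ?A. c i * f i x) * v j x) = (LINT x|?M. 0)"
        proof (rule integral_cong_AE)
          show "(\<lambda>x. (\<Sum>i<card ?A. c i * f i x) * v j x) \<in> borel_measurable ?M"
            by (rule borel_measurable_integrable) (intro integrable_cube_continuous continuous_intros cont)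
          show "AE x in ?M. (\<Sum>i<card ?A. c i * f i x) * v j x = 0" using ae by eventually_elim simp
        qed simp
        then show ?thesis by simp
      qed
      also have "\<dots> = (LINT x|?M. (\<Sum>i<card ?A. c i * (f i x * v j x)))"
        by (simp add: sum_distrib_right mult.assoc)
      also have "\<dots> = (\<Sum>i<card ?A. c i * (LINT x|?M. f i x * v j x))"
        using ci by (simp add: Bochner_Integration.integral_sum)
      also have "\<dots> = (\<Sum>i<card ?A. if i = j then c j * (LINT x|?M. f j x * v j x) else 0)"
      proof (rule sum.cong[OF refl])
        fix i assume "i \<in> {..<card ?A}"
        then have i: "i < card ?A" by simp
        show "c i * (LINT x|?M. f i x * v j x) = (if i = j then c j * (LINT x|?M. f j x * v j x) else 0)"
        proof (cases "i = j")
          case False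
          then have "a i \<noteq> a j" using bij i j by (auto simp: bij_betw_def inj_on_def)
          from eigenmode_orthogonal[OF L a[OF i] a[OF j] this]
          have "integral (cube L) (\<lambda>x. f i x * v j x) = 0" by (simp add: f_def v_def)
          with False show ?thesis by (simp add: pair)
        qed simp
      qed
      also have "\<dots> = c j * (LINT x|?M. f j x * v j x)" using j by simp
      finally show "c j = 0" using eigenmode_norm[OF L, of \<mu> "a j"] unfolding pair by (simp add: f_def v_def)
    qed
    moreover have "\<forall>i<card ?A. f i \<in> eigenspace L \<mu>" using eigenmode_in_eigenspace[OF L a] by (simp add: f_def)
    ultimately show ?thesis by blast
  qed
  then show ?thesis unfolding multiplicity_at_def
    using le by (intro antisym SUP_least SUP_upper2[of "card ?A"]) (auto intro: of_nat_mono)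
qed

section \<open>Counting\<close>

text \<open>The number of Landau levels \<open>2 j + 1\<close> up to \<open>e\<close>.\<close>

definition levels :: "real \<Rightarrow> nat" where
  "levels e = nat \<lfloor>(e + 1) / 2\<rfloor>"

lemma less_levels_iff: "j < levels e \<longleftrightarrow> 2 * real j + 1 \<le> e"
proof -
  have "j < levels e \<longleftrightarrow> int j + 1 \<le> \<lfloor>(e + 1) / 2\<rfloor>" by (auto simp: levels_def)
  also have "\<dots> \<longleftrightarrow> real_of_int (int j + 1) \<le> (e + 1) / 2" by (rule le_floor_iff)
  also have "\<dots> \<longleftrightarrow> 2 * real j + 1 \<le> e" by auto
  finally show ?thesis .
qed

lemma less_two_levels: "e < 2 * real (levels e) + 1"
  using less_levels_iff[of "levels e" e] by simp

lemma levels_mono: "e \<le> e' \<Longrightarrow> levels e \<le> levels e'"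
  by (metis less_levels_iff not_le order_trans order_less_irrefl)

text \<open>The sines in the third direction with energy up to \<open>e\<close>.\<close>

definition box_modes :: "real \<Rightarrow> real \<Rightarrow> nat set" where
  "box_modes L e = {m. (pi * real (Suc m) / L)\<^sup>2 \<le> e}"

lemma box_modes_eq:
  assumes L: "0 < L"
  shows "box_modes L e = {..<nat \<lfloor>L * sqrt (max 0 e) / pi\<rfloor>}"
proof -
  have "m \<in> box_modes L e \<longleftrightarrow> m < nat \<lfloor>L * sqrt (max 0 e) / pi\<rfloor>" for m
  proof (cases "0 \<le> e")
    case True
    have nn: "0 \<le> pi * real (Suc m) / L" using L by simp
    have "m \<in> box_modes L e \<longleftrightarrow> pi * real (Suc m) / L \<le> sqrt e"
      using nn by (simp add: box_modes_def real_le_rsqrt real_sqrt_le_iff' del: of_nat_Suc)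
         (metis True nn abs_of_nonneg real_sqrt_abs real_sqrt_le_iff)
    also have "\<dots> \<longleftrightarrow> real_of_int (int (Suc m)) \<le> L * sqrt e / pi"
      using L by (simp add: field_simps)
    also have "\<dots> \<longleftrightarrow> int (Suc m) \<le> \<lfloor>L * sqrt e / pi\<rfloor>" by (rule le_floor_iff[symmetric])
    also have "\<dots> \<longleftrightarrow> m < nat \<lfloor>L * sqrt (max 0 e) / pi\<rfloor>" using True by auto
    finally show ?thesis .
  next
    case False
    then have "\<not> (pi * real (Suc m) / L)\<^sup>2 \<le> e" using zero_le_power2[of "pi * real (Suc m) / L"] by linarith
    then show ?thesis using False by (simp add: box_modes_def max_def)
  qed
  then show ?thesis by blast
qed

text \<open>
  The number of pairs of a sine in the third direction and a Landau level with total energy up to \<open>e\<close>: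
  the states of a frequency whose oscillator is not affected by the boundary.
\<close>

definition states_per_freq :: "real \<Rightarrow> real \<Rightarrow> nat" where
  "states_per_freq L e = (\<Sum>m\<in>box_modes L e. levels (e - (pi * real (Suc m) / L)\<^sup>2))"

text \<open>The same pairs, grouped by the Landau level, so that the asymptotics can be taken level by level.\<close>

lemma states_per_freq_eq:
  assumes L: "0 < L" and K: "levels e \<le> K"
  shows "states_per_freq L e = (\<Sum>j<K. card (box_modes L (e - (2 * real j + 1))))"
proof -
  have fin: "finite (box_modes L c)" for c unfolding box_modes_eq[OF L] by simp
  have "levels (e - (pi * real (Suc m) / L)\<^sup>2) = (\<Sum>j<K. if m \<in> box_modes L (e - (2 * real j + 1)) then 1 else 0)" for m
  proof -
    let ?e = "e - (pi * real (Suc m) / L)\<^sup>2"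
    have "levels ?e \<le> levels e" by (rule levels_mono) simp
    moreover have mem: "m \<in> box_modes L (e - (2 * real j + 1)) \<longleftrightarrow> j < levels ?e" for j
      unfolding less_levels_iff box_modes_def mem_Collect_eq by linarith
    ultimately have "{..<levels ?e} = {j \<in> {..<K}. m \<in> box_modes L (e - (2 * real j + 1))}"
      unfolding mem using K by auto
    then have "levels ?e = card {j \<in> {..<K}. m \<in> box_modes L (e - (2 * real j + 1))}" by (metis card_lessThan)
    also have "\<dots> = (\<Sum>j<K. if m \<in> box_modes L (e - (2 * real j + 1)) then 1 else 0)"
      by (simp add: sum.If_cases Int_def)
    finally show ?thesis .
  qed
  then have "states_per_freq L e = (\<Sum>m\<in>box_modes L e. \<Sum>j<K. if m \<in> box_modes L (e - (2 * real j + 1)) then 1 else 0)"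
    unfolding states_per_freq_def by (intro sum.cong) auto
  also have "\<dots> = (\<Sum>j<K. \<Sum>m\<in>box_modes L e. if m \<in> box_modes L (e - (2 * real j + 1)) then 1 else 0)"
    by (rule sum.swap)
  also have "\<dots> = (\<Sum>j<K. card (box_modes L (e - (2 * real j + 1))))"
  proof (rule sum.cong[OF refl])
    fix j
    have "box_modes L (e - (2 * real j + 1)) \<subseteq> box_modes L e" by (auto simp: box_modes_def)
    then have "box_modes L e \<inter> {m. m \<in> box_modes L (e - (2 * real j + 1))} = box_modes L (e - (2 * real j + 1))" by auto
    then show "(\<Sum>m\<in>box_modes L e. if m \<in> box_modes L (e - (2 * real j + 1)) then 1 else 0) = card (box_modes L (e - (2 * real j + 1)))"
      using fin by (simp add: sum.If_cases)
  qed
  finally show ?thesis .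
qed

definition freqs :: "real \<Rightarrow> real \<Rightarrow> real \<Rightarrow> int set" where
  "freqs L x y = {n. x \<le> freq L n \<and> freq L n \<le> y}"

lemma freqs_eq:
  assumes "0 < L"
  shows "freqs L x y = {\<lceil>x * L / (2 * pi)\<rceil>..\<lfloor>y * L / (2 * pi)\<rfloor>}"
proof -
  have mem: "n \<in> freqs L x y \<longleftrightarrow> x * L / (2 * pi) \<le> of_int n \<and> of_int n \<le> y * L / (2 * pi)" for n
    using assms by (auto simp: freqs_def freq_def field_simps)
  show ?thesis by (rule set_eqI) (simp only: mem atLeastAtMost_iff ceiling_le_iff le_floor_iff)
qed

lemma card_freqs:
  assumes "0 < L"
  shows "(y - x) * L / (2 * pi) - 1 \<le> real (card (freqs L x y))"
    and "x \<le> y \<Longrightarrow> real (card (freqs L x y)) \<le> (y - x) * L / (2 * pi) + 1"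
proof -
  define a where "a = x * L / (2 * pi)"
  define b where "b = y * L / (2 * pi)"
  have d: "(y - x) * L / (2 * pi) = b - a" by (simp add: a_def b_def diff_divide_distrib left_diff_distrib)
  have c: "card (freqs L x y) = nat (\<lfloor>b\<rfloor> + 1 - \<lceil>a\<rceil>)" unfolding freqs_eq[OF assms] a_def b_def by simp
  show "(y - x) * L / (2 * pi) - 1 \<le> real (card (freqs L x y))"
    unfolding d c by linarith
  assume "x \<le> y"
  then have "a \<le> b" unfolding a_def b_def using assms by (intro divide_right_mono mult_right_mono) auto
  then show "real (card (freqs L x y)) \<le> (y - x) * L / (2 * pi) + 1"
    unfolding d c by linarith
qed

lemma sum_card_modes_swap:
  assumes "finite F" "finite I" "\<And>\<mu>. \<mu> \<in> F \<Longrightarrow> modes_at L \<mu> \<subseteq> I"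
  shows "(\<Sum>\<mu>\<in>F. card (modes_at L \<mu>)) = (\<Sum>p\<in>I. card {\<mu>\<in>F. p \<in> modes_at L \<mu>})"
proof -
  have "card (modes_at L \<mu>) = (\<Sum>p\<in>I. if p \<in> modes_at L \<mu> then 1 else 0)" if "\<mu> \<in> F" for \<mu>
  proof -
    have "I \<inter> {p. p \<in> modes_at L \<mu>} = modes_at L \<mu>" using assms(3)[OF that] by auto
    then show ?thesis using assms(2) by (simp add: sum.If_cases)
  qed
  then have "(\<Sum>\<mu>\<in>F. card (modes_at L \<mu>)) = (\<Sum>\<mu>\<in>F. \<Sum>p\<in>I. if p \<in> modes_at L \<mu> then 1 else 0)" by simp
  also have "\<dots> = (\<Sum>p\<in>I. \<Sum>\<mu>\<in>F. if p \<in> modes_at L \<mu> then 1 else 0)" by (rule sum.swap)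
  also have "\<dots> = (\<Sum>p\<in>I. card {\<mu>\<in>F. p \<in> modes_at L \<mu>})"
    using assms(1) by (simp add: sum.If_cases Int_def)
  finally show ?thesis .
qed

text \<open>
  A frequency can only contribute below energy \<open>E\<close> if its interval comes within distance
  \<open>sqrt E\<close> of the bottom of the oscillator, and then at most as much as on the whole line.
\<close>

lemma sum_card_modes_le:
  assumes L: "0 < L" and F: "finite F" "F \<subseteq> {..E}"
  shows "(\<Sum>\<mu>\<in>F. card (modes_at L \<mu>)) \<le> card (freqs L (- L - sqrt (max 0 E)) (sqrt (max 0 E))) * states_per_freq L E"
proof -
  let ?r = "sqrt (max 0 E)"
  let ?N = "freqs L (- L - ?r) ?r"
  let ?h = "\<lambda>m. (pi * real (Suc m) / L)\<^sup>2"
  have finN: "finite ?N" and finM: "finite (box_modes L E)" unfolding freqs_eq[OF L] box_modes_eq[OF L] by auto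
  have "modes_at L \<mu> \<subseteq> ?N \<times> box_modes L E" if "\<mu> \<in> F" for \<mu>
  proof
    fix p assume "p \<in> modes_at L \<mu>"
    then obtain n m where p: "p = (n, m)" and z: "dsol (freq L n) (\<mu> - ?h m) (freq L n + L) = 0"
      by (auto simp: modes_at_def)
    obtain s where s: "freq L n \<le> s" "s \<le> freq L n + L" "s\<^sup>2 < \<mu> - ?h m"
      using dsol_zero_imp_low_potential[OF L z] .
    have "\<mu> \<le> E" using that F by auto
    then have e: "s\<^sup>2 \<le> E" "?h m \<le> E" using s(3) zero_le_power2[of s] zero_le_power2[of "pi * real (Suc m) / L"] by linarith+
    then have "\<bar>s\<bar> \<le> ?r" by (metis max.cobounded2 order_trans real_sqrt_abs real_sqrt_le_iff)
    then have "n \<in> ?N" using s by (auto simp: freqs_def)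
    then show "p \<in> ?N \<times> box_modes L E" using p e by (auto simp: box_modes_def)
  qed
  then have "(\<Sum>\<mu>\<in>F. card (modes_at L \<mu>)) = (\<Sum>p\<in>?N \<times> box_modes L E. card {\<mu>\<in>F. p \<in> modes_at L \<mu>})"
    using F finN finM by (intro sum_card_modes_swap) auto
  also have "\<dots> \<le> (\<Sum>p\<in>?N \<times> box_modes L E. levels (E - ?h (snd p)))"
  proof (rule sum_mono)
    fix p assume "p \<in> ?N \<times> box_modes L E"
    let ?A = "{\<mu>\<in>F. p \<in> modes_at L \<mu>}" and ?k = "freq L (fst p)"
    have "card ((\<lambda>\<mu>. \<mu> - ?h (snd p)) ` ?A) \<le> levels (E - ?h (snd p))"
    proof (rule dirichlet_eigenvalues_le[OF _ less_two_levels])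
      show "?k < ?k + L" using L by simp
      show "(\<lambda>\<mu>. \<mu> - ?h (snd p)) ` ?A \<subseteq> {\<nu>. \<nu> \<le> E - ?h (snd p) \<and> dsol ?k \<nu> (?k + L) = 0}"
        using F by (auto simp: modes_at_def case_prod_unfold)
    qed (use F in auto)
    then show "card ?A \<le> levels (E - ?h (snd p))" by (subst (asm) card_image) (auto simp: inj_on_def)
  qed
  also have "\<dots> = (\<Sum>n\<in>?N. \<Sum>m\<in>box_modes L E. levels (E - ?h m))"
    by (subst sum.cartesian_product) (simp add: case_prod_unfold)
  also have "\<dots> = card ?N * states_per_freq L E" by (simp add: states_per_freq_def)
  finally show ?thesis .
qed

text \<open>
  Frequencies in \<open>{R - L..- R}\<close> have intervals containing \<open>{- R..R}\<close>. There the eigenvalues exceed the Landau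
  levels by at most \<open>\<epsilon>\<close>, which is compensated by lowering the energy.
\<close>

lemma sum_card_modes_ge:
  assumes L: "0 < L"
    and R: "\<And>J a b. J \<le> levels E \<Longrightarrow> a \<le> - R \<Longrightarrow> R \<le> b \<Longrightarrow>
      \<exists>S. finite S \<and> card S = J \<and> S \<subseteq> {\<nu>. \<nu> \<le> 2 * real J - 1 + \<epsilon> \<and> dsol a \<nu> b = 0}"
    and \<epsilon>: "0 < \<epsilon>"
  obtains F where "finite F" "F \<subseteq> {..E}"
    "card (freqs L (R - L) (- R)) * states_per_freq L (E - \<epsilon>) \<le> (\<Sum>\<mu>\<in>F. card (modes_at L \<mu>))"
proof -
  let ?N = "freqs L (R - L) (- R)" and ?M = "box_modes L (E - \<epsilon>)"
  let ?h = "\<lambda>m. (pi * real (Suc m) / L)\<^sup>2"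
  have finN: "finite ?N" and finM: "finite ?M" unfolding freqs_eq[OF L] box_modes_eq[OF L] by auto
  have ex: "\<exists>S. finite S \<and> card S = levels (E - \<epsilon> - ?h (snd p))
      \<and> S \<subseteq> {\<nu>. \<nu> \<le> E - ?h (snd p) \<and> dsol (freq L (fst p)) \<nu> (freq L (fst p) + L) = 0}" if "p \<in> ?N \<times> ?M" for p
  proof -
    let ?J = "levels (E - \<epsilon> - ?h (snd p))" and ?k = "freq L (fst p)"
    have "?k \<le> - R" "R \<le> ?k + L" using that by (auto simp: freqs_def)
    moreover have "?J \<le> levels E" 
      using \<epsilon> zero_le_power2[of "pi * real (Suc (snd p)) / L"] by (intro levels_mono) linarith
    ultimately obtain S where S: "finite S" "card S = ?J" "S \<subseteq> {\<nu>. \<nu> \<le> 2 * real ?J - 1 + \<epsilon> \<and> dsol ?k \<nu> (?k + L) = 0}"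
      using R by blast
    have "\<nu> \<le> E - ?h (snd p)" if "\<nu> \<in> S" for \<nu>
    proof -
      have "?J \<noteq> 0" using that S by (metis card_0_eq empty_iff)
      then have "?J - 1 < ?J" by simp
      then have "2 * real (?J - 1) + 1 \<le> E - \<epsilon> - ?h (snd p)" by (simp only: less_levels_iff)
      moreover have "real (?J - 1) = real ?J - 1" using \<open>?J \<noteq> 0\<close> by (simp add: of_nat_diff)
      ultimately show ?thesis using that S by auto
    qed
    then show ?thesis using S by (intro exI[of _ S]) auto
  qed
  have "\<forall>p\<in>?N \<times> ?M. \<exists>S. finite S \<and> card S = levels (E - \<epsilon> - ?h (snd p))
      \<and> S \<subseteq> {\<nu>. \<nu> \<le> E - ?h (snd p) \<and> dsol (freq L (fst p)) \<nu> (freq L (fst p) + L) = 0}"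
    by (rule ballI) (rule ex)
  from bchoice[OF this] obtain S where all: "\<forall>p\<in>?N \<times> ?M. finite (S p) \<and> card (S p) = levels (E - \<epsilon> - ?h (snd p))
      \<and> S p \<subseteq> {\<nu>. \<nu> \<le> E - ?h (snd p) \<and> dsol (freq L (fst p)) \<nu> (freq L (fst p) + L) = 0}"
    by (rule exE)
  have S: "finite (S p)" "card (S p) = levels (E - \<epsilon> - ?h (snd p))"
     "S p \<subseteq> {\<nu>. \<nu> \<le> E - ?h (snd p) \<and> dsol (freq L (fst p)) \<nu> (freq L (fst p) + L) = 0}"
    if "p \<in> ?N \<times> ?M" for p
    using bspec[OF all that] by (simp_all only: conj_assoc simp_thms)
  define F where "F = (\<Union>p\<in>?N \<times> ?M. (\<lambda>\<nu>. \<nu> + ?h (snd p)) ` S p)"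
  have F: "finite F" "F \<subseteq> {..E}"
  proof -
    show "finite F" unfolding F_def using finN finM S(1) by blast
    show "F \<subseteq> {..E}"
    proof
      fix \<mu> assume "\<mu> \<in> F"
      then obtain p \<nu> where p: "p \<in> ?N \<times> ?M" "\<nu> \<in> S p" "\<mu> = \<nu> + ?h (snd p)" unfolding F_def by blast
      then have "\<nu> \<le> E - ?h (snd p)" using S(3)[OF p(1)] by blast
      then show "\<mu> \<in> {..E}" using p(3) by simp
    qed
  qed
  define I where "I = (\<Union>\<mu>\<in>F. modes_at L \<mu>) \<union> ?N \<times> ?M"
  have finI: "finite I" unfolding I_def using F finN finM finite_modes_at[OF L] by auto
  have "card ?N * states_per_freq L (E - \<epsilon>) = (\<Sum>n\<in>?N. \<Sum>m\<in>?M. levels (E - \<epsilon> - ?h m))" by (simp add: states_per_freq_def)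
  also have "\<dots> = (\<Sum>p\<in>?N \<times> ?M. levels (E - \<epsilon> - ?h (snd p)))"
    by (subst sum.cartesian_product) (simp add: case_prod_unfold)
  also have "\<dots> \<le> (\<Sum>p\<in>?N \<times> ?M. card {\<mu>\<in>F. p \<in> modes_at L \<mu>})"
  proof (rule sum_mono)
    fix p assume p: "p \<in> ?N \<times> ?M"
    have "levels (E - \<epsilon> - ?h (snd p)) = card ((\<lambda>\<nu>. \<nu> + ?h (snd p)) ` S p)"
      using S(2)[OF p] by (simp add: card_image inj_on_def)
    also have "\<dots> \<le> card {\<mu>\<in>F. p \<in> modes_at L \<mu>}"
    proof (rule card_mono)
      have "(\<lambda>\<nu>. \<nu> + ?h (snd p)) ` S p \<subseteq> F" unfolding F_def using p by blast
      then show "(\<lambda>\<nu>. \<nu> + ?h (snd p)) ` S p \<subseteq> {\<mu>\<in>F. p \<in> modes_at L \<mu>}"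
        using S(3)[OF p] by (auto simp: modes_at_def case_prod_unfold)
    qed (use F in auto)
    finally show "levels (E - \<epsilon> - ?h (snd p)) \<le> card {\<mu>\<in>F. p \<in> modes_at L \<mu>}" .
  qed
  also have "\<dots> \<le> (\<Sum>p\<in>I. card {\<mu>\<in>F. p \<in> modes_at L \<mu>})"
    using finI by (intro sum_mono2) (auto simp: I_def)
  also have "\<dots> = (\<Sum>\<mu>\<in>F. card (modes_at L \<mu>))"
    using F finI by (intro sum_card_modes_swap[symmetric]) (auto simp: I_def)
  finally show ?thesis using that F by blast
qed

text \<open>
  The counting function is a supremum over finite sets of energies, for which both bounds apply.
\<close>

lemma landau_count_bounds:
  assumes L: "0 < L"
  shows "landau_count L E \<le> of_nat (card (freqs L (- L - sqrt (max 0 E)) (sqrt (max 0 E))) * states_per_freq L E)"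
    and "finite F \<Longrightarrow> F \<subseteq> {..E} \<Longrightarrow> of_nat (\<Sum>\<mu>\<in>F. card (modes_at L \<mu>)) \<le> landau_count L E"
proof -
  have eq: "landau_count L E = (SUP F\<in>{F. finite F \<and> F \<subseteq> {..E}}. (\<Sum>\<mu>\<in>F. multiplicity_at L \<mu>))"
    unfolding landau_count_def by (rule nonneg_infsum_complete) simp
  have s: "(\<Sum>\<mu>\<in>F. multiplicity_at L \<mu>) = of_nat (\<Sum>\<mu>\<in>F. card (modes_at L \<mu>))" for F
    by (simp add: multiplicity_at_eq[OF L])
  show "landau_count L E \<le> of_nat (card (freqs L (- L - sqrt (max 0 E)) (sqrt (max 0 E))) * states_per_freq L E)"
    unfolding eq s by (rule SUP_least) (use sum_card_modes_le[OF L] in \<open>auto intro: of_nat_mono simp del: of_nat_mult of_nat_sum\<close>)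
  show "of_nat (\<Sum>\<mu>\<in>F. card (modes_at L \<mu>)) \<le> landau_count L E" if "finite F" "F \<subseteq> {..E}"
    unfolding eq s[symmetric] by (rule SUP_upper) (use that in auto)
qed

section \<open>The limit of large cubes\<close>

definition level_sum :: "real \<Rightarrow> real" where
  "level_sum E = (\<Sum>j<levels E. sqrt (max 0 (E - (2 * real j + 1))))"

lemma tendsto_card_box_modes: "((\<lambda>L. real (card (box_modes L e)) / L) \<longlongrightarrow> sqrt (max 0 e) / pi) at_top"
proof (rule tendsto_sandwich)
  let ?s = "sqrt (max 0 e)"
  have b: "L * ?s / pi - 1 \<le> real (card (box_modes L e))" "real (card (box_modes L e)) \<le> L * ?s / pi" if L: "0 < L" for L
  proof -
    have "card (box_modes L e) = nat \<lfloor>L * ?s / pi\<rfloor>" by (simp add: box_modes_eq[OF L])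
    moreover have "0 \<le> L * ?s / pi" using L by simp
    ultimately show "L * ?s / pi - 1 \<le> real (card (box_modes L e))" "real (card (box_modes L e)) \<le> L * ?s / pi" by linarith+
  qed
  show "\<forall>\<^sub>F L in at_top. ?s / pi - 1 / L \<le> real (card (box_modes L e)) / L"
    using eventually_gt_at_top[of 0]
  proof eventually_elim
    case (elim L)
    have "(L * ?s / pi - 1) / L \<le> real (card (box_modes L e)) / L" using elim b by (intro divide_right_mono) auto
    then show ?case using elim by (simp add: diff_divide_distrib)
  qed
  show "\<forall>\<^sub>F L in at_top. real (card (box_modes L e)) / L \<le> ?s / pi"
    using eventually_gt_at_top[of 0]
  proof eventually_elim
    case (elim L)
    have "real (card (box_modes L e)) / L \<le> (L * ?s / pi) / L" using elim b by (intro divide_right_mono) auto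
    then show ?case using elim by simp
  qed
  have "((\<lambda>L::real. 1 / L) \<longlongrightarrow> 0) at_top" by real_asymp
  then show "((\<lambda>L. ?s / pi - 1 / L) \<longlongrightarrow> ?s / pi) at_top" using tendsto_diff[OF tendsto_const] by fastforce
qed simp

lemma tendsto_states_per_freq:
  assumes "levels e \<le> K"
  shows "((\<lambda>L. real (states_per_freq L e) / L) \<longlongrightarrow> (\<Sum>j<K. sqrt (max 0 (e - (2 * real j + 1)))) / pi) at_top"
proof -
  have "((\<lambda>L. \<Sum>j<K. real (card (box_modes L (e - (2 * real j + 1)))) / L) \<longlongrightarrow> (\<Sum>j<K. sqrt (max 0 (e - (2 * real j + 1))) / pi)) at_top"
    by (intro tendsto_sum tendsto_card_box_modes)
  moreover have "\<forall>\<^sub>F L in at_top. (\<Sum>j<K. real (card (box_modes L (e - (2 * real j + 1)))) / L) = real (states_per_freq L e) / L"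
    using eventually_gt_at_top[of 0]
    by eventually_elim (simp add: states_per_freq_eq[OF _ assms] sum_divide_distrib)
  ultimately show ?thesis by (simp add: filterlim_cong sum_divide_distrib)
qed

lemma tendsto_card_freqs: "((\<lambda>L. real (card (freqs L (c - L) d)) / L\<^sup>2) \<longlongrightarrow> 1 / (2 * pi)) at_top"
proof (rule tendsto_sandwich)
  have half: "1 / (2 * pi) = inverse pi / 2" by (simp add: inverse_eq_divide)
  show "\<forall>\<^sub>F L in at_top. ((d - (c - L)) * L / (2 * pi) - 1) / L\<^sup>2 \<le> real (card (freqs L (c - L) d)) / L\<^sup>2"
    using eventually_gt_at_top[of 0]
    by eventually_elim (intro divide_right_mono card_freqs, auto)
  show "\<forall>\<^sub>F L in at_top. real (card (freqs L (c - L) d)) / L\<^sup>2 \<le> ((d - (c - L)) * L / (2 * pi) + 1) / L\<^sup>2"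
    using eventually_gt_at_top[of "max 0 (c - d)"]
    by eventually_elim (intro divide_right_mono card_freqs, auto)
  show "((\<lambda>L. ((d - (c - L)) * L / (2 * pi) - 1) / L\<^sup>2) \<longlongrightarrow> 1 / (2 * pi)) at_top"
    unfolding half using pi_gt_zero by real_asymp
  show "((\<lambda>L. ((d - (c - L)) * L / (2 * pi) + 1) / L\<^sup>2) \<longlongrightarrow> 1 / (2 * pi)) at_top"
    unfolding half using pi_gt_zero by real_asymp
qed

text \<open>Only finitely many levels matter, so a single radius serves for all of them.\<close>

lemma exists_uniform_radius:
  assumes "0 < \<epsilon>"
  obtains R where "\<And>J a b. J \<le> (K::nat) \<Longrightarrow> a \<le> - R \<Longrightarrow> R \<le> b \<Longrightarrow>
      \<exists>S. finite S \<and> card S = J \<and> S \<subseteq> {\<nu>. \<nu> \<le> 2 * real J - 1 + \<epsilon> \<and> dsol a \<nu> b = 0}"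
proof -
  have "\<forall>J. \<exists>R\<ge>1. \<forall>a b. a \<le> - R \<longrightarrow> R \<le> b \<longrightarrow>
      (\<exists>S. finite S \<and> card S = J \<and> S \<subseteq> {\<nu>. \<nu> \<le> 2 * real J - 1 + \<epsilon> \<and> dsol a \<nu> b = 0})"
    using assms by (intro allI dirichlet_eigenvalues_ge) simp
  from choice[OF this] obtain R where R: "\<And>J a b. a \<le> - R J \<Longrightarrow> R J \<le> b \<Longrightarrow>
      \<exists>S. finite S \<and> card S = J \<and> S \<subseteq> {\<nu>. \<nu> \<le> 2 * real J - 1 + \<epsilon> \<and> dsol a \<nu> b = 0}"
    by blast
  show ?thesis
  proof (rule that)
    fix J a b assume J: "J \<le> K" "a \<le> - Max (R ` {..K})" "Max (R ` {..K}) \<le> b"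
    have "R J \<le> Max (R ` {..K})" using J by (intro Max_ge) auto
    then show "\<exists>S. finite S \<and> card S = J \<and> S \<subseteq> {\<nu>. \<nu> \<le> 2 * real J - 1 + \<epsilon> \<and> dsol a \<nu> b = 0}"
      using J by (intro R) linarith+
  qed
qed

text \<open>
  The frequency ranges of both bounds differ from one of length \<open>L\<close> by constants, which do not
  affect the limit. The loss \<open>\<epsilon>\<close> in the lower bound is removed by continuity of the limit in the energy.
\<close>

lemma tendsto_landau_count:
  "((\<lambda>L. landau_count L E / ennreal (L ^ 3)) \<longlongrightarrow> ennreal (level_sum E / (2 * pi\<^sup>2))) at_top"
proof -
  define c where "c L = enn2real (landau_count L E)" for L
  have fin: "landau_count L E = ennreal (c L)" if "0 < L" for L
  proof -
    have "landau_count L E \<noteq> top" using le_less_trans[OF landau_count_bounds(1)[OF that, of E] of_nat_less_top] by auto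
    then show ?thesis by (simp add: c_def less_top)
  qed
  have ofn: "ennreal (real n) = of_nat n" for n by (simp add: ennreal_of_nat_eq_real_of_nat)
  let ?r = "sqrt (max 0 E)"
  have up: "c L \<le> real (card (freqs L (- ?r - L) ?r)) * real (states_per_freq L E)" if L: "0 < L" for L
  proof -
    have "ennreal (c L) \<le> ennreal (real (card (freqs L (- ?r - L) ?r) * states_per_freq L E))"
      using landau_count_bounds(1)[OF L, of E] unfolding fin[OF L, symmetric] ofn
      by (simp only: diff_conv_add_uminus add.commute)
    then show ?thesis by (simp add: ennreal_le_iff del: ennreal_mult_eq_top_iff)
  qed
  have lim: "((\<lambda>L. c L / L ^ 3) \<longlongrightarrow> level_sum E / (2 * pi\<^sup>2)) at_top"
  proof (rule order_tendstoI)
    fix a assume a: "level_sum E / (2 * pi\<^sup>2) < a"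
    have "((\<lambda>L. real (card (freqs L (- ?r - L) ?r)) / L\<^sup>2 * (real (states_per_freq L E) / L)) \<longlongrightarrow> 1 / (2 * pi) * (level_sum E / pi)) at_top"
      unfolding level_sum_def by (intro tendsto_mult tendsto_card_freqs tendsto_states_per_freq) simp
    moreover have "1 / (2 * pi) * (level_sum E / pi) < a" using a by (simp add: power2_eq_square)
    ultimately have "\<forall>\<^sub>F L in at_top. real (card (freqs L (- ?r - L) ?r)) / L\<^sup>2 * (real (states_per_freq L E) / L) < a"
      by (rule order_tendstoD)
    with eventually_gt_at_top[of 0] show "\<forall>\<^sub>F L in at_top. c L / L ^ 3 < a"
    proof eventually_elim
      case (elim L)
      have "c L / L ^ 3 \<le> real (card (freqs L (- ?r - L) ?r)) * real (states_per_freq L E) / L ^ 3"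
        using up elim by (intro divide_right_mono) auto
      also have "\<dots> = real (card (freqs L (- ?r - L) ?r)) / L\<^sup>2 * (real (states_per_freq L E) / L)"
        by (simp add: power2_eq_square power3_eq_cube)
      finally show ?case using elim by simp
    qed
  next
    fix a assume a: "a < level_sum E / (2 * pi\<^sup>2)"
    let ?K = "levels E"
    let ?f = "\<lambda>\<epsilon>. (\<Sum>j<?K. sqrt (max 0 (E - \<epsilon> - (2 * real j + 1))))"
    have "isCont ?f 0" by (intro continuous_intros)
    then have "(?f \<longlongrightarrow> level_sum E) (at_right 0)"
      unfolding isCont_def level_sum_def by (simp add: filterlim_at_split)
    moreover have "a * (2 * pi\<^sup>2) < level_sum E" using a by (simp add: pos_less_divide_eq)
    ultimately have "\<forall>\<^sub>F \<epsilon> in at_right 0. a * (2 * pi\<^sup>2) < ?f \<epsilon>" by (rule order_tendstoD)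
    moreover have "\<forall>\<^sub>F \<epsilon> in at_right 0. 0 < (\<epsilon>::real)" by (simp add: eventually_at_right_less)
    ultimately have "\<forall>\<^sub>F \<epsilon> in at_right 0. 0 < \<epsilon> \<and> a * (2 * pi\<^sup>2) < ?f \<epsilon>" by eventually_elim simp
    then obtain \<epsilon> where \<epsilon>: "0 < \<epsilon>" "a * (2 * pi\<^sup>2) < ?f \<epsilon>"
      by (auto dest!: eventually_happens)
    obtain R where R: "\<And>J a b. J \<le> ?K \<Longrightarrow> a \<le> - R \<Longrightarrow> R \<le> b \<Longrightarrow>
      \<exists>S. finite S \<and> card S = J \<and> S \<subseteq> {\<nu>. \<nu> \<le> 2 * real J - 1 + \<epsilon> \<and> dsol a \<nu> b = 0}"
      by (rule exists_uniform_radius[OF \<epsilon>(1), of ?K]) (rule that)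
    have "levels (E - \<epsilon>) \<le> ?K" using \<epsilon> by (intro levels_mono) simp
    then have "((\<lambda>L. real (card (freqs L (R - L) (- R))) / L\<^sup>2 * (real (states_per_freq L (E - \<epsilon>)) / L)) \<longlongrightarrow> 1 / (2 * pi) * (?f \<epsilon> / pi)) at_top"
      by (intro tendsto_mult tendsto_card_freqs tendsto_states_per_freq)
    moreover have "a < 1 / (2 * pi) * (?f \<epsilon> / pi)"
    proof -
      have "a < ?f \<epsilon> / (2 * pi\<^sup>2)" using \<epsilon>(2) by (subst pos_less_divide_eq) simp_all
      then show ?thesis by (simp add: power2_eq_square)
    qed
    ultimately have "\<forall>\<^sub>F L in at_top. a < real (card (freqs L (R - L) (- R))) / L\<^sup>2 * (real (states_per_freq L (E - \<epsilon>)) / L)"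
      by (rule order_tendstoD)
    with eventually_gt_at_top[of 0] show "\<forall>\<^sub>F L in at_top. a < c L / L ^ 3"
    proof eventually_elim
      case (elim L)
      then have L: "0 < L" by simp
      obtain F where F: "finite F" "F \<subseteq> {..E}"
        "card (freqs L (R - L) (- R)) * states_per_freq L (E - \<epsilon>) \<le> (\<Sum>\<mu>\<in>F. card (modes_at L \<mu>))"
        by (rule sum_card_modes_ge[OF L R \<epsilon>(1)])
      have "ennreal (real (card (freqs L (R - L) (- R)) * states_per_freq L (E - \<epsilon>))) \<le> ennreal (c L)"
        unfolding fin[OF L, symmetric] ofn
        by (rule order_trans[OF of_nat_mono[OF F(3)] landau_count_bounds(2)[OF L F(1,2)]])
      then have "real (card (freqs L (R - L) (- R)) * states_per_freq L (E - \<epsilon>)) \<le> c L"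
        by (subst (asm) ennreal_le_iff) (auto simp: c_def)
      then have "real (card (freqs L (R - L) (- R))) * real (states_per_freq L (E - \<epsilon>)) / L ^ 3 \<le> c L / L ^ 3"
        using L by (intro divide_right_mono) auto
      moreover have "real (card (freqs L (R - L) (- R))) * real (states_per_freq L (E - \<epsilon>)) / L ^ 3
          = real (card (freqs L (R - L) (- R))) / L\<^sup>2 * (real (states_per_freq L (E - \<epsilon>)) / L)"
        by (simp add: power2_eq_square power3_eq_cube)
      ultimately show ?case using elim by linarith
    qed
  qed
  have "\<forall>\<^sub>F L in at_top. ennreal (c L / L ^ 3) = landau_count L E / ennreal (L ^ 3)"
    using eventually_gt_at_top[of 0]
  proof eventually_elim
    case (elim L)
    then show ?case unfolding fin[OF elim] by (simp add: divide_ennreal c_def)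
  qed
  then show ?thesis using tendsto_ennrealI[OF lim] by (simp add: filterlim_cong)
qed

lemma landau_ids_eq: "landau_ids E = level_sum E / (2 * pi\<^sup>2)"
proof -
  have "Lim at_top (\<lambda>L. landau_count L E / ennreal (L ^ 3)) = ennreal (level_sum E / (2 * pi\<^sup>2))"
    by (rule tendsto_Lim[OF _ tendsto_landau_count]) simp
  moreover have "0 \<le> level_sum E" unfolding level_sum_def by (intro sum_nonneg) auto
  ultimately show ?thesis by (simp add: landau_ids_def)
qed

section \<open>The sum over the Landau levels\<close>

text \<open>
  The mean value of the square root over \<open>{y..y + 2}\<close> is at most its value in the middle by concavity,
  and at least the trapezoidal value. The difference of these two is half the second difference
  \<open>(sqrt (y + 1) - sqrt y) - (sqrt (y + 2) - sqrt (y + 1))\<close>. Replacing its last increment by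
  the smaller one over \<open>{y + 2..y + 3}\<close> makes it telescope in steps of length 2.
\<close>

lemma midpoint_sqrt:
  fixes y :: real
  assumes y: "0 \<le> y"
  shows "((y + 2) * sqrt (y + 2) - y * sqrt y) / 3 \<le> sqrt (y + 1)"
    and "sqrt (y + 1) \<le> ((y + 2) * sqrt (y + 2) - y * sqrt y) / 3
      + ((sqrt (y + 1) - sqrt y) - (sqrt (y + 3) - sqrt (y + 2))) / 2"
proof -
  define p where "p = sqrt (y + 2)"
  define q where "q = sqrt y"
  define r where "r = sqrt (y + 1)"
  define A where "A = (p ^ 3 - q ^ 3) / 3"
  have p2: "p\<^sup>2 = y + 2" and q2: "q\<^sup>2 = y" and r2: "r\<^sup>2 = y + 1" using y by (auto simp: p_def q_def r_def)
  have pos: "0 < p" "0 \<le> q" "0 < r" using y by (auto simp: p_def q_def r_def)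
  have A: "((y + 2) * sqrt (y + 2) - y * sqrt y) / 3 = A"
  proof -
    have "p ^ 3 = (y + 2) * p" "q ^ 3 = y * q" using p2 q2 by (simp_all add: power3_eq_cube power2_eq_square)
    then show ?thesis by (simp add: A_def p_def q_def)
  qed
  \<comment> \<open>The squares of p and q differ by 2, which makes the mean value A a rational function of p and q.\<close>
  have Apq: "A * (3 * (p + q)) = 2 * (p\<^sup>2 + p * q + q\<^sup>2)"
  proof -
    have "A * (3 * (p + q)) = (3 * A) * (p + q)" by simp
    also have "3 * A = p ^ 3 - q ^ 3" by (simp add: A_def)
    also have "(p ^ 3 - q ^ 3) * (p + q) = (p\<^sup>2 - q\<^sup>2) * (p\<^sup>2 + p * q + q\<^sup>2)"
      by (simp add: power2_eq_square power3_eq_cube algebra_simps)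
    finally show ?thesis by (simp add: p2 q2)
  qed
  have pq: "0 < 3 * (p + q)" using pos by simp
  have low: "(p + q) / 2 \<le> A"
  proof -
    have "0 \<le> (p - q)\<^sup>2" by simp
    then have "3 * ((p + q) * (p + q)) \<le> 2 * (2 * (p\<^sup>2 + p * q + q\<^sup>2))"
      by (simp add: power2_eq_square algebra_simps)
    moreover have "(p + q) / 2 * (3 * (p + q)) = 3 * ((p + q) * (p + q)) / 2" by simp
    ultimately have "(p + q) / 2 * (3 * (p + q)) \<le> A * (3 * (p + q))"
      unfolding Apq by linarith
    then show ?thesis using pq by (rule mult_right_le_imp_le)
  qed
  have "A \<le> r"
  proof -
    define s where "s = p\<^sup>2 + q\<^sup>2"
    define t where "t = p * q"
    have t: "0 \<le> t" "2 * t \<le> s" using pos zero_le_power2[of "p - q"] by (auto simp: s_def t_def power2_eq_square algebra_simps)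
    have rs: "r\<^sup>2 = s / 2" by (simp add: s_def p2 q2 r2)
    have "4 * t * (2 * t) \<le> 4 * t * s" using t by (intro mult_left_mono) auto
    moreover have "s * (2 * t) \<le> s * s" using t by (intro mult_left_mono) auto
    ultimately have "8 * (s + t)\<^sup>2 \<le> 9 * (s * (s + 2 * t))" by (simp add: power2_eq_square algebra_simps)
    then have "(2 * (s + t))\<^sup>2 \<le> r\<^sup>2 * (9 * (s + 2 * t))" unfolding rs by (simp add: power2_eq_square algebra_simps)
    also have "\<dots> = (r * (3 * (p + q)))\<^sup>2" by (simp add: s_def t_def power2_eq_square algebra_simps)
    finally have "2 * (s + t) \<le> r * (3 * (p + q))" by (rule power2_le_imp_le) (use pos in simp)
    then have "A * (3 * (p + q)) \<le> r * (3 * (p + q))" unfolding Apq by (simp add: s_def t_def algebra_simps)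
    then show ?thesis using pq by (rule mult_right_le_imp_le)
  qed
  then show "((y + 2) * sqrt (y + 2) - y * sqrt y) / 3 \<le> sqrt (y + 1)" unfolding A r_def .
  define v where "v = sqrt (y + 3)"
  have "(v + r) / 2 \<le> p"
  proof (rule power2_le_imp_le)
    have v2: "v\<^sup>2 = y + 3" using y by (simp add: v_def)
    have "0 \<le> (v - r)\<^sup>2" by simp
    then have "2 * (v * r) \<le> v\<^sup>2 + r\<^sup>2" by (simp add: power2_eq_square algebra_simps)
    moreover have "((v + r) / 2)\<^sup>2 = (v\<^sup>2 + r\<^sup>2 + 2 * (v * r)) / 4" by (simp add: power2_eq_square algebra_simps add_divide_distrib)
    ultimately show "((v + r) / 2)\<^sup>2 \<le> p\<^sup>2" by (simp add: p2 v2 r2)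
  qed (use pos in auto)
  then have "v + r \<le> 2 * p" by simp
  then have "r \<le> A + ((r - q) - (v - p)) / 2" using low by (simp add: field_simps)
  then show "sqrt (y + 1) \<le> ((y + 2) * sqrt (y + 2) - y * sqrt y) / 3
      + ((sqrt (y + 1) - sqrt y) - (sqrt (y + 3) - sqrt (y + 2))) / 2"
    unfolding A by (simp add: p_def q_def r_def v_def)
qed

lemma sum_sqrt_bounds:
  fixes E :: real
  assumes "2 * real n \<le> E"
  shows "(E * sqrt E - (E - 2 * real n) * sqrt (E - 2 * real n)) / 3 \<le> (\<Sum>j<n. sqrt (E - (2 * real j + 1)))"
    and "(\<Sum>j<n. sqrt (E - (2 * real j + 1))) \<le> (E * sqrt E - (E - 2 * real n) * sqrt (E - 2 * real n)) / 3
      + ((sqrt (E - 2 * real n + 1) - sqrt (E - 2 * real n)) - (sqrt (E + 1) - sqrt E)) / 2"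
  using assms
proof (induction n)
  case (Suc n)
  define y where "y = E - 2 * real (Suc n)"
  have y: "0 \<le> y" and le: "2 * real n \<le> E" if "2 * real (Suc n) \<le> E" using that by (simp_all add: y_def)
  have e: "E - 2 * real (Suc n) = y" "E - 2 * real n = y + 2" "E - (2 * real n + 1) = y + 1" "y + 2 + 1 = y + 3"
    by (simp_all add: y_def)
  note IH = Suc.IH[unfolded e]
  have telescope: "(a - b) / 3 + (b - c) / 3 = (a - c) / 3"
    "(a - b) / 3 + (u - v) / 2 + ((b - c) / 3 + (w - u) / 2) = (a - c) / 3 + (w - v) / 2" for a b c u v w :: real
    by (simp_all add: field_simps)
  { case 1
    show ?case using add_mono[OF IH(1)[OF le[OF 1]] midpoint_sqrt(1)[OF y[OF 1]]]
      unfolding e sum.lessThan_Suc telescope .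
  next
    case 2
    show ?case using add_mono[OF IH(2)[OF le[OF 2]] midpoint_sqrt(2)[OF y[OF 2]]]
      unfolding e sum.lessThan_Suc telescope .
  }
qed simp_all

text \<open>
  The midpoint rule covers all levels but the highest one. The interval that remains has length below 3, so
  that the last summand, the remaining integral and the telescoped differences are all bounded.
\<close>

lemma level_sum_asymptotics:
  assumes E: "1 \<le> E"
  shows "\<bar>level_sum E - E * sqrt E / 3\<bar> \<le> 5"
proof -
  have "0 < levels E" unfolding less_levels_iff using E by simp
  then obtain n where n: "levels E = Suc n" by (metis gr0_implies_Suc)
  have lo: "2 * real n + 1 \<le> E" using less_levels_iff[of n E] n by simp
  have hi: "E < 2 * real n + 3" using less_two_levels[of E] n by simp
  have "max 0 (E - (2 * real j + 1)) = E - (2 * real j + 1)" if "j < levels E" for j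
    using that less_levels_iff[of j E] by simp
  then have "level_sum E = (\<Sum>j<levels E. sqrt (E - (2 * real j + 1)))" unfolding level_sum_def by (intro sum.cong) auto
  then have ls: "level_sum E = (\<Sum>j<n. sqrt (E - (2 * real j + 1))) + sqrt (E - (2 * real n + 1))" by (simp add: n)
  define x where "x = E - 2 * real n"
  have x: "1 \<le> x" "x < 3" using lo hi by (auto simp: x_def)
  have s2: "0 \<le> sqrt (E - (2 * real n + 1))" "sqrt (E - (2 * real n + 1)) \<le> 2"
    using lo hi by (auto intro!: real_le_lsqrt)
  have sx: "0 \<le> sqrt x" "sqrt x \<le> 2" "sqrt (x + 1) \<le> 2" using x by (auto intro!: real_le_lsqrt)
  have xx: "0 \<le> x * sqrt x" "x * sqrt x \<le> 3 * 2" using x sx by (simp, intro mult_mono) auto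
  have sE: "sqrt E \<le> sqrt (E + 1)" by simp
  have n2: "2 * real n \<le> E" using lo by simp
  note b = sum_sqrt_bounds[OF n2, folded x_def]
  have "\<bar>s + r - e / 3\<bar> \<le> 5" 
    if "(e - y) / 3 \<le> s" "s \<le> (e - y) / 3 + (u - v - (w - z)) / 2" "0 \<le> r" "r \<le> 2" "0 \<le> v" "u \<le> 2" "0 \<le> y" "y \<le> 3 * 2" "z \<le> w"
    for s r e y u v w z :: real
    using that by (simp add: field_simps abs_le_iff)
  from this[OF b s2 sx(1,3) xx sE] show ?thesis unfolding ls .
qed

theorem corollary1p7:
  shows "(\<forall>E. ((\<lambda>L. landau_count L E / ennreal (L ^ 3)) \<longlongrightarrow> ennreal (landau_ids E)) at_top)
    \<and> (\<lambda>E. landau_ids E - 1 / (6 * pi\<^sup>2) * E powr (3 / 2)) \<in> O[at_top](\<lambda>_. 1)"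
proof (intro conjI allI)
  show "((\<lambda>L. landau_count L E / ennreal (L ^ 3)) \<longlongrightarrow> ennreal (landau_ids E)) at_top" for E
    unfolding landau_ids_eq by (rule tendsto_landau_count)
  show "(\<lambda>E. landau_ids E - 1 / (6 * pi\<^sup>2) * E powr (3 / 2)) \<in> O[at_top](\<lambda>_. 1)"
  proof (rule bigoI[where c = "5 / (2 * pi\<^sup>2)"])
    show "\<forall>\<^sub>F E in at_top. norm (landau_ids E - 1 / (6 * pi\<^sup>2) * E powr (3 / 2)) \<le> 5 / (2 * pi\<^sup>2) * norm (1 :: real)"
      using eventually_ge_at_top[of 1]
    proof eventually_elim
      case (elim E)
      have "E powr (3 / 2) = E powr (1 + 1 / 2)" by simp
      also have "\<dots> = E * sqrt E" using elim by (simp only: powr_add) (simp add: powr_half_sqrt)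
      finally have p: "E powr (3 / 2) = E * sqrt E" .
      have "landau_ids E - 1 / (6 * pi\<^sup>2) * E powr (3 / 2) = (level_sum E - E * sqrt E / 3) / (2 * pi\<^sup>2)"
        unfolding landau_ids_eq p by (simp add: diff_divide_distrib)
      then have "norm (landau_ids E - 1 / (6 * pi\<^sup>2) * E powr (3 / 2)) = \<bar>level_sum E - E * sqrt E / 3\<bar> / (2 * pi\<^sup>2)"
        by (simp add: abs_divide)
      also have "\<dots> \<le> 5 / (2 * pi\<^sup>2)" using level_sum_asymptotics[OF elim] by (intro divide_right_mono) auto
      finally show ?case by simp
    qed
  qed
qed

end
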